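(* Let $p\ge 2$ be an integer, $N\ge 1$, $0<c_1<\dots<c_N$, $x_1,\dots,x_N\in\mathbb{R}$, and let $u$ be a multi-soliton in $+\infty$ of the generalized Korteweg-de Vries equation $\partial_t u+\partial_x(\partial_x^2u+u^p)=0$ associated with the solitons $R_{c_j,x_j}$, $j=1,\dots,N$, defined on $[T_0,+\infty)$ with $T_0\ge 0$ (see context). Let $\beta>c_N$. Then there exist $T_1>0$ with $T_1\ge T_0$, and $\kappa>0$, such that for all $s\in\mathbb{N}$: (1) there exists $C_s>0$ such that for all $t\ge T_1$ and all $x\le \beta t$, $$\left|\partial_x^s u(t,x)\right|\le C_s\sum_{j=1}^N e^{-\kappa|x-c_jt|};$$ (2) for all $n\in\mathbb{N}$ there exists $C_{s,n}>0$ such that for all $t\ge T_1$ and all $x>\beta t$, $$\left|\partial_x^s u(t,x)\right|\le \frac{C_{s,n}}{(x-\beta t)^n}.$$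
   Context: $\mathbb{N}=\{0,1,2,\dots\}$. Unknowns are real-valued functions of $(t,x)\in\mathbb{R}\times\mathbb{R}$. Solitons: $Q(x)=\left(\frac{p+1}{2\cosh^2\left(\frac{p-1}{2}x\right)}\right)^{\frac1{p-1}}$ is the positive $H^1$ solution of $Q''+Q^p=Q$; for $c>0$, $Q_c(x)=c^{\frac1{p-1}}Q(\sqrt c\,x)$; and for $c>0$, $x_0\in\mathbb{R}$, $R_{c,x_0}(t,x)=Q_c(x-ct-x_0)$, which solves the equation. Multi-soliton: a multi-soliton in $+\infty$ associated with the $R_{c_j,x_j}$ is an $H^1$-solution $u$ of the equation defined in a neighborhood of $+\infty$ such that $\|u(t)-\sum_{j=1}^N R_{c_j,x_j}(t)\|_{H^1}\to 0$ as $t\to+\infty$. By a known theorem (Martel; Côte–Martel–Merle; Combet), which is part of the setting here, there are $T_0\ge 0$, $\theta>0$ and constants $\lambda_s>0$ such that $u\in\mathscr{C}([T_0,+\infty),H^s(\mathbb{R}))$ for all $s\ge 0$ and, for all $s\ge0$ and $t\ge T_0$, $\|u(t)-\sum_{j=1}^N R_{c_j,x_j}(t)\|_{H^s}\le\lambda_s e^{-\theta t}$. These properties may be taken as assumptions on $u$. *)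

theory Defs
  imports "HOL-Analysis.Analysis"
begin

section \<open>Integer-order Sobolev spaces on the real line\<close>

definition test_function :: "(real \<Rightarrow> real) \<Rightarrow> bool" where
  "test_function \<phi> \<longleftrightarrow>
     (\<forall>k x. ((deriv ^^ k) \<phi>) differentiable (at x)) \<and>
     (\<exists>r. \<forall>x. r < \<bar>x\<bar> \<longrightarrow> \<phi> x = 0)"

definition L2 :: "(real \<Rightarrow> real) \<Rightarrow> bool" where
  "L2 f \<longleftrightarrow> f \<in> borel_measurable lborel \<and> integrable lborel (\<lambda>x. (f x)\<^sup>2)"

definition has_weak_deriv :: "nat \<Rightarrow> (real \<Rightarrow> real) \<Rightarrow> (real \<Rightarrow> real) \<Rightarrow> bool" where
  "has_weak_deriv k f g \<longleftrightarrow>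
     (\<forall>\<phi>. test_function \<phi> \<longrightarrow>
        (LINT x|lborel. f x * (deriv ^^ k) \<phi> x) = (-1) ^ k * (LINT x|lborel. g x * \<phi> x))"

definition sobolev :: "nat \<Rightarrow> (real \<Rightarrow> real) \<Rightarrow> bool" where
  "sobolev s f \<longleftrightarrow> L2 f \<and> (\<forall>k\<le>s. \<exists>g. L2 g \<and> has_weak_deriv k f g)"

text \<open>An \<open>L\<^sup>2\<close> weak derivative is unique up to null sets, so the choice below
  does not affect the norm.\<close>

definition weak_deriv :: "nat \<Rightarrow> (real \<Rightarrow> real) \<Rightarrow> real \<Rightarrow> real" where
  "weak_deriv k f = (SOME g. L2 g \<and> has_weak_deriv k f g)"

text \<open>Meaningful only for \<open>f\<close> satisfying \<open>sobolev s f\<close>.\<close>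

definition sobolev_norm :: "nat \<Rightarrow> (real \<Rightarrow> real) \<Rightarrow> real" where
  "sobolev_norm s f = sqrt (\<Sum>k\<le>s. LINT x|lborel. (weak_deriv k f x)\<^sup>2)"

text \<open>\<open>u \<in> C(I, H\<^sup>s)\<close>; here and below \<open>u t x\<close> is the value at time \<open>t\<close> and
  position \<open>x\<close>.\<close>

definition continuous_in_sobolev :: "nat \<Rightarrow> real set \<Rightarrow> (real \<Rightarrow> real \<Rightarrow> real) \<Rightarrow> bool" where
  "continuous_in_sobolev s I u \<longleftrightarrow>
     (\<forall>t\<in>I. sobolev s (u t)) \<and>
     (\<forall>t\<in>I. ((\<lambda>\<tau>. sobolev_norm s (\<lambda>x. u \<tau> x - u t x)) \<longlongrightarrow> 0) (at t within I))"


section \<open>The generalized Korteweg-de Vries equation\<close>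

text \<open>An \<open>H\<^sup>1\<close>-solution is an element of \<open>C(I, H\<^sup>1)\<close> satisfying
  \<open>\<partial>\<^sub>t u + \<partial>\<^sub>x (\<partial>\<^sub>x\<^sup>2 u + u\<^sup>p) = 0\<close> in the sense of distributions in \<open>x\<close>: the pairing
  with a test function is differentiable in time, and all \<open>x\<close>-derivatives in the equation
  are moved to the test function.\<close>

definition H1_solution :: "nat \<Rightarrow> real set \<Rightarrow> (real \<Rightarrow> real \<Rightarrow> real) \<Rightarrow> bool" where
  "H1_solution p I u \<longleftrightarrow>
     continuous_in_sobolev 1 I u \<and>
     (\<forall>\<phi>. test_function \<phi> \<longrightarrow> (\<forall>t\<in>I.
        ((\<lambda>\<tau>. LINT x|lborel. u \<tau> x * \<phi> x) has_real_derivative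
          (LINT x|lborel. u t x * (deriv ^^ 3) \<phi> x + u t x ^ p * deriv \<phi> x)) (at t within I)))"

definition ground_state :: "nat \<Rightarrow> real \<Rightarrow> real" where
  "ground_state p x =
     ((real p + 1) / (2 * (cosh ((real p - 1) / 2 * x))\<^sup>2)) powr (1 / (real p - 1))"

definition scaled_ground_state :: "nat \<Rightarrow> real \<Rightarrow> real \<Rightarrow> real" where
  "scaled_ground_state p c x = c powr (1 / (real p - 1)) * ground_state p (sqrt c * x)"

definition soliton :: "nat \<Rightarrow> real \<Rightarrow> real \<Rightarrow> real \<Rightarrow> real \<Rightarrow> real" where
  "soliton p c x0 t x = scaled_ground_state p c (x - c * t - x0)"

definition soliton_sum ::
  "nat \<Rightarrow> nat \<Rightarrow> (nat \<Rightarrow> real) \<Rightarrow> (nat \<Rightarrow> real) \<Rightarrow> real \<Rightarrow> real \<Rightarrow> real" where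
  "soliton_sum p N c x0 t x = (\<Sum>j=1..N. soliton p (c j) (x0 j) t x)"

definition multi_soliton ::
  "nat \<Rightarrow> nat \<Rightarrow> (nat \<Rightarrow> real) \<Rightarrow> (nat \<Rightarrow> real) \<Rightarrow> real \<Rightarrow> (real \<Rightarrow> real \<Rightarrow> real) \<Rightarrow> bool" where
  "multi_soliton p N c x0 T0 u \<longleftrightarrow>
     H1_solution p {T0..} u \<and>
     ((\<lambda>t. sobolev_norm 1 (\<lambda>x. u t x - soliton_sum p N c x0 t x)) \<longlongrightarrow> 0) at_top"

end

theory Submission
  imports Defs "HOL-Computational_Algebra.Polynomial"
begin

text \<open>
  All estimates are energy estimates for \<open>v = \<partial>\<^sub>x\<^sup>s u\<close> with a weight \<open>w(x - \<sigma> t)\<close>: up to nonlinear terms,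
  the time derivative of \<open>\<integral> v\<^sup>2 w\<close> is \<open>-3 \<integral> v\<^sub>x\<^sup>2 w' + \<integral> v\<^sup>2 (w''' - \<sigma> w')\<close>. Where the weight lives the
  solution is of size \<open>e\<^bsup>-\<gamma>t\<^esup>\<close>, so the nonlinear terms are integrable in time, and the weighted norm
  vanishes as \<open>t \<rightarrow> \<infinity>\<close>; a Gronwall argument backwards from \<open>t = \<infinity>\<close> therefore closes at every order \<open>s\<close>.

  On the left, \<open>w\<close> is a decreasing logistic function moving slower than the slowest soliton; the
  linear terms then have a favourable sign and \<open>\<integral> v\<^sup>2 w\<close> inherits the size \<open>e\<^bsup>-\<kappa>Y\<^esup>\<close> of the weight at the
  solitons, with a rate that does not depend on \<open>s\<close>. On the right the sign is unfavourable and \<open>v\<^sub>x\<close> has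
  to be controlled by the estimate at order \<open>s + 1\<close>; with a weight increasing slowly over \<open>[Y, 2Y]\<close> each
  such step costs one derivative and gains a factor \<open>1 / Y\<close>, which is why only polynomial decay results.
\<close>

section \<open>Smooth functions and test functions\<close>

text \<open>Smallness comes from a product. The weight moves with a speed different from every
  \<open>c j\<close> and is majorised by \<open>M * exp (\<kappa> * \<zeta>)\<close>, with \<zeta>
  the position in the moving frame; the solitons have envelopes of the same rate \<kappa>. Hence
  weight times soliton is at most M exp(-\<gamma> t), where \<gamma> depends only on \<theta> and on
  the gap between the speeds. The rest of u is of size exp(-\<theta> t) in every Sobolev norm, with
  one \<theta> for all of them. The nonlinear terms are thus bounded by exp(-\<gamma> t) (w + M)
  times squares: the part with w feeds the Gronwall argument and the part with M is its source.

  The rate \<kappa> = sqrt (c 1) / 2 meets two constraints: it does not exceed the decay rate sqrt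
  (c j) of any soliton, and its square is below the speed c 1 / 2 of the left frame, so that w''' is
  absorbed by \<sigma> w'.

  The solution is given as a continuous curve in Sobolev spaces that satisfies the equation weakly.
  Before energies can be computed it has to become a jointly continuous function with classical
  space derivatives that solves the equation pointwise; the preparations on test functions and weak
  derivatives serve this.\<close>

definition smooth :: "(real \<Rightarrow> real) \<Rightarrow> bool" where
  "smooth f \<longleftrightarrow> (\<forall>k x. (deriv ^^ k) f differentiable at x)"

lemma smooth_DERIV:
  assumes "smooth f"
  shows "((deriv ^^ k) f has_real_derivative (deriv ^^ Suc k) f x) (at x)"
  using assms by (simp add: smooth_def DERIV_deriv_iff_real_differentiable)

lemma smooth_DERIV0:
  assumes "smooth f"
  shows "(f has_real_derivative deriv f x) (at x)"
  using smooth_DERIV[OF assms, of 0 x] by simp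

text \<open>Exhibiting the whole jet at once settles \<open>deriv ^^ k\<close> by a plain induction.
  The formulas for sums, multiples and affine substitutions are all obtained by guessing the jet
  \<open>F\<close>.\<close>

lemma funpow_deriv_eqI:
  fixes F :: "nat \<Rightarrow> real \<Rightarrow> real"
  assumes "\<And>i x. (F i has_real_derivative F (Suc i) x) (at x)"
  shows "(deriv ^^ k) (F 0) = F k"
proof (induction k)
  case (Suc k)
  have "deriv (F k) = F (Suc k)"
    using assms[of k] by (auto intro!: DERIV_imp_deriv)
  with Suc show ?case by simp
qed simp

lemma smoothI_jets:
  fixes F :: "nat \<Rightarrow> real \<Rightarrow> real"
  assumes "\<And>i x. (F i has_real_derivative F (Suc i) x) (at x)"
  shows "smooth (F 0)"
  unfolding smooth_def funpow_deriv_eqI[of F, OF assms]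
  using assms by (auto simp: real_differentiable_def)

text \<open>Coinduction for smoothness: iterated derivatives never leave a class that is closed
  under differentiation. It serves classes without a convenient formula for the k-th derivative,
  such as products, flat exponentials and functions with weak derivatives of all orders.\<close>

lemma smooth_coinduct:
  assumes step: "\<And>f. f \<in> S \<Longrightarrow> \<exists>f'\<in>S. \<forall>x. (f has_real_derivative f' x) (at x)" and "f \<in> S"
  shows "smooth f"
proof -
  have "(deriv ^^ k) f \<in> S" for k
  proof (induction k)
    case (Suc k)
    from step[OF Suc] obtain f' where "f' \<in> S" "\<forall>x. ((deriv ^^ k) f has_real_derivative f' x) (at x)"
      by blast
    moreover from this have "deriv ((deriv ^^ k) f) = f'" by (auto intro!: DERIV_imp_deriv)
    ultimately show ?case by simp
  qed (simp add: assms)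
  thus ?thesis unfolding smooth_def using step by (meson real_differentiable_def)
qed

lemma smooth_funpow_deriv: "smooth f \<Longrightarrow> smooth ((deriv ^^ k) f)"
  unfolding smooth_def by (metis comp_apply funpow_add)

lemma smooth_deriv: "smooth f \<Longrightarrow> smooth (deriv f)"
  using smooth_funpow_deriv[of f 1] by simp

lemma smooth_continuous: "smooth f \<Longrightarrow> continuous_on A ((deriv ^^ k) f)"
  by (meson DERIV_continuous_on has_field_derivative_at_within smooth_DERIV)

lemma smooth_continuous0: "smooth f \<Longrightarrow> continuous_on A f"
  using smooth_continuous[of f A 0] by simp

lemma deriv_funpow_deriv: "(deriv ^^ k) (deriv f) = (deriv ^^ Suc k) f"
  by (simp add: funpow_swap1)

lemma smooth_add:
  assumes "smooth f" "smooth g"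
  shows "smooth (\<lambda>x. f x + g x)" "(deriv ^^ k) (\<lambda>x. f x + g x) = (\<lambda>x. (deriv ^^ k) f x + (deriv ^^ k) g x)"
proof -
  let ?F = "\<lambda>i x. (deriv ^^ i) f x + (deriv ^^ i) g x"
  have *: "\<And>i x. (?F i has_real_derivative ?F (Suc i) x) (at x)"
    by (intro DERIV_add smooth_DERIV assms)
  show "smooth (\<lambda>x. f x + g x)" using smoothI_jets[of ?F, OF *] by simp
  show "(deriv ^^ k) (\<lambda>x. f x + g x) = (\<lambda>x. (deriv ^^ k) f x + (deriv ^^ k) g x)"
    using funpow_deriv_eqI[of ?F, OF *] by simp
qed

lemma smooth_cmult:
  assumes "smooth f"
  shows "smooth (\<lambda>x. c * f x)" "(deriv ^^ k) (\<lambda>x. c * f x) = (\<lambda>x. c * (deriv ^^ k) f x)"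
proof -
  let ?F = "\<lambda>i x. c * (deriv ^^ i) f x"
  have *: "\<And>i x. (?F i has_real_derivative ?F (Suc i) x) (at x)"
    by (intro DERIV_cmult smooth_DERIV assms)
  show "smooth (\<lambda>x. c * f x)" using smoothI_jets[of ?F, OF *] by simp
  show "(deriv ^^ k) (\<lambda>x. c * f x) = (\<lambda>x. c * (deriv ^^ k) f x)"
    using funpow_deriv_eqI[of ?F, OF *] by simp
qed

lemma smooth_diff:
  assumes "smooth f" "smooth g"
  shows "smooth (\<lambda>x. f x - g x)" "(deriv ^^ k) (\<lambda>x. f x - g x) = (\<lambda>x. (deriv ^^ k) f x - (deriv ^^ k) g x)"
  using smooth_add(1)[OF assms(1) smooth_cmult(1)[OF assms(2), of "-1"]]
    smooth_add(2)[OF assms(1) smooth_cmult(1)[OF assms(2), of "-1"], of k] smooth_cmult(2)[OF assms(2), of k "-1"]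
  by simp_all

lemma smooth_affine:
  assumes "smooth f"
  shows "smooth (\<lambda>x. f (a * x + b))" "(deriv ^^ k) (\<lambda>x. f (a * x + b)) = (\<lambda>x. a ^ k * (deriv ^^ k) f (a * x + b))"
proof -
  let ?F = "\<lambda>i x. a ^ i * (deriv ^^ i) f (a * x + b)"
  have *: "(?F i has_real_derivative ?F (Suc i) x) (at x)" for i x
    by (rule derivative_eq_intros DERIV_chain2[OF smooth_DERIV[OF assms]] refl | simp)+
  show "smooth (\<lambda>x. f (a * x + b))" using smoothI_jets[of ?F, OF *] by simp
  show "(deriv ^^ k) (\<lambda>x. f (a * x + b)) = (\<lambda>x. a ^ k * (deriv ^^ k) f (a * x + b))"
    using funpow_deriv_eqI[of ?F, OF *] by simp
qed

text \<open>The smallest class that contains the products and is stable under the Leibniz rule; it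
  takes the place of the binomial formula for higher derivatives of a product.\<close>

inductive_set sums_of_products :: "(real \<Rightarrow> real) set" where
  prod: "smooth f \<Longrightarrow> smooth g \<Longrightarrow> (\<lambda>x. f x * g x) \<in> sums_of_products"
| add: "f \<in> sums_of_products \<Longrightarrow> g \<in> sums_of_products \<Longrightarrow> (\<lambda>x. f x + g x) \<in> sums_of_products"

lemma smooth_mult:
  assumes "smooth f" "smooth g"
  shows "smooth (\<lambda>x. f x * g x)"
proof (rule smooth_coinduct)
  show "(\<lambda>x. f x * g x) \<in> sums_of_products" using assms by (rule prod)
  show "\<exists>f'\<in>sums_of_products. \<forall>x. (f has_real_derivative f' x) (at x)"
    if "f \<in> sums_of_products" for f using that
  proof induction
    case (prod f g)
    show ?case
    proof (intro bexI allI)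
      show "((\<lambda>x. f x * g x) has_real_derivative deriv f x * g x + f x * deriv g x) (at x)" for x
        using DERIV_mult[OF smooth_DERIV0[OF prod(1)] smooth_DERIV0[OF prod(2)]] by (simp add: mult.commute)
      show "(\<lambda>x. deriv f x * g x + f x * deriv g x) \<in> sums_of_products"
        by (intro sums_of_products.intros smooth_deriv prod)
    qed
  next
    case (add f g)
    then obtain f' g' where "f' \<in> sums_of_products" "\<forall>x. (f has_real_derivative f' x) (at x)"
       "g' \<in> sums_of_products" "\<forall>x. (g has_real_derivative g' x) (at x)" by blast
    thus ?case by (intro bexI[of _ "\<lambda>x. f' x + g' x"] allI DERIV_add sums_of_products.add) auto
  qed
qed

lemma test_function_iff: "test_function \<phi> \<longleftrightarrow> smooth \<phi> \<and> (\<exists>r. \<forall>x. r < \<bar>x\<bar> \<longrightarrow> \<phi> x = 0)"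
  by (simp add: test_function_def smooth_def)

lemma test_function_smooth: "test_function \<phi> \<Longrightarrow> smooth \<phi>"
  by (simp add: test_function_iff)

text \<open>The set \<open>r < \<bar>x\<bar>\<close> is open, so the function is constantly zero
  near each of its points and differentiation does not enlarge the support bound
  \<open>r\<close>.\<close>

lemma funpow_deriv_zero_outside:
  assumes "\<forall>x. r < \<bar>x\<bar> \<longrightarrow> f x = 0" and "r < \<bar>x\<bar>"
  shows "(deriv ^^ k) f x = (0::real)"
  using assms(2)
proof (induction k arbitrary: x)
  case (Suc k)
  have "((deriv ^^ k) f has_real_derivative 0) (at x)"
  proof (rule has_field_derivative_transform_within_open[where f="\<lambda>_. 0" and S="{x. r < \<bar>x\<bar>}"])
    show "open {x::real. r < \<bar>x\<bar>}" by (intro open_Collect_less continuous_intros)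
  qed (use Suc in auto)
  thus ?case by (simp add: DERIV_imp_deriv)
qed (use assms in auto)

lemma test_function_funpow_deriv:
  assumes "test_function \<phi>" shows "test_function ((deriv ^^ k) \<phi>)"
  using assms funpow_deriv_zero_outside[of _ \<phi> _ k] unfolding test_function_iff
  by (metis smooth_funpow_deriv)

lemma test_function_deriv: "test_function \<phi> \<Longrightarrow> test_function (deriv \<phi>)"
  using test_function_funpow_deriv[of \<phi> 1] by simp

lemma test_function_mult:
  assumes "smooth f" "test_function \<phi>" shows "test_function (\<lambda>x. f x * \<phi> x)"
  using assms by (auto simp: test_function_iff intro: smooth_mult)

lemma test_function_cmult: "test_function \<phi> \<Longrightarrow> test_function (\<lambda>x. c * \<phi> x)"
  by (auto simp: test_function_iff intro: smooth_cmult)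

lemma test_function_diff:
  assumes "test_function \<phi>" "test_function \<psi>" shows "test_function (\<lambda>x. \<phi> x - \<psi> x)"
proof -
  obtain r s where "\<forall>x. r < \<bar>x\<bar> \<longrightarrow> \<phi> x = 0" "\<forall>x. s < \<bar>x\<bar> \<longrightarrow> \<psi> x = 0"
    using assms by (auto simp: test_function_iff)
  hence "\<forall>x. max r s < \<bar>x\<bar> \<longrightarrow> \<phi> x - \<psi> x = 0" by auto
  moreover have "smooth (\<lambda>x. \<phi> x - \<psi> x)" using assms by (auto simp: test_function_iff intro: smooth_diff)
  ultimately show ?thesis unfolding test_function_iff by blast
qed

lemma test_function_affine:
  assumes "test_function \<phi>" "a \<noteq> 0" shows "test_function (\<lambda>x. \<phi> (a * x + b))"
proof -
  obtain r where r: "\<forall>x. r < \<bar>x\<bar> \<longrightarrow> \<phi> x = 0" using assms by (auto simp: test_function_iff)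
  have "\<phi> (a * x + b) = 0" if "(r + \<bar>b\<bar>) / \<bar>a\<bar> < \<bar>x\<bar>" for x
  proof -
    have "r + \<bar>b\<bar> < \<bar>a * x\<bar>" using that assms(2) by (simp add: pos_divide_less_eq abs_mult mult.commute)
    thus ?thesis using r by auto
  qed
  thus ?thesis using assms(1) by (auto simp: test_function_iff intro: smooth_affine)
qed

subsection \<open>A bump function\<close>

lemma tendsto_poly_times_exp_minus:
  "((\<lambda>t. poly q t * exp (- t)) \<longlongrightarrow> (0::real)) at_top"
proof -
  have "((\<lambda>t. \<Sum>i\<le>degree q. coeff q i * (t ^ i / exp t)) \<longlongrightarrow> (\<Sum>i\<le>degree q. coeff q i * 0)) at_top"
    by (intro tendsto_intros tendsto_power_div_exp_0)
  thus ?thesis by (simp add: poly_altdef sum_distrib_right exp_minus field_simps sum_divide_distrib)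
qed

text \<open>The classical flat function exp(-1/x), carried along with a polynomial in 1/x because
  this family is stable under differentiation. \<open>flat_exp 1\<close> is the flat function
  itself.\<close>

definition flat_exp :: "real poly \<Rightarrow> real \<Rightarrow> real" where
  "flat_exp p x = (if x > 0 then poly p (1 / x) * exp (- (1 / x)) else 0)"

text \<open>For positive x the chain rule gives the square of 1/x times P - P' at 1/x, which is
  where the polynomial on the right comes from. At the origin the exponential beats every power of
  1/x.\<close>

lemma flat_exp_DERIV:
  "(flat_exp p has_real_derivative flat_exp ([:0, 0, 1:] * (p - pderiv p)) x) (at x)"
proof -
  consider "x > 0" | "x < 0" | "x = 0" by linarith
  thus ?thesis
  proof cases
    case 1
    have "((\<lambda>x. poly p (1 / x) * exp (- (1 / x))) has_real_derivative
        flat_exp ([:0, 0, 1:] * (p - pderiv p)) x) (at x)"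
      using 1 by (auto intro!: derivative_eq_intros DERIV_chain2[OF poly_DERIV]
          simp: flat_exp_def power2_eq_square field_simps)
    thus ?thesis
      by (rule has_field_derivative_transform_within_open[where S="{0<..}"]) (use 1 in \<open>auto simp: flat_exp_def\<close>)
  next
    case 2
    show ?thesis
      by (rule has_field_derivative_transform_within_open[where S="{..<0}" and f="\<lambda>_. 0"])
        (use 2 in \<open>auto simp: flat_exp_def\<close>)
  next
    case 3
    \<comment> \<open>The difference quotient from the right becomes, in the variable
      \<open>inverse y\<close>, a polynomial times a decaying exponential; the division by
      \<open>y\<close> is the extra factor in \<open>pCons 0 p\<close>.\<close>
    have "((\<lambda>y. flat_exp p y / y) \<longlongrightarrow> 0) (at_right 0)"
    proof (rule Lim_transform_eventually)
      show "((\<lambda>y. poly (pCons 0 p) (inverse y) * exp (- inverse y)) \<longlongrightarrow> 0) (at_right 0)"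
        using filterlim_compose[OF tendsto_poly_times_exp_minus filterlim_inverse_at_top_right] .
      show "\<forall>\<^sub>F y in at_right 0. poly (pCons 0 p) (inverse y) * exp (- inverse y) = flat_exp p y / y"
        by (auto simp: eventually_at_right_less flat_exp_def field_simps intro: eventually_mono[OF eventually_at_right_less])
    qed
    moreover have "((\<lambda>y. flat_exp p y / y) \<longlongrightarrow> 0) (at_left 0)"
      by (rule Lim_transform_eventually[where f="\<lambda>_. 0"])
         (auto simp: flat_exp_def eventually_at_filter)
    ultimately have "((\<lambda>y. flat_exp p y / y) \<longlongrightarrow> 0) (at 0)"
      by (simp add: filterlim_split_at)
    thus ?thesis using 3 by (simp add: DERIV_def flat_exp_def)
  qed
qed

lemma smooth_flat_exp: "smooth (flat_exp p)"
  by (rule smooth_coinduct[where S="range flat_exp"]) (use flat_exp_DERIV in blast)+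

lemma bump_function:
  obtains \<psi> where "test_function \<psi>" "\<And>x. 0 \<le> \<psi> x" "\<And>x. \<psi> x \<le> 1" "\<psi> 0 = 1"
    "\<And>x. \<bar>x\<bar> < 1 \<Longrightarrow> \<psi> x > 0" "\<And>x. \<bar>x\<bar> \<ge> 1 \<Longrightarrow> \<psi> x = 0"
proof
  \<comment> \<open>The factor \<open>exp 2\<close> cancels the value exp(-1) exp(-1) of the product
    at the origin.\<close>
  let ?\<psi> = "\<lambda>x. exp 2 * (flat_exp 1 (1 * x + 1) * flat_exp 1 (- 1 * x + 1))"
  have *: "smooth ?\<psi>"
    by (intro smooth_cmult smooth_mult smooth_affine smooth_flat_exp)
  show z: "?\<psi> x = 0" if "\<bar>x\<bar> \<ge> 1" for x using that by (auto simp: flat_exp_def)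
  show "test_function ?\<psi>" using * z unfolding test_function_iff by (meson less_imp_le)
  show "?\<psi> x \<ge> 0" for x by (auto simp: flat_exp_def)
  show "?\<psi> 0 = 1" by (simp add: flat_exp_def flip: exp_add)
  show "?\<psi> x > 0" if "\<bar>x\<bar> < 1" for x using that by (auto simp: flat_exp_def)
  show "?\<psi> x \<le> 1" for x
  proof (cases "\<bar>x\<bar> < 1")
    case True
    \<comment> \<open>The exponent of \<open>?\<psi> x\<close> is 2 minus this sum, so the
      inequality is the upper bound 1.\<close>
    have "2 \<le> 1 / (x + 1) + 1 / (1 - x)"
    proof -
      have "1 / (x + 1) + 1 / (1 - x) = 2 / (1 - x\<^sup>2)"
        using True by (simp add: field_simps power2_eq_square)
      moreover have "1 - x\<^sup>2 > 0" using True by (simp add: abs_square_less_1)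
      ultimately show ?thesis by (simp add: le_divide_eq)
    qed
    thus ?thesis using True by (auto simp: flat_exp_def simp flip: exp_add)
  next
    case False
    thus ?thesis by (subst z) auto
  qed
qed

lemma smooth_if_smooth_deriv:
  assumes "\<And>x. (f has_real_derivative f' x) (at x)" "smooth f'"
  shows "smooth f"
proof (rule smooth_coinduct)
  show "f \<in> insert f (Collect smooth)" by simp
  show "\<exists>g'\<in>insert f (Collect smooth). \<forall>x. (g has_real_derivative g' x) (at x)"
    if "g \<in> insert f (Collect smooth)" for g
    using that assms smooth_DERIV0[of g] smooth_deriv[of g] by blast
qed

section \<open>Integration on the line\<close>

text \<open>Bridge between the Lebesgue integral on the line, in which the weak formulation is
  written, and the Henstock-Kurzweil integral over an interval, where the fundamental theorem and
  the interchange of iterated integrals are applied.\<close>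

lemma integrable_compact_support:
  fixes f :: "real \<Rightarrow> real"
  assumes "continuous_on UNIV f" "\<forall>x. r < \<bar>x\<bar> \<longrightarrow> f x = 0"
  shows "integrable lborel f" "(LINT x|lborel. f x) = integral {-r..r} f" "f integrable_on {-r..r}"
proof -
  have eq: "(\<lambda>x. indicator {-r..r} x *\<^sub>R f x) = f"
  proof
    fix x show "indicator {-r..r} x *\<^sub>R f x = f x"
      using assms(2) by (cases "r < \<bar>x\<bar>") (auto simp: indicator_def)
  qed
  have *: "set_integrable lborel {-r..r} f"
    by (intro borel_integrable_atLeastAtMost' continuous_on_subset[OF assms(1)]) auto
  show "integrable lborel f" using * by (simp only: set_integrable_def eq)
  show "f integrable_on {-r..r}" using set_borel_integral_eq_integral(1)[OF *] .
  show "(LINT x|lborel. f x) = integral {-r..r} f"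
    using set_borel_integral_eq_integral(2)[OF *] by (simp only: set_lebesgue_integral_def eq)
qed

lemma integrable_test_mult:
  assumes "continuous_on UNIV f" "test_function \<phi>"
  shows "integrable lborel (\<lambda>x. f x * \<phi> x)"
proof -
  obtain r where "\<forall>x. r < \<bar>x\<bar> \<longrightarrow> \<phi> x = 0" using assms by (auto simp: test_function_iff)
  thus ?thesis using assms
    by (intro integrable_compact_support(1)[where r=r] continuous_on_mult assms(1) smooth_continuous0[OF test_function_smooth]) auto
qed

lemma integrable_test: "test_function \<phi> \<Longrightarrow> integrable lborel \<phi>"
  using integrable_test_mult[of "\<lambda>_. 1" \<phi>] by simp

text \<open>A nonzero limit would keep the absolute value above half of \<open>\<bar>A\<bar>\<close>
  on a half-line, and its integral above every multiple of that.\<close>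

lemma integrable_tendsto_at_top_eq_0:
  fixes f :: "real \<Rightarrow> real"
  assumes f: "integrable lborel f" and lim: "(f \<longlongrightarrow> A) at_top"
  shows "A = 0"
proof (rule ccontr)
  assume A: "A \<noteq> 0"
  have "\<forall>\<^sub>F x in at_top. dist (f x) A < \<bar>A\<bar> / 2" using lim A by (intro tendstoD) auto
  then obtain b where b: "\<And>x. x \<ge> b \<Longrightarrow> dist (f x) A < \<bar>A\<bar> / 2" by (auto simp: eventually_at_top_linorder)
  have *: "\<bar>A\<bar> / 2 * real n \<le> (LINT x|lborel. \<bar>f x\<bar>)" for n
  proof -
    have "(LINT x|lborel. indicator {b..b + real n} x * (\<bar>A\<bar> / 2)) \<le> (LINT x|lborel. \<bar>f x\<bar>)"
    proof (rule integral_mono)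
      show "integrable lborel (\<lambda>x. \<bar>f x\<bar>)" using f by auto
      show "indicator {b..b + real n} x * (\<bar>A\<bar> / 2) \<le> \<bar>f x\<bar>" for x
        proof (cases "x \<in> {b..b + real n}")
          case True
          hence "\<bar>f x - A\<bar> < \<bar>A\<bar> / 2" using b[of x] by (simp add: dist_real_def)
          hence "\<bar>A\<bar> / 2 \<le> \<bar>f x\<bar>" using abs_triangle_ineq2_sym[of A "f x"] by linarith
          thus ?thesis using True by simp
        qed simp
    qed auto
    thus ?thesis by (simp add: mult.commute)
  qed
  obtain n :: nat where "real n > (LINT x|lborel. \<bar>f x\<bar>) / (\<bar>A\<bar> / 2)" using reals_Archimedean2 by blast
  with *[of n] A show False by (simp add: pos_divide_less_eq mult.commute)
qed

text \<open>Integrability of \<open>f'\<close> makes f(b) - f(0) converge as b grows; integrability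
  of \<open>f\<close> then forces the limit to be zero.\<close>

lemma C1_integrable_tendsto_at_top:
  fixes f f' :: "real \<Rightarrow> real"
  assumes d: "\<And>x. (f has_real_derivative f' x) (at x)" and c: "continuous_on UNIV f'"
    and f: "integrable lborel f" and f': "integrable lborel f'"
  shows "(f \<longlongrightarrow> 0) at_top"
proof -
  have "((\<lambda>b. LINT x|lborel. f' x * indicator {0..b} x) \<longlongrightarrow> (LINT x|lborel. f' x * indicator {0..} x)) at_top"
  proof (rule integral_dominated_convergence_at_top)
    show "AE x in lborel. ((\<lambda>i. f' x * indicator {0..i} x) \<longlongrightarrow> f' x * indicator {0..} x) at_top"
    proof (intro AE_I2 tendsto_eventually)
      show "\<forall>\<^sub>F i in at_top. f' x * indicator {0..i} x = f' x * indicator {0..} x" for x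
        using eventually_ge_at_top[of x] by eventually_elim (auto simp: indicator_def)
    qed
    show "integrable lborel (\<lambda>x. \<bar>f' x\<bar>)" using f' by auto
  qed (use f' in \<open>auto simp: indicator_def\<close>)
  moreover have "\<forall>\<^sub>F b in at_top. (LINT x|lborel. f' x * indicator {0..b} x) = f b - f 0"
    using eventually_ge_at_top[of 0]
    by eventually_elim (intro integral_FTC_Icc_real d, use c in \<open>auto simp: continuous_on_eq_continuous_at\<close>)
  ultimately have "((\<lambda>b. f b - f 0) \<longlongrightarrow> (LINT x|lborel. f' x * indicator {0..} x)) at_top"
    by (rule Lim_transform_eventually)
  hence "((\<lambda>b. (f b - f 0) + f 0) \<longlongrightarrow> (LINT x|lborel. f' x * indicator {0..} x) + f 0) at_top"
    by (intro tendsto_intros)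
  hence "(f \<longlongrightarrow> (LINT x|lborel. f' x * indicator {0..} x) + f 0) at_top" by simp
  with integrable_tendsto_at_top_eq_0[OF f this] show ?thesis by simp
qed

lemma integrable_reflect:
  fixes f :: "real \<Rightarrow> real"
  shows "integrable lborel f \<Longrightarrow> integrable lborel (\<lambda>x. f (- x))"
  using lborel_integrable_real_affine[of f "-1" 0] by simp

text \<open>\<open>f\<close> vanishes at both ends of the line, so no boundary term survives in the
  fundamental theorem. The first claim carries the integrations by parts against test functions and
  in the energy identity; the second is the Sobolev embedding in its simplest form.\<close>

lemma C1_integrable:
  fixes f f' :: "real \<Rightarrow> real"
  assumes d: "\<And>x. (f has_real_derivative f' x) (at x)" and c: "continuous_on UNIV f'"
    and f: "integrable lborel f" and f': "integrable lborel f'"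
  shows C1_integral_deriv_eq_0: "(LINT x|lborel. f' x) = 0"
    and C1_abs_le_integral_deriv: "\<bar>f x\<bar> \<le> (LINT x|lborel. \<bar>f' x\<bar>)"
proof -
  have top: "(f \<longlongrightarrow> 0) at_top" by (rule C1_integrable_tendsto_at_top[OF assms])
  have "((\<lambda>x. f (- x)) \<longlongrightarrow> 0) at_top"
  proof (rule C1_integrable_tendsto_at_top)
    show "((\<lambda>x. f (- x)) has_real_derivative - f' (- x)) (at x)" for x
    proof -
      have "((\<lambda>x. f (- x)) has_real_derivative f' (- x) * - 1) (at x)"
        by (rule DERIV_chain2[OF d]) (auto intro!: derivative_eq_intros)
      thus ?thesis by simp
    qed
    show "continuous_on UNIV (\<lambda>x. - f' (- x))"
      by (intro continuous_intros continuous_on_compose2[OF c]) auto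
  qed (use integrable_reflect f f' in auto)
  note bot = this
  have FTC: "(LINT x|lborel. f' x * indicator {a..b} x) = f b - f a" if "a \<le> b" for a b
    using that by (intro integral_FTC_Icc_real d) (use c in \<open>auto simp: continuous_on_eq_continuous_at\<close>)
  have "((\<lambda>b. LINT x|lborel. f' x * indicator {-b..b} x) \<longlongrightarrow> (LINT x|lborel. f' x)) at_top"
  proof (rule integral_dominated_convergence_at_top)
    show "AE x in lborel. ((\<lambda>i. f' x * indicator {-i..i} x) \<longlongrightarrow> f' x) at_top"
    proof (intro AE_I2 tendsto_eventually)
      show "\<forall>\<^sub>F i in at_top. f' x * indicator {-i..i} x = f' x" for x
        using eventually_ge_at_top[of "\<bar>x\<bar>"] by eventually_elim (auto simp: indicator_def)
    qed
    show "integrable lborel (\<lambda>x. \<bar>f' x\<bar>)" using f' by auto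
  qed (use f' in \<open>auto simp: indicator_def\<close>)
  moreover have "\<forall>\<^sub>F b in at_top. (LINT x|lborel. f' x * indicator {-b..b} x) = f b - f (- b)"
    using eventually_ge_at_top[of 0] by eventually_elim (simp add: FTC)
  ultimately have "((\<lambda>b. f b - f (- b)) \<longlongrightarrow> (LINT x|lborel. f' x)) at_top"
    by (rule Lim_transform_eventually)
  moreover have "((\<lambda>b. f b - f (- b)) \<longlongrightarrow> 0 - 0) at_top" by (intro tendsto_diff top bot)
  ultimately show "(LINT x|lborel. f' x) = 0"
    by (metis tendsto_unique trivial_limit_at_top_linorder diff_zero)
  have "\<forall>\<^sub>F b in at_top. \<bar>f b - f x\<bar> \<le> (LINT x|lborel. \<bar>f' x\<bar>)"
    using eventually_ge_at_top[of x]
  proof eventually_elim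
    case (elim b)
    have "\<bar>LINT y|lborel. f' y * indicator {x..b} y\<bar> \<le> (LINT y|lborel. \<bar>f' y * indicator {x..b} y\<bar>)"
      using integral_norm_bound[of lborel "\<lambda>y. f' y * indicator {x..b} y"] unfolding real_norm_def .
    also have "\<dots> \<le> (LINT x|lborel. \<bar>f' x\<bar>)"
    proof (rule integral_mono)
      show "integrable lborel (\<lambda>y. \<bar>f' y * indicator {x..b} y\<bar>)"
        by (intro integrable_abs integrable_real_mult_indicator f') auto
    qed (use f' in \<open>auto simp: indicator_def\<close>)
    finally show ?case using elim by (simp add: FTC)
  qed
  moreover have "((\<lambda>b. \<bar>f b - f x\<bar>) \<longlongrightarrow> \<bar>0 - f x\<bar>) at_top" by (intro tendsto_intros top)
  ultimately show "\<bar>f x\<bar> \<le> (LINT x|lborel. \<bar>f' x\<bar>)"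
    using tendsto_upperbound[of "\<lambda>b. \<bar>f b - f x\<bar>" "\<bar>0 - f x\<bar>" at_top] by simp
qed

lemma integral_by_parts_test:
  assumes d: "\<And>x. (f has_real_derivative f' x) (at x)" and c: "continuous_on UNIV f'"
    and \<phi>: "test_function \<phi>"
  shows "(LINT x|lborel. f' x * \<phi> x) = - (LINT x|lborel. f x * deriv \<phi> x)"
proof -
  have cf: "continuous_on UNIV f" by (meson DERIV_continuous_on has_field_derivative_at_within d)
  have i: "integrable lborel (\<lambda>x. f' x * \<phi> x)" "integrable lborel (\<lambda>x. f x * deriv \<phi> x)"
    "integrable lborel (\<lambda>x. f x * \<phi> x)"
    by (intro integrable_test_mult test_function_deriv cf c \<phi>)+
  have "(LINT x|lborel. f' x * \<phi> x + f x * deriv \<phi> x) = 0"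
  proof (rule C1_integral_deriv_eq_0)
    show "((\<lambda>x. f x * \<phi> x) has_real_derivative f' x * \<phi> x + f x * deriv \<phi> x) (at x)" for x
      using DERIV_mult[OF d smooth_DERIV0[OF test_function_smooth[OF \<phi>]]] by (simp add: mult.commute)
    show "continuous_on UNIV (\<lambda>x. f' x * \<phi> x + f x * deriv \<phi> x)"
      by (intro continuous_intros cf c smooth_continuous0 smooth_deriv test_function_smooth \<phi>)
  qed (use i in auto)
  thus ?thesis using i by simp
qed

lemma integral_by_parts_test_funpow:
  assumes "smooth f" "test_function \<phi>"
  shows "(LINT x|lborel. f x * (deriv ^^ k) \<phi> x) = (-1) ^ k * (LINT x|lborel. (deriv ^^ k) f x * \<phi> x)"
  using assms
proof (induction k arbitrary: f)
  case (Suc k)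
  have "(LINT x|lborel. f x * (deriv ^^ Suc k) \<phi> x) = - (LINT x|lborel. deriv f x * (deriv ^^ k) \<phi> x)"
    using integral_by_parts_test[of f "deriv f" "(deriv ^^ k) \<phi>"] Suc
    by (simp add: smooth_DERIV0 smooth_continuous0 smooth_deriv test_function_funpow_deriv)
  also have "\<dots> = (-1) ^ Suc k * (LINT x|lborel. (deriv ^^ Suc k) f x * \<phi> x)"
    using Suc.IH[OF smooth_deriv Suc.prems(2)] Suc.prems by (simp only: deriv_funpow_deriv) simp
  finally show ?case .
qed simp

lemma L2_add:
  assumes "L2 f" "L2 g" shows "L2 (\<lambda>x. f x + g x)"
proof -
  have "integrable lborel (\<lambda>x. (f x + g x)\<^sup>2)"
  proof (rule Bochner_Integration.integrable_bound)
    show "integrable lborel (\<lambda>x. 2 * (f x)\<^sup>2 + 2 * (g x)\<^sup>2)" using assms by (auto simp: L2_def)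
    have "(f x + g x)\<^sup>2 \<le> 2 * (f x)\<^sup>2 + 2 * (g x)\<^sup>2" for x
      using sum_squares_bound[of "f x" "g x"] by (simp add: power2_sum)
    thus "AE x in lborel. norm ((f x + g x)\<^sup>2) \<le> norm (2 * (f x)\<^sup>2 + 2 * (g x)\<^sup>2)" by simp
  qed (use assms in \<open>auto simp: L2_def\<close>)
  thus ?thesis using assms by (auto simp: L2_def)
qed

lemma L2_cmult: "L2 f \<Longrightarrow> L2 (\<lambda>x. c * f x)"
  by (auto simp: L2_def power_mult_distrib)

lemma L2_diff: "L2 f \<Longrightarrow> L2 g \<Longrightarrow> L2 (\<lambda>x. f x - g x)"
  using L2_add[of f "\<lambda>x. -1 * g x"] L2_cmult[of g "-1"] by simp

lemma L2_mult_integrable: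
  assumes "L2 f" "L2 g" shows "integrable lborel (\<lambda>x. f x * g x)"
proof (rule Bochner_Integration.integrable_bound)
  show "integrable lborel (\<lambda>x. (f x)\<^sup>2 + (g x)\<^sup>2)" using assms by (auto simp: L2_def)
  have "\<bar>f x * g x\<bar> \<le> (f x)\<^sup>2 + (g x)\<^sup>2" for x
    using sum_squares_bound[of "\<bar>f x\<bar>" "\<bar>g x\<bar>"] abs_ge_zero[of "f x * g x"]
    unfolding power2_abs mult.assoc abs_mult by linarith
  thus "AE x in lborel. norm (f x * g x) \<le> norm ((f x)\<^sup>2 + (g x)\<^sup>2)" by auto
qed (use assms in \<open>auto simp: L2_def\<close>)

lemma L2_test_function:
  assumes "test_function \<phi>" shows "L2 \<phi>"
proof -
  have "continuous_on UNIV \<phi>" using assms by (simp add: smooth_continuous0 test_function_smooth)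
  thus ?thesis using assms integrable_test_mult[of \<phi> \<phi>]
    by (auto simp: L2_def power2_eq_square borel_measurable_continuous_onI)
qed

lemma L2_test_integrable: "L2 f \<Longrightarrow> test_function \<phi> \<Longrightarrow> integrable lborel (\<lambda>x. f x * \<phi> x)"
  by (simp add: L2_mult_integrable L2_test_function)

section \<open>Distributions given by continuous functions\<close>

text \<open>Close to a point \<open>a\<close> with \<open>q a\<close> nonzero, \<open>q\<close>
  keeps the sign of \<open>q a\<close>. Testing with \<open>q a\<close> times a bump supported there
  makes the integrand nonnegative, continuous and positive at \<open>a\<close>, so its integral
  cannot vanish.\<close>

lemma continuous_eq_0_if_test_integrals_0:
  fixes q :: "real \<Rightarrow> real"
  assumes c: "continuous_on UNIV q" and z: "\<And>\<phi>. test_function \<phi> \<Longrightarrow> (LINT x|lborel. q x * \<phi> x) = 0"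
  shows "q a = 0"
proof (rule ccontr)
  assume a: "q a \<noteq> 0"
  have "isCont q a" using c by (simp add: continuous_on_eq_continuous_at)
  then obtain d where d: "d > 0" "\<And>x. dist x a < d \<Longrightarrow> dist (q x) (q a) < \<bar>q a\<bar>"
    using a unfolding continuous_at_eps_delta by (meson zero_less_abs_iff)
  obtain \<psi> where \<psi>: "test_function \<psi>" "\<And>x. 0 \<le> \<psi> x" "\<And>x. \<psi> x \<le> 1" "\<psi> 0 = 1"
    "\<And>x. \<bar>x\<bar> < 1 \<Longrightarrow> \<psi> x > 0" "\<And>x. \<bar>x\<bar> \<ge> 1 \<Longrightarrow> \<psi> x = 0" using bump_function by blast
  define \<phi> where "\<phi> = (\<lambda>x. \<psi> ((1 / d) * x + (- a / d)))"
  have \<phi>: "test_function \<phi>" unfolding \<phi>_def using \<psi>(1) d(1) by (intro test_function_affine) auto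
  define f where "f = (\<lambda>x. q x * (q a * \<phi> x))"
  have arg: "(1 / d) * x + (- a / d) = (x - a) / d" for x by (simp add: diff_divide_distrib)
  have f0: "f x = 0" if "dist x a \<ge> d" for x
    using \<psi>(6)[of "(x - a) / d"] that d(1) unfolding f_def \<phi>_def arg by (simp add: dist_real_def)
  have fnn: "f x \<ge> 0" for x
  proof (cases "dist x a < d")
    case True
    hence "dist (q x) (q a) < \<bar>q a\<bar>" by (rule d)
    hence "q x * q a > 0" using a by (auto simp: dist_real_def zero_less_mult_iff)
    thus ?thesis using \<psi>(2) unfolding f_def \<phi>_def by (metis less_imp_le mult.assoc zero_le_mult_iff)
  qed (use f0 in auto)
  have cf: "continuous_on UNIV f" unfolding f_def
    by (intro continuous_intros c smooth_continuous0 test_function_smooth \<phi>)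
  define r where "r = \<bar>a\<bar> + d"
  have r: "\<forall>x. r < \<bar>x\<bar> \<longrightarrow> f x = 0" using f0 by (auto simp: r_def dist_real_def)
  have "(LINT x|lborel. f x) = 0" unfolding f_def using z[OF test_function_cmult[OF \<phi>]] .
  hence "(f has_integral 0) (cbox (-r) r)"
    using integrable_compact_support(2,3)[OF cf r] by (metis cbox_interval integrable_integral)
  moreover have "box (-r) r \<noteq> {}" "a \<in> cbox (-r) r" using d(1) by (auto simp: r_def box_eq_empty)
  ultimately have "f a = 0"
    using has_integral_0_cbox_imp_0[of "-r" r f a] fnn continuous_on_subset[OF cf] by blast
  thus False using a \<psi>(4) by (simp add: f_def \<phi>_def arg)
qed

lemma antiderivative_exists:
  fixes f :: "real \<Rightarrow> real"
  assumes c: "continuous_on UNIV f"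
  obtains F where "\<And>x. (F has_real_derivative f x) (at x)"
proof
  fix x :: real
  have "((\<lambda>x. LBINT y=0..x. f y) has_vector_derivative f x) (at x within {-\<bar>x\<bar>-1..\<bar>x\<bar>+1})"
    using interval_integral_FTC2[of "-\<bar>x\<bar>-1" 0 "\<bar>x\<bar>+1" f x] continuous_on_subset[OF c] by (auto simp: zero_ereal_def)
  moreover have "at x within {-\<bar>x\<bar>-1..\<bar>x\<bar>+1} = at x" by (intro at_within_interior) auto
  ultimately show "((\<lambda>x. LBINT y=0..x. f y) has_real_derivative f x) (at x)"
    by (simp add: has_real_derivative_iff_has_vector_derivative)
qed

text \<open>A primitive that vanishes to the left of the support is constant to its right, and this
  constant is the integral of \<open>\<phi>\<close>. Zero mean is exactly what keeps the support
  compact.\<close>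

lemma test_function_antiderivative:
  assumes \<phi>: "test_function \<phi>" and z: "(LINT x|lborel. \<phi> x) = 0"
  obtains \<eta> where "test_function \<eta>" "deriv \<eta> = \<phi>"
proof -
  obtain r where r: "\<forall>x. r < \<bar>x\<bar> \<longrightarrow> \<phi> x = 0" using \<phi> by (auto simp: test_function_iff)
  have c: "continuous_on UNIV \<phi>" by (intro smooth_continuous0 test_function_smooth \<phi>)
  obtain F where F: "\<And>x. (F has_real_derivative \<phi> x) (at x)" using antiderivative_exists[OF c] by blast
  have FTC: "(\<phi> has_integral F b - F a) {a..b}" if "a \<le> b" for a b
    by (intro fundamental_theorem_of_calculus that)
      (use F in \<open>auto simp: has_real_derivative_iff_has_vector_derivative intro: has_vector_derivative_at_within\<close>)
  define s where "s = \<bar>r\<bar> + 1"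
  have 1: "F R = F (- R)" if "R \<ge> s" for R
  proof -
    have "(LINT x|lborel. \<phi> x) = integral {-R..R} \<phi>"
      using that r by (intro integrable_compact_support c) (auto simp: s_def)
    moreover have "- R \<le> R" using that by (simp add: s_def)
    ultimately show ?thesis using z integral_unique[OF FTC[of "-R" R]] by simp
  qed
  have 2: "F x = F (- s)" if "x \<le> - s" for x
  proof -
    have "(\<phi> has_integral 0) {x..-s}"
      by (rule has_integral_is_0) (use r in \<open>auto simp: s_def\<close>)
    thus ?thesis using has_integral_unique[OF FTC[OF that]] by (metis eq_iff_diff_eq_0)
  qed
  define \<eta> where "\<eta> = (\<lambda>x. F x - F (- s))"
  have d: "(\<eta> has_real_derivative \<phi> x) (at x)" for x
    unfolding \<eta>_def by (auto intro!: derivative_eq_intros F)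
  hence dd: "deriv \<eta> = \<phi>" by (auto intro!: DERIV_imp_deriv)
  have "smooth \<eta>"
    using d test_function_smooth[OF \<phi>] by (rule smooth_if_smooth_deriv)
  moreover have "\<eta> x = 0" if "s < \<bar>x\<bar>" for x
    using that 1[of x] 2[of x] 2[of "-x"] by (auto simp: \<eta>_def abs_if split: if_splits)
  ultimately have "test_function \<eta>" by (auto simp: test_function_iff)
  thus thesis using dd that by blast
qed

text \<open>If every test function had mean zero, the constant 1 would annihilate all of them and
  hence vanish.\<close>

lemma test_function_integral_1:
  obtains \<rho> where "test_function \<rho>" "(LINT x|lborel. \<rho> x) = 1"
proof -
  have "\<exists>\<phi>. test_function \<phi> \<and> (LINT x|lborel. \<phi> x) \<noteq> 0"
  proof (rule ccontr)
    assume "\<not> ?thesis"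
    hence "(LINT x|lborel. 1 * \<phi> x) = 0" if "test_function \<phi>" for \<phi> using that by simp
    from continuous_eq_0_if_test_integrals_0[of "\<lambda>_. 1", OF _ this] show False by simp
  qed
  then obtain \<phi> where \<phi>: "test_function \<phi>" "(LINT x|lborel. \<phi> x) \<noteq> 0" by blast
  show thesis
  proof (rule that)
    show "test_function (\<lambda>x. (1 / (LINT x|lborel. \<phi> x)) * \<phi> x)" by (rule test_function_cmult[OF \<phi>(1)])
    show "(LINT x|lborel. (1 / (LINT x|lborel. \<phi> x)) * \<phi> x) = 1" using \<phi>(2) by simp
  qed
qed

text \<open>Adding \<open>A * x\<close> yields a continuous \<open>q'\<close> that annihilates the
  derivatives of all test functions. A test function minus its mean times \<open>\<rho>\<close> is
  such a derivative, so integration against \<open>q'\<close> sees only the mean, and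
  \<open>q'\<close> is constant.\<close>

lemma du_bois_reymond:
  fixes q :: "real \<Rightarrow> real"
  assumes c: "continuous_on UNIV q"
    and z: "\<And>\<phi>. test_function \<phi> \<Longrightarrow> (LINT x|lborel. q x * deriv \<phi> x) = A * (LINT x|lborel. \<phi> x)"
  obtains B where "\<And>x. q x = B - A * x"
proof -
  obtain \<rho> where \<rho>: "test_function \<rho>" "(LINT x|lborel. \<rho> x) = 1" using test_function_integral_1 by blast
  define q' where "q' = (\<lambda>x. q x + A * x)"
  have c': "continuous_on UNIV q'" unfolding q'_def by (intro continuous_intros c)
  have z': "(LINT x|lborel. q' x * deriv \<phi> x) = 0" if \<phi>: "test_function \<phi>" for \<phi>
  proof -
    have "(LINT x|lborel. q' x * deriv \<phi> x) = (LINT x|lborel. q x * deriv \<phi> x) + (LINT x|lborel. (A * x) * deriv \<phi> x)"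
      unfolding q'_def ring_distribs
      by (intro Bochner_Integration.integral_add integrable_test_mult test_function_deriv \<phi> c continuous_intros)
    also have "(LINT x|lborel. (A * x) * deriv \<phi> x) = - (LINT x|lborel. A * \<phi> x)"
      by (subst integral_by_parts_test[where f="\<lambda>x. A * x" and f'="\<lambda>_. A", OF _ _ \<phi>])
         (auto intro!: derivative_eq_intros)
    finally show ?thesis using z[OF \<phi>] by simp
  qed
  define B where "B = (LINT x|lborel. q' x * \<rho> x)"
  have "q' x - B = 0" for x
  proof (rule continuous_eq_0_if_test_integrals_0[where q="\<lambda>x. q' x - B"])
    show "continuous_on UNIV (\<lambda>x. q' x - B)" by (intro continuous_intros c')
    fix \<phi> assume \<phi>: "test_function \<phi>"
    define m where "m = (LINT x|lborel. \<phi> x)"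
    have t: "test_function (\<lambda>x. \<phi> x - m * \<rho> x)" by (intro test_function_diff test_function_cmult \<phi> \<rho>)
    have "(LINT x|lborel. \<phi> x - m * \<rho> x) = 0"
      using \<rho> integrable_test[OF \<phi>] integrable_test[OF \<rho>(1)] by (simp add: m_def)
    then obtain \<eta> where \<eta>: "test_function \<eta>" "deriv \<eta> = (\<lambda>x. \<phi> x - m * \<rho> x)"
      using test_function_antiderivative[OF t] by blast
    have "0 = (LINT x|lborel. q' x * (\<phi> x - m * \<rho> x))" using z'[OF \<eta>(1)] \<eta>(2) by simp
    also have "\<dots> = (LINT x|lborel. q' x * \<phi> x - m * (q' x * \<rho> x))" by (simp add: algebra_simps)
    also have "\<dots> = (LINT x|lborel. q' x * \<phi> x) - m * B" unfolding B_def
      using integrable_test_mult[OF c' \<phi>] integrable_test_mult[OF c' \<rho>(1)] by simp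
    also have "\<dots> = (LINT x|lborel. q' x * \<phi> x - B * \<phi> x)" unfolding m_def
      using integrable_test_mult[OF c' \<phi>] integrable_test[OF \<phi>] by simp
    finally show "(LINT x|lborel. (q' x - B) * \<phi> x) = 0" by (simp add: algebra_simps)
  qed
  thus thesis using that[of B] by (simp add: q'_def algebra_simps)
qed

text \<open>The same decomposition one order higher: \<open>q\<close> satisfies the hypothesis of
  the first-order lemma with \<open>A\<close> equal to its pairing with
  \<open>deriv \<rho>\<close>.\<close>

lemma du_bois_reymond2:
  fixes q :: "real \<Rightarrow> real"
  assumes c: "continuous_on UNIV q"
    and z: "\<And>\<phi>. test_function \<phi> \<Longrightarrow> (LINT x|lborel. q x * (deriv ^^ 2) \<phi> x) = 0"
  obtains A B where "\<And>x. q x = B - A * x"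
proof -
  obtain \<rho> where \<rho>: "test_function \<rho>" "(LINT x|lborel. \<rho> x) = 1" using test_function_integral_1 by blast
  define A where "A = (LINT x|lborel. q x * deriv \<rho> x)"
  have "(LINT x|lborel. q x * deriv \<phi> x) = A * (LINT x|lborel. \<phi> x)" if \<phi>: "test_function \<phi>" for \<phi>
  proof -
    define m where "m = (LINT x|lborel. \<phi> x)"
    have t: "test_function (\<lambda>x. \<phi> x - m * \<rho> x)" by (intro test_function_diff test_function_cmult \<phi> \<rho>)
    have "(LINT x|lborel. \<phi> x - m * \<rho> x) = 0"
      using \<rho> integrable_test[OF \<phi>] integrable_test[OF \<rho>(1)] by (simp add: m_def)
    then obtain \<eta> where \<eta>: "test_function \<eta>" "deriv \<eta> = (\<lambda>x. \<phi> x - m * \<rho> x)"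
      using test_function_antiderivative[OF t] by blast
    have "deriv (deriv \<eta>) = (\<lambda>x. deriv \<phi> x - m * deriv \<rho> x)"
      unfolding \<eta>(2) by (intro ext DERIV_imp_deriv DERIV_diff DERIV_cmult smooth_DERIV0 test_function_smooth \<phi> \<rho>)
    hence "0 = (LINT x|lborel. q x * (deriv \<phi> x - m * deriv \<rho> x))"
      using z[OF \<eta>(1)] by (simp add: numeral_2_eq_2)
    also have "\<dots> = (LINT x|lborel. q x * deriv \<phi> x - m * (q x * deriv \<rho> x))" by (simp add: algebra_simps)
    also have "\<dots> = (LINT x|lborel. q x * deriv \<phi> x) - m * A" unfolding A_def
      using integrable_test_mult[OF c test_function_deriv[OF \<phi>]] integrable_test_mult[OF c test_function_deriv[OF \<rho>(1)]] by simp
    finally show ?thesis by (simp add: m_def mult.commute)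
  qed
  from du_bois_reymond[OF c this] show thesis using that by blast
qed

section \<open>Elliptic regularity and the Sobolev inequality\<close>

lemma L2_indicator_integrable:
  assumes "L2 g" shows "integrable lborel (\<lambda>x. indicator {a..b} x * g x)"
proof -
  have "L2 (indicator {a..b :: real})"
    using borel_integrable_atLeastAtMost'[of a b "\<lambda>_. 1 :: real"]
    unfolding L2_def power2_eq_square by (auto simp: set_integrable_def simp flip: indicator_inter_arith)
  from L2_mult_integrable[OF this assms] show ?thesis .
qed

lemma integrable_product:
  fixes a b :: "real \<Rightarrow> real"
  assumes a: "integrable lborel a" and b: "integrable lborel b"
  shows "integrable (lborel \<Otimes>\<^sub>M lborel) (\<lambda>(x, y). a x * b y)"
proof -
  have [measurable]: "a \<in> borel_measurable lborel" "b \<in> borel_measurable lborel"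
    using a b by auto
  show ?thesis
  proof (rule lborel_pair.Fubini_integrable)
    have "(\<lambda>x. LINT y|lborel. norm (case (x, y) of (x, y) \<Rightarrow> a x * b y)) = (\<lambda>x. \<bar>a x\<bar> * (LINT y|lborel. \<bar>b y\<bar>))"
      by (simp add: abs_mult)
    thus "integrable lborel (\<lambda>x. LINT y|lborel. norm (case (x, y) of (x, y) \<Rightarrow> a x * b y))"
      using a by auto
  qed (use b in auto)
qed

text \<open>\<open>g\<close> is only square integrable, so its primitive \<open>G\<close> need not
  be differentiable at every point. That \<open>g\<close> is nevertheless its weak derivative comes
  from Fubini on the half-plane \<open>y \<le> x\<close>.\<close>

lemma L2_primitive:
  assumes g: "L2 g"
  obtains G where "continuous_on UNIV G"
    "\<And>\<phi>. test_function \<phi> \<Longrightarrow> (LINT x|lborel. G x * deriv \<phi> x) = - (LINT x|lborel. g x * \<phi> x)"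
proof -
  have si: "set_integrable lborel {a..b} g" for a b
    using L2_indicator_integrable[OF g] by (simp add: set_integrable_def)
  have gi: "g integrable_on {a..b}" for a b
    by (rule set_borel_integral_eq_integral(1)[OF si])
  have geq: "integral {a..b} g = (LINT y|lborel. indicator {a..b} y * g y)" for a b
    using set_borel_integral_eq_integral(2)[OF si] by (simp add: set_lebesgue_integral_def)
  \<comment> \<open>Signed integral from the origin: for each \<open>x\<close> at least one of the
    two terms is zero.\<close>
  define G where "G = (\<lambda>x. integral {0..x} g - integral {x..0} g)"
  have G: "integral {-r..x} g = G x + integral {-r..0} g" if "-r \<le> x" "r > 0" for r x
  proof (cases "x \<ge> 0")
    case True
    have "integral {-r..0} g + integral {0..x} g = integral {-r..x} g"
      by (rule Henstock_Kurzweil_Integration.integral_combine) (use True that gi in auto)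
    moreover have "integral {x..0} g = 0" using True by (cases "x = 0") auto
    ultimately show ?thesis by (simp add: G_def)
  next
    case False
    have "integral {-r..x} g + integral {x..0} g = integral {-r..0} g"
      by (rule Henstock_Kurzweil_Integration.integral_combine) (use False that gi in auto)
    moreover have "integral {0..x} g = 0" using False by auto
    ultimately show ?thesis by (simp add: G_def)
  qed
  have cG: "continuous_on UNIV G"
  proof (intro continuous_at_imp_continuous_on ballI)
    fix x :: real
    define r where "r = \<bar>x\<bar> + 1"
    have "continuous_on {-r..r} (\<lambda>x. integral {-r..x} g - integral {-r..0} g)"
      by (intro continuous_intros indefinite_integral_continuous_1 gi)
    moreover have "integral {-r..y} g - integral {-r..0} g = G y" if "y \<in> {-r..r}" for y
      using G[of r y] that by (auto simp: r_def)
    ultimately have "continuous_on {-r..r} G" by (rule continuous_on_eq)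
    thus "isCont G x" by (rule continuous_on_interior) (auto simp: r_def)
  qed
  have "(LINT x|lborel. G x * deriv \<phi> x) = - (LINT x|lborel. g x * \<phi> x)" if \<phi>: "test_function \<phi>" for \<phi>
  proof -
    obtain r0 where r0: "\<forall>x. r0 < \<bar>x\<bar> \<longrightarrow> \<phi> x = 0" using \<phi> by (auto simp: test_function_iff)
    define r where "r = \<bar>r0\<bar> + 1"
    have r: "r > 0" "\<And>x. r \<le> \<bar>x\<bar> \<Longrightarrow> \<phi> x = 0" "\<And>x. r \<le> \<bar>x\<bar> \<Longrightarrow> deriv \<phi> x = 0"
      using r0 funpow_deriv_zero_outside[OF r0, where k=1] by (auto simp: r_def)
    note d\<phi> = test_function_deriv[OF \<phi>]
    have cd: "continuous_on UNIV (deriv \<phi>)" by (intro smooth_continuous0 test_function_smooth d\<phi>)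
    have [measurable]: "g \<in> borel_measurable lborel" "deriv \<phi> \<in> borel_measurable lborel"
      using g cd by (auto simp: L2_def intro: borel_measurable_continuous_onI)
    \<comment> \<open>Integrating out \<open>y\<close> leaves \<open>G\<close> plus a constant,
      times \<open>deriv \<phi>\<close>; integrating out \<open>x\<close> leaves
      \<open>- (g y * \<phi> y)\<close> by the fundamental theorem for
      \<open>\<phi>\<close>.\<close>
    define h where "h = (\<lambda>x y. deriv \<phi> x * (indicator {-r..r} y * g y) * (if y \<le> x then 1 else 0 :: real))"
    have hi: "integrable (lborel \<Otimes>\<^sub>M lborel) (case_prod h)"
    proof (rule Bochner_Integration.integrable_bound)
      show "integrable (lborel \<Otimes>\<^sub>M lborel) (\<lambda>(x, y). deriv \<phi> x * (indicator {-r..r} y * g y))"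
        by (intro integrable_product integrable_test d\<phi> L2_indicator_integrable g)
      show "case_prod h \<in> borel_measurable (lborel \<Otimes>\<^sub>M lborel)" unfolding h_def by measurable
    qed (auto simp: h_def)
    have hy: "(LINT y|lborel. h x y) = (G x + integral {-r..0} g) * deriv \<phi> x" for x
    proof (cases "r \<le> \<bar>x\<bar>")
      case False
      have "h x y = deriv \<phi> x * (indicator {-r..x} y * g y)" for y
        using False by (auto simp: h_def indicator_def)
      thus ?thesis using G[of r x] r(1) False by (simp add: geq)
    qed (simp add: r(3) h_def)
    have hx: "(LINT x|lborel. h x y) = - (g y * \<phi> y)" for y
    proof (cases "r < \<bar>y\<bar>")
      case True
      hence "h x y = 0" for x by (auto simp: h_def indicator_def)
      thus ?thesis using True by (simp add: r(2))
    next
      case False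
      have "h x y = g y * (deriv \<phi> x * indicator {y..r} x)" for x
        using False r(3)[of x] by (auto simp: h_def indicator_def)
      hence "(LINT x|lborel. h x y) = g y * (LINT x|lborel. deriv \<phi> x * indicator {y..r} x)" by simp
      also have "(LINT x|lborel. deriv \<phi> x * indicator {y..r} x) = \<phi> r - \<phi> y"
        by (intro integral_FTC_Icc_real smooth_DERIV0 test_function_smooth \<phi>)
           (use False cd in \<open>auto simp: continuous_on_eq_continuous_at\<close>)
      finally show ?thesis using r(2)[of r] r(1) by simp
    qed
    have "(LINT x|lborel. G x * deriv \<phi> x) + integral {-r..0} g * (LINT x|lborel. deriv \<phi> x)
        = (LINT x|lborel. (LINT y|lborel. h x y))"
      unfolding hy ring_distribs
      using integrable_test_mult[OF cG d\<phi>] integrable_test[OF d\<phi>] by simp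
    also have "\<dots> = (LINT y|lborel. (LINT x|lborel. h x y))"
      using lborel_pair.Fubini_integral[OF hi] by simp
    also have "\<dots> = - (LINT y|lborel. g y * \<phi> y)" unfolding hx by simp
    also have "(LINT x|lborel. deriv \<phi> x) = 0"
      using integral_by_parts_test[of "\<lambda>_. 1" "\<lambda>_. 0" \<phi>] \<phi> by simp
    finally show ?thesis by simp
  qed
  thus thesis using cG that by blast
qed

text \<open>Integrating \<open>g\<close> twice gives a continuously differentiable \<open>P\<close>
  with the same second distributional derivative as \<open>f\<close>. The difference is continuous,
  hence affine.\<close>

lemma C1_if_L2_second_weak_deriv:
  assumes c: "continuous_on UNIV f" and g: "L2 g" and w: "has_weak_deriv 2 f g"
  obtains f' where "continuous_on UNIV f'" "\<And>x. (f has_real_derivative f' x) (at x)"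
proof -
  obtain G where G: "continuous_on UNIV G"
    "\<And>\<phi>. test_function \<phi> \<Longrightarrow> (LINT x|lborel. G x * deriv \<phi> x) = - (LINT x|lborel. g x * \<phi> x)"
    using L2_primitive[OF g] by blast
  obtain P where P: "\<And>x. (P has_real_derivative G x) (at x)" using antiderivative_exists[OF G(1)] by blast
  have cP: "continuous_on UNIV P" by (meson DERIV_continuous_on has_field_derivative_at_within P)
  have "(LINT x|lborel. (f x - P x) * (deriv ^^ 2) \<phi> x) = 0" if \<phi>: "test_function \<phi>" for \<phi>
  proof -
    have "(LINT x|lborel. P x * deriv (deriv \<phi>) x) = (LINT x|lborel. g x * \<phi> x)"
      using integral_by_parts_test[OF P G(1) test_function_deriv[OF \<phi>]] G(2)[OF \<phi>] by simp
    moreover have "(LINT x|lborel. f x * (deriv ^^ 2) \<phi> x) = (LINT x|lborel. g x * \<phi> x)"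
      using w \<phi> by (auto simp: has_weak_deriv_def)
    ultimately show ?thesis
      using integrable_test_mult[OF c test_function_funpow_deriv[OF \<phi>, of 2]]
        integrable_test_mult[OF cP test_function_funpow_deriv[OF \<phi>, of 2]]
      by (simp add: left_diff_distrib numeral_2_eq_2)
  qed
  moreover have "continuous_on UNIV (\<lambda>x. f x - P x)" by (intro continuous_intros c cP)
  ultimately obtain A B where AB: "\<And>x. f x - P x = B - A * x"
    using du_bois_reymond2[of "\<lambda>x. f x - P x"] by blast
  hence f: "f = (\<lambda>x. P x + B - A * x)" by (auto simp: algebra_simps)
  show thesis
  proof (rule that)
    show "continuous_on UNIV (\<lambda>x. G x - A)" by (intro continuous_intros G)
    show "(f has_real_derivative G x - A) (at x)" for x
      unfolding f by (auto intro!: derivative_eq_intros P)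
  qed
qed

text \<open>The second weak derivative already makes \<open>f\<close> continuously differentiable,
  and the weak derivatives of f' are those of \<open>f\<close> shifted by one. The class is
  therefore closed under differentiation.\<close>

lemma smooth_if_weak_derivs:
  assumes "continuous_on UNIV f" "\<And>k. \<exists>g. L2 g \<and> has_weak_deriv k f g"
  shows "smooth f"
proof (rule smooth_coinduct)
  let ?S = "{f. continuous_on UNIV f \<and> (\<forall>k. \<exists>g. L2 g \<and> has_weak_deriv k f g)}"
  show "f \<in> ?S" using assms by auto
  fix f assume f: "f \<in> ?S"
  hence c: "continuous_on UNIV f" by simp
  obtain f' where f': "continuous_on UNIV f'" "\<And>x. (f has_real_derivative f' x) (at x)"
    using f C1_if_L2_second_weak_deriv[of f] by blast
  have "\<exists>g. L2 g \<and> has_weak_deriv k f' g" for k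
  proof -
    obtain g where g: "L2 g" "has_weak_deriv (Suc k) f g" using f by blast
    have "has_weak_deriv k f' g" unfolding has_weak_deriv_def
    proof (intro allI impI)
      fix \<phi> assume \<phi>: "test_function \<phi>"
      show "(LINT x|lborel. f' x * (deriv ^^ k) \<phi> x) = (- 1) ^ k * (LINT x|lborel. g x * \<phi> x)"
        using integral_by_parts_test[OF f'(2,1) test_function_funpow_deriv[OF \<phi>, of k]] g(2) \<phi>
        by (simp add: has_weak_deriv_def)
    qed
    thus ?thesis using g by blast
  qed
  thus "\<exists>f'\<in>?S. \<forall>x. (f has_real_derivative f' x) (at x)" using f' by blast
qed

text \<open>Testing against \<open>h\<close> times a cutoff bounds \<open>h\<close> in \<open>L\<^sup>2\<close>, which makes the almost everywhere
  uniqueness of weak derivatives unnecessary.\<close>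

lemma L2_if_test_integrals_eq:
  assumes h: "smooth h" and g: "L2 g"
    and eq: "\<And>\<phi>. test_function \<phi> \<Longrightarrow> (LINT x|lborel. h x * \<phi> x) = (LINT x|lborel. g x * \<phi> x)"
  shows "L2 h" "(LINT x|lborel. (h x)\<^sup>2) \<le> (LINT x|lborel. (g x)\<^sup>2)"
proof -
  let ?I = "LINT x|lborel. (g x)\<^sup>2"
  obtain \<psi> where \<psi>: "test_function \<psi>" "\<And>x. 0 \<le> \<psi> x" "\<And>x. \<psi> x \<le> 1" "\<psi> 0 = 1"
    "\<And>x. \<bar>x\<bar> < 1 \<Longrightarrow> \<psi> x > 0" "\<And>x. \<bar>x\<bar> \<ge> 1 \<Longrightarrow> \<psi> x = 0" using bump_function by blast
  define \<eta> where "\<eta> = (\<lambda>n x. \<psi> ((1 / real (Suc n)) * x + 0))"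
  have \<eta>: "test_function (\<eta> n)" "0 \<le> \<eta> n x" "\<eta> n x \<le> 1" for n x
    unfolding \<eta>_def by (intro test_function_affine \<psi>; simp)+
  have ch: "continuous_on UNIV h" by (rule smooth_continuous0[OF h])
  have [measurable]: "h \<in> borel_measurable lborel" "\<And>n. \<eta> n \<in> borel_measurable lborel"
    using ch smooth_continuous0[OF test_function_smooth[OF \<eta>(1)]] by (auto intro: borel_measurable_continuous_onI)
  have int1: "integrable lborel (\<lambda>x. (h x)\<^sup>2 * \<eta> n x)" for n
    by (intro integrable_test_mult \<eta> continuous_intros ch)
  have bound: "(LINT x|lborel. (h x)\<^sup>2 * \<eta> n x) \<le> ?I" for n
  proof -
    have t: "test_function (\<lambda>x. h x * \<eta> n x)" by (intro test_function_mult h \<eta>)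
    have ig: "integrable lborel (\<lambda>x. (g x)\<^sup>2)" using g by (simp add: L2_def)
    have "(LINT x|lborel. (h x)\<^sup>2 * \<eta> n x) = (LINT x|lborel. g x * (h x * \<eta> n x))"
      using eq[OF t] by (simp add: power2_eq_square mult.assoc)
    \<comment> \<open>Young's inequality. The cutoff lies between 0 and 1, so its square is at most
      itself, and the second term is absorbed into the left side.\<close>
    also have "\<dots> \<le> (LINT x|lborel. (1/2) * (g x)\<^sup>2 + (1/2) * ((h x)\<^sup>2 * \<eta> n x))"
    proof (rule integral_mono)
      show "integrable lborel (\<lambda>x. g x * (h x * \<eta> n x))" by (rule L2_test_integrable[OF g t])
      show "integrable lborel (\<lambda>x. (1/2) * (g x)\<^sup>2 + (1/2) * ((h x)\<^sup>2 * \<eta> n x))" using ig int1 by simp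
      fix x
      have "2 * g x * (h x * \<eta> n x) \<le> (g x)\<^sup>2 + (h x * \<eta> n x)\<^sup>2" by (rule sum_squares_bound)
      also have "(h x * \<eta> n x)\<^sup>2 \<le> (h x)\<^sup>2 * \<eta> n x"
        unfolding power_mult_distrib using \<eta>(2,3)[of n x]
        by (intro mult_left_mono) (auto simp: power2_eq_square mult_left_le)
      finally show "g x * (h x * \<eta> n x) \<le> (1/2) * (g x)\<^sup>2 + (1/2) * ((h x)\<^sup>2 * \<eta> n x)" by simp
    qed
    also have "\<dots> = (1/2) * ?I + (1/2) * (LINT x|lborel. (h x)\<^sup>2 * \<eta> n x)" using ig int1 by simp
    finally show ?thesis by simp
  qed
  \<comment> \<open>Fatou's lemma removes the cutoff, since \<open>\<eta> n x\<close> tends to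
    \<open>\<psi> 0 = 1\<close> for every \<open>x\<close>.\<close>
  have "(\<integral>\<^sup>+x. ennreal ((h x)\<^sup>2) \<partial>lborel) = (\<integral>\<^sup>+x. liminf (\<lambda>n. ennreal ((h x)\<^sup>2 * \<eta> n x)) \<partial>lborel)"
  proof (intro nn_integral_cong)
    fix x
    have "(\<lambda>n. (1 / real (Suc n)) * x + 0) \<longlonglongrightarrow> 0 * x + 0"
      by (intro tendsto_intros) (use LIMSEQ_inverse_real_of_nat in \<open>simp add: inverse_eq_divide\<close>)
    hence "(\<lambda>n. (1 / real (Suc n)) * x + 0) \<longlonglongrightarrow> 0" by simp
    moreover have "isCont \<psi> 0"
      using smooth_continuous0[OF test_function_smooth[OF \<psi>(1)], of UNIV] by (simp add: continuous_on_eq_continuous_at)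
    ultimately have "(\<lambda>n. \<eta> n x) \<longlonglongrightarrow> \<psi> 0" unfolding \<eta>_def
      by (rule isCont_tendsto_compose[rotated])
    hence "(\<lambda>n. (h x)\<^sup>2 * \<eta> n x) \<longlonglongrightarrow> (h x)\<^sup>2 * 1" unfolding \<psi>(4) by (intro tendsto_intros)
    hence "(\<lambda>n. ennreal ((h x)\<^sup>2 * \<eta> n x)) \<longlonglongrightarrow> ennreal ((h x)\<^sup>2)" by (intro tendsto_ennrealI) simp
    thus "ennreal ((h x)\<^sup>2) = liminf (\<lambda>n. ennreal ((h x)\<^sup>2 * \<eta> n x))"
      by (intro lim_imp_Liminf[symmetric]) auto
  qed
  also have "\<dots> \<le> liminf (\<lambda>n. (\<integral>\<^sup>+x. ennreal ((h x)\<^sup>2 * \<eta> n x) \<partial>lborel))"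
    by (intro nn_integral_liminf) measurable
  also have "\<dots> \<le> liminf (\<lambda>n. ennreal ?I)"
  proof (intro Liminf_mono always_eventually allI)
    fix n
    have "(\<integral>\<^sup>+x. ennreal ((h x)\<^sup>2 * \<eta> n x) \<partial>lborel) = ennreal (LINT x|lborel. (h x)\<^sup>2 * \<eta> n x)"
      by (intro nn_integral_eq_integral int1) (use \<eta> in auto)
    also have "\<dots> \<le> ennreal ?I" by (intro ennreal_leI bound)
    finally show "(\<integral>\<^sup>+x. ennreal ((h x)\<^sup>2 * \<eta> n x) \<partial>lborel) \<le> ennreal ?I" .
  qed
  also have "\<dots> = ennreal ?I" by (simp add: Liminf_const)
  finally have nn: "(\<integral>\<^sup>+x. ennreal ((h x)\<^sup>2) \<partial>lborel) \<le> ennreal ?I" .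
  have ih: "integrable lborel (\<lambda>x. (h x)\<^sup>2)"
    by (rule integrableI_nonneg) (use nn in \<open>auto simp: le_less_trans\<close>)
  thus "L2 h" by (simp add: L2_def)
  have "ennreal (LINT x|lborel. (h x)\<^sup>2) \<le> ennreal ?I" using nn nn_integral_eq_integral[OF ih] by simp
  thus "(LINT x|lborel. (h x)\<^sup>2) \<le> ?I" by (subst (asm) ennreal_le_iff) auto
qed

lemma sobolev_weak_deriv:
  assumes "sobolev s f" "k \<le> s"
  shows "L2 (weak_deriv k f)" "has_weak_deriv k f (weak_deriv k f)"
  using someI_ex[of "\<lambda>g. L2 g \<and> has_weak_deriv k f g"] assms
  by (auto simp: sobolev_def weak_deriv_def)

text \<open>\<open>sobolev_norm\<close> is built from a chosen weak derivative, while the estimates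
  use classical ones. Both have the same test integrals, so the classical derivative is square
  integrable with at most the same norm.\<close>

lemma sobolev_regularity:
  assumes c: "continuous_on UNIV f" and s: "\<And>s. sobolev s f"
  shows "smooth f" "L2 ((deriv ^^ k) f)"
    "k \<le> s \<Longrightarrow> (LINT x|lborel. ((deriv ^^ k) f x)\<^sup>2) \<le> (sobolev_norm s f)\<^sup>2"
proof -
  show sm: "smooth f" by (rule smooth_if_weak_derivs[OF c]) (use s in \<open>auto simp: sobolev_def\<close>)
  have "(LINT x|lborel. (deriv ^^ k) f x * \<phi> x) = (LINT x|lborel. weak_deriv k f x * \<phi> x)"
    if \<phi>: "test_function \<phi>" for \<phi>
    using integral_by_parts_test_funpow[OF sm \<phi>, of k] sobolev_weak_deriv(2)[OF s, of k k] \<phi>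
    by (simp add: has_weak_deriv_def)
  note * = L2_if_test_integrals_eq[OF smooth_funpow_deriv[OF sm] sobolev_weak_deriv(1)[OF s, of k k] this]
  show "L2 ((deriv ^^ k) f)" using *(1) by simp
  assume "k \<le> s"
  have "(LINT x|lborel. ((deriv ^^ k) f x)\<^sup>2) \<le> (LINT x|lborel. (weak_deriv k f x)\<^sup>2)" using *(2) by simp
  also have "\<dots> \<le> (\<Sum>k\<le>s. LINT x|lborel. (weak_deriv k f x)\<^sup>2)"
    using \<open>k \<le> s\<close> by (intro member_le_sum) auto
  also have "\<dots> = (sobolev_norm s f)\<^sup>2" by (simp add: sobolev_norm_def sum_nonneg)
  finally show "(LINT x|lborel. ((deriv ^^ k) f x)\<^sup>2) \<le> (sobolev_norm s f)\<^sup>2" .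
qed

lemma sobolev_diff:
  assumes "sobolev s f" "sobolev s g" shows "sobolev s (\<lambda>x. f x - g x)"
  unfolding sobolev_def
proof (intro conjI allI impI)
  show "L2 (\<lambda>x. f x - g x)" using assms by (auto simp: sobolev_def intro: L2_diff)
  fix k assume "k \<le> s"
  then obtain f' g' where *: "L2 f'" "has_weak_deriv k f f'" "L2 g'" "has_weak_deriv k g g'"
    using assms unfolding sobolev_def by blast
  have L: "L2 f" "L2 g" using assms by (auto simp: sobolev_def)
  have "has_weak_deriv k (\<lambda>x. f x - g x) (\<lambda>x. f' x - g' x)"
    using * L L2_test_integrable test_function_funpow_deriv[of _ k]
    by (auto simp: has_weak_deriv_def left_diff_distrib right_diff_distrib)
  thus "\<exists>h. L2 h \<and> has_weak_deriv k (\<lambda>x. f x - g x) h" using * L2_diff by blast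
qed

lemma sobolev_if_smooth_L2:
  assumes "smooth f" "\<And>k. L2 ((deriv ^^ k) f)" shows "sobolev s f"
  using assms assms(2)[of 0] integral_by_parts_test_funpow[OF assms(1)]
  by (auto simp: sobolev_def has_weak_deriv_def)

lemma integrable_bounded_mult:
  fixes f w :: "real \<Rightarrow> real"
  assumes "integrable lborel f" "continuous_on UNIV w" "\<And>x. \<bar>w x\<bar> \<le> M"
  shows "integrable lborel (\<lambda>x. f x * w x)"
proof (rule Bochner_Integration.integrable_bound)
  show "integrable lborel (\<lambda>x. M * f x)" using assms by simp
  have "w \<in> borel_measurable lborel" using assms by (simp add: borel_measurable_continuous_onI)
  thus "(\<lambda>x. f x * w x) \<in> borel_measurable lborel" using assms by simp
  have "\<bar>f x * w x\<bar> \<le> \<bar>M * f x\<bar>" for x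
    using mult_left_mono[OF order_trans[OF assms(3)[of x] abs_ge_self[of M]], of "\<bar>f x\<bar>"] by (simp add: abs_mult mult.commute)
  thus "AE x in lborel. norm (f x * w x) \<le> norm (M * f x)" by simp
qed

text \<open>The square of \<open>v\<close> times \<open>w\<close> is continuously differentiable and
  integrable, hence bounded by the integral of the absolute value of its derivative. The bound of
  \<open>w'\<close> by \<open>K * w\<close> lets the term with \<open>w'\<close> be measured by the
  weight itself, so the constant does not depend on where the weight is centred.\<close>

lemma weighted_sobolev_inequality:
  assumes v: "\<And>x. (v has_real_derivative v' x) (at x)" "continuous_on UNIV v'" "L2 v" "L2 v'"
    and w: "\<And>x. (w has_real_derivative w' x) (at x)" "continuous_on UNIV w'"
      "\<And>x. 0 \<le> w x" "\<And>x. w x \<le> M" "\<And>x. \<bar>w' x\<bar> \<le> K * w x" and K: "K \<ge> 0"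
  shows "(v x)\<^sup>2 * w x \<le> (1 + K) * (LINT x|lborel. ((v x)\<^sup>2 + (v' x)\<^sup>2) * w x)"
proof -
  have cv: "continuous_on UNIV v" by (meson DERIV_continuous_on has_field_derivative_at_within v(1))
  have cw: "continuous_on UNIV w" by (meson DERIV_continuous_on has_field_derivative_at_within w(1))
  have bw: "\<bar>w x\<bar> \<le> M" "\<bar>w' x\<bar> \<le> K * M" for x
    using w(3)[of x] w(4)[of x] w(5)[of x] mult_left_mono[OF w(4)[of x] K] by auto
  have vv: "integrable lborel (\<lambda>x. (v x)\<^sup>2)" "integrable lborel (\<lambda>x. (v' x)\<^sup>2)" using v by (auto simp: L2_def)
  have i1: "integrable lborel (\<lambda>x. (v x)\<^sup>2 * w x)" "integrable lborel (\<lambda>x. (v x * v' x) * w x)"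
    by (rule integrable_bounded_mult[OF _ cw bw(1)], intro vv L2_mult_integrable v)+
  have i2: "integrable lborel (\<lambda>x. (v x)\<^sup>2 * w' x)"
    by (rule integrable_bounded_mult[OF _ w(2) bw(2)], intro vv)
  have i3: "integrable lborel (\<lambda>x. ((v x)\<^sup>2 + (v' x)\<^sup>2) * w x)"
    by (rule integrable_bounded_mult[OF _ cw bw(1)]) (use vv in auto)
  have i4: "integrable lborel (\<lambda>x. 2 * (v x * v' x) * w x + (v x)\<^sup>2 * w' x)" using i1 i2 by (simp add: mult.assoc)
  have "\<bar>(v x)\<^sup>2 * w x\<bar> \<le> (LINT x|lborel. \<bar>2 * (v x * v' x) * w x + (v x)\<^sup>2 * w' x\<bar>)"
  proof (rule C1_abs_le_integral_deriv[where f="\<lambda>x. (v x)\<^sup>2 * w x"])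
    show "((\<lambda>x. (v x)\<^sup>2 * w x) has_real_derivative 2 * (v x * v' x) * w x + (v x)\<^sup>2 * w' x) (at x)" for x
      by (auto intro!: derivative_eq_intros v(1) w(1))
    show "continuous_on UNIV (\<lambda>x. 2 * (v x * v' x) * w x + (v x)\<^sup>2 * w' x)"
      by (intro continuous_intros cv cw v w)
  qed (use i1 i4 in auto)
  also have "\<dots> \<le> (LINT x|lborel. (1 + K) * (((v x)\<^sup>2 + (v' x)\<^sup>2) * w x))"
  proof (rule integral_mono)
    show "integrable lborel (\<lambda>x. (1 + K) * (((v x)\<^sup>2 + (v' x)\<^sup>2) * w x))" using i3 by simp
    fix x
    have "\<bar>2 * (v x * v' x) * w x\<bar> \<le> ((v x)\<^sup>2 + (v' x)\<^sup>2) * w x"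
      using mult_right_mono[OF sum_squares_bound[of "\<bar>v x\<bar>" "\<bar>v' x\<bar>"] w(3)[of x]] w(3)[of x]
      by (simp add: abs_mult mult.assoc)
    moreover have "\<bar>(v x)\<^sup>2 * w' x\<bar> \<le> (v x)\<^sup>2 * (K * w x)"
      unfolding abs_mult by (intro mult_mono w) auto
    moreover have "(v x)\<^sup>2 * (K * w x) \<le> ((v x)\<^sup>2 + (v' x)\<^sup>2) * (K * w x)"
      using w(3)[of x] K by (intro mult_right_mono) auto
    ultimately show "\<bar>2 * (v x * v' x) * w x + (v x)\<^sup>2 * w' x\<bar> \<le> (1 + K) * (((v x)\<^sup>2 + (v' x)\<^sup>2) * w x)"
      by (simp add: algebra_simps)
  qed (use i4 in auto)
  finally show ?thesis using i3 w(3)[of x] by simp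
qed

lemma sobolev_inequality:
  assumes sm: "smooth f" and L: "\<And>k. L2 ((deriv ^^ k) f)"
  shows "((deriv ^^ k) f x)\<^sup>2 \<le> (LINT x|lborel. ((deriv ^^ k) f x)\<^sup>2) + (LINT x|lborel. ((deriv ^^ Suc k) f x)\<^sup>2)"
proof -
  have "((deriv ^^ k) f x)\<^sup>2 * 1 \<le> (1 + 0) * (LINT x|lborel. (((deriv ^^ k) f x)\<^sup>2 + ((deriv ^^ Suc k) f x)\<^sup>2) * 1)"
    by (rule weighted_sobolev_inequality[where w="\<lambda>_. 1" and w'="\<lambda>_. 0" and M=1, OF smooth_DERIV[OF sm] smooth_continuous[OF sm] L L])
      auto
  moreover have "integrable lborel (\<lambda>x. ((deriv ^^ k) f x)\<^sup>2)" for k using L by (auto simp: L2_def)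
  ultimately show ?thesis using L by (simp del: funpow.simps)
qed

lemma sobolev_pointwise:
  assumes c: "continuous_on UNIV f" and s: "\<And>s. sobolev s f"
  shows "\<bar>(deriv ^^ k) f x\<bar> \<le> 2 * sobolev_norm (Suc k) f"
proof -
  have n: "sobolev_norm (Suc k) f \<ge> 0" unfolding sobolev_norm_def by (intro real_sqrt_ge_zero sum_nonneg) auto
  have "((deriv ^^ k) f x)\<^sup>2 \<le> (sobolev_norm (Suc k) f)\<^sup>2 + (sobolev_norm (Suc k) f)\<^sup>2"
    using sobolev_inequality[OF sobolev_regularity(1,2)[OF c s], of k x]
      sobolev_regularity(3)[OF c s, of k "Suc k"] sobolev_regularity(3)[OF c s, of "Suc k" "Suc k"] by simp
  also have "\<dots> \<le> (2 * sobolev_norm (Suc k) f)\<^sup>2" by (simp add: power_mult_distrib)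
  finally have "\<bar>(deriv ^^ k) f x\<bar> \<le> \<bar>2 * sobolev_norm (Suc k) f\<bar>" by (rule abs_le_square_iff[THEN iffD2])
  thus ?thesis using n by simp
qed

section \<open>Solitons\<close>

lemma integrable_exp_minus_abs:
  assumes k: "k > (0::real)"
  shows "integrable lborel (\<lambda>x. exp (- k * \<bar>x\<bar>))"
proof -
  have "(\<integral>\<^sup>+x\<in>{0..}. ennreal (exp (- k * x)) \<partial>lborel) = ennreal (0 - - (exp (- k * 0) / k))"
  proof (rule nn_integral_FTC_atLeast)
    show "((\<lambda>x. - (exp (- k * x) / k)) has_real_derivative exp (- k * x)) (at x)" for x
      using k by (auto intro!: derivative_eq_intros)
    have "((\<lambda>x. exp (- k * x)) \<longlongrightarrow> 0) at_top"
      using k by (intro filterlim_compose[OF exp_at_bot] filterlim_tendsto_neg_mult_at_bot[OF tendsto_const])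
        (auto intro: filterlim_ident)
    hence "((\<lambda>x. - (exp (- k * x) / k)) \<longlongrightarrow> - (0 / k)) at_top" using k by (intro tendsto_intros) auto
    thus "((\<lambda>x. - (exp (- k * x) / k)) \<longlongrightarrow> 0) at_top" by simp
  qed auto
  hence *: "(\<integral>\<^sup>+x. ennreal (exp (- k * x) * indicator {0..} x) \<partial>lborel) < \<infinity>"
    by (simp add: ennreal_mult ennreal_indicator)
  have i: "integrable lborel (\<lambda>x. exp (- k * x) * indicator {0..} x)"
    by (rule integrableI_nonneg) (use * in auto)
  have "integrable lborel (\<lambda>x. exp (- k * x) * indicator {0..} x + exp (- k * (- x)) * indicator {0..} (- x))"
    by (intro Bochner_Integration.integrable_add i integrable_reflect[OF i])
  thus ?thesis
    by (rule Bochner_Integration.integrable_bound) (auto simp: indicator_def)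
qed

lemma exp_minus_abs_shift:
  assumes k: "k > (0::real)"
  shows "integrable lborel (\<lambda>x. exp (- k * \<bar>x - a\<bar>))"
    "(LINT x|lborel. exp (- k * \<bar>x - a\<bar>)) = (LINT x|lborel. exp (- k * \<bar>x\<bar>))"
  using lborel_integrable_real_affine[OF integrable_exp_minus_abs[OF k], of 1 "-a"]
    lborel_integral_real_affine[of 1 "\<lambda>x. exp (- k * \<bar>x\<bar>)" "-a"] by (simp_all add: add.commute)

lemma poly_bounded_on_unit_interval:
  obtains M where "M > 0" "\<And>t::real. \<bar>t\<bar> \<le> 1 \<Longrightarrow> \<bar>poly P t\<bar> \<le> M"
proof -
  have "compact (poly P ` {-1..1})" by (intro compact_continuous_image continuous_intros) auto
  then obtain M where "M > 0" "\<forall>y\<in>poly P ` {-1..1}. norm y \<le> M"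
    using compact_imp_bounded bounded_pos by metis
  thus thesis using that[of M] by (auto simp: abs_le_iff)
qed

context
  fixes p :: nat
  assumes p: "p \<ge> 2"
begin

text \<open>The profile satisfies Q' = -Q tanh(kx), and tanh(kx) has derivative k (1 - tanh^2), so
  the products of Q with a polynomial in tanh(kx) are closed under differentiation. The polynomial
  on the right is -X P + k (1 - X^2) P'.\<close>

lemma ground_state_poly_tanh_DERIV:
  defines "k \<equiv> (real p - 1) / 2"
  shows "((\<lambda>x. ground_state p x * poly P (tanh (k * x))) has_real_derivative
    ground_state p x * poly (P * [:0, -1:] + pderiv P * [:k, 0, -k:]) (tanh (k * x))) (at x)"
proof -
  have pos: "(real p + 1) / (2 * (cosh (k * x))\<^sup>2) > 0" by simp
  have pn: "real p - 1 \<noteq> 0" using p by auto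
  have Q: "(ground_state p has_real_derivative - ground_state p x * tanh (k * x)) (at x)"
  proof -
    have "((\<lambda>x. (real p + 1) / (2 * (cosh (k * x))\<^sup>2)) has_real_derivative
        - (2 * k * tanh (k * x)) * ((real p + 1) / (2 * (cosh (k * x))\<^sup>2))) (at x)"
      by (auto intro!: derivative_eq_intros simp: tanh_def field_simps power2_eq_square)
    from DERIV_fun_powr[OF this pos, of "1 / (real p - 1)"]
    have "((\<lambda>x. ((real p + 1) / (2 * (cosh (k * x))\<^sup>2)) powr (1 / (real p - 1))) has_real_derivative
        1 / (real p - 1) * ((real p + 1) / (2 * (cosh (k * x))\<^sup>2)) powr (1 / (real p - 1) - 1) *
        (- (2 * k * tanh (k * x)) * ((real p + 1) / (2 * (cosh (k * x))\<^sup>2)))) (at x)" by simp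
    moreover have "1 / (real p - 1) * ((real p + 1) / (2 * (cosh (k * x))\<^sup>2)) powr (1 / (real p - 1) - 1) *
        (- (2 * k * tanh (k * x)) * ((real p + 1) / (2 * (cosh (k * x))\<^sup>2)))
        = - (2 * k / (real p - 1)) * tanh (k * x) * ((real p + 1) / (2 * (cosh (k * x))\<^sup>2)) powr (1 / (real p - 1))"
      using pos by (simp add: powr_diff)
    \<comment> \<open>The exponent 1 / (p - 1) and the factor (p - 1) / 2 inside cosh cancel, which
      gives Q' = -Q tanh(kx) without a constant.\<close>
    moreover have "2 * k / (real p - 1) = 1" using pn by (simp add: k_def)
    ultimately show ?thesis unfolding ground_state_def[abs_def] k_def by (simp add: mult.commute)
  qed
  have T: "((\<lambda>x. tanh (k * x)) has_real_derivative k * (1 - (tanh (k * x))\<^sup>2)) (at x)"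
    by (auto intro!: derivative_eq_intros)
  show ?thesis
    by (rule DERIV_cong[OF DERIV_mult[OF Q DERIV_chain2[OF poly_DERIV T]]])
       (simp add: algebra_simps power2_eq_square)
qed

lemma ground_state_funpow_deriv:
  "\<exists>P. (deriv ^^ s) (ground_state p) = (\<lambda>x. ground_state p x * poly P (tanh ((real p - 1) / 2 * x)))"
proof (induction s)
  case 0
  show ?case by (rule exI[of _ 1]) simp
next
  case (Suc s)
  then obtain P where "(deriv ^^ s) (ground_state p) = (\<lambda>x. ground_state p x * poly P (tanh ((real p - 1) / 2 * x)))"
    by blast
  moreover have "deriv (\<lambda>x. ground_state p x * poly P (tanh ((real p - 1) / 2 * x))) = (\<lambda>x. ground_state p x *
      poly (P * [:0, -1:] + pderiv P * [:(real p - 1) / 2, 0, - ((real p - 1) / 2):]) (tanh ((real p - 1) / 2 * x)))"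
    by (rule ext, rule DERIV_imp_deriv, rule ground_state_poly_tanh_DERIV)
  ultimately have "(deriv ^^ Suc s) (ground_state p) = (\<lambda>x. ground_state p x *
      poly (P * [:0, -1:] + pderiv P * [:(real p - 1) / 2, 0, - ((real p - 1) / 2):]) (tanh ((real p - 1) / 2 * x)))"
    by (simp only: funpow.simps comp_apply)
  thus ?case by blast
qed

lemma smooth_ground_state: "smooth (ground_state p)"
  unfolding smooth_def
proof (intro allI)
  fix s x
  obtain P where P: "(deriv ^^ s) (ground_state p) = (\<lambda>x. ground_state p x * poly P (tanh ((real p - 1) / 2 * x)))"
    using ground_state_funpow_deriv by blast
  show "(deriv ^^ s) (ground_state p) differentiable (at x)"
    unfolding P using ground_state_poly_tanh_DERIV[of P x] real_differentiable_def by blast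
qed

text \<open>From 2 cosh(kx) \<ge> exp(k |x|), raised to the power -2 / (p - 1). Since 2k = p - 1,
  the decay rate is 1 for every p.\<close>

lemma ground_state_le: "0 \<le> ground_state p x" "ground_state p x \<le> (2 * (real p + 1)) powr (1 / (real p - 1)) * exp (- \<bar>x\<bar>)"
proof -
  define k where "k = (real p - 1) / 2"
  have k: "k > 0" using p by (simp add: k_def)
  show "0 \<le> ground_state p x" by (simp add: ground_state_def)
  have "exp (k * \<bar>x\<bar>) \<le> 2 * cosh (k * x)"
    using k by (cases "x \<ge> 0") (simp_all add: cosh_def)
  hence "(exp (k * \<bar>x\<bar>))\<^sup>2 \<le> (2 * cosh (k * x))\<^sup>2" by (intro power_mono) auto
  hence c: "exp (2 * k * \<bar>x\<bar>) \<le> 4 * (cosh (k * x))\<^sup>2"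
    by (simp add: power_mult_distrib mult.assoc flip: exp_double)
  have "(real p + 1) / (2 * (cosh (k * x))\<^sup>2) = 2 * (real p + 1) / (4 * (cosh (k * x))\<^sup>2)" by (simp add: field_simps)
  also have "\<dots> \<le> 2 * (real p + 1) / exp (2 * k * \<bar>x\<bar>)"
    by (intro divide_left_mono c) auto
  also have "\<dots> = 2 * (real p + 1) * exp (- (2 * k * \<bar>x\<bar>))" by (simp add: exp_minus field_simps)
  finally have "ground_state p x \<le> (2 * (real p + 1) * exp (- (2 * k * \<bar>x\<bar>))) powr (1 / (real p - 1))"
    unfolding ground_state_def k_def using p by (intro powr_mono2) auto
  also have "\<dots> = (2 * (real p + 1)) powr (1 / (real p - 1)) * exp (- \<bar>x\<bar>)"
  proof -
    have "- (2 * k * \<bar>x\<bar>) * (1 / (real p - 1)) = - \<bar>x\<bar>" using p by (simp add: k_def)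
    thus ?thesis by (subst powr_mult) (auto simp only: exp_powr_real)
  qed
  finally show "ground_state p x \<le> (2 * (real p + 1)) powr (1 / (real p - 1)) * exp (- \<bar>x\<bar>)" .
qed

lemma smooth_soliton: "smooth (soliton p c y t)"
  and soliton_funpow_deriv: "(deriv ^^ s) (soliton p c y t) =
    (\<lambda>x. c powr (1 / (real p - 1)) * (sqrt c ^ s * (deriv ^^ s) (ground_state p) (sqrt c * x + sqrt c * (- c * t - y))))"
proof -
  have *: "soliton p c y t = (\<lambda>x. c powr (1 / (real p - 1)) * ground_state p (sqrt c * x + sqrt c * (- c * t - y)))"
    by (simp add: fun_eq_iff soliton_def scaled_ground_state_def algebra_simps)
  show "smooth (soliton p c y t)" unfolding * by (intro smooth_cmult smooth_affine smooth_ground_state)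
  show "(deriv ^^ s) (soliton p c y t) =
    (\<lambda>x. c powr (1 / (real p - 1)) * (sqrt c ^ s * (deriv ^^ s) (ground_state p) (sqrt c * x + sqrt c * (- c * t - y))))"
    unfolding * smooth_cmult(2)[OF smooth_affine(1)[OF smooth_ground_state]] smooth_affine(2)[OF smooth_ground_state] ..
qed

text \<open>The polynomial in tanh is bounded, so every derivative decays like the profile, at rate
  \<open>sqrt c\<close>. Giving away part of the rate provides a common \<open>k\<close> for
  solitons of different speeds; the phase \<open>y\<close> only costs the factor
  \<open>exp (k * \<bar>y\<bar>)\<close>.\<close>

lemma soliton_funpow_deriv_bound:
  assumes c: "c > 0" and k: "0 \<le> k" "k \<le> sqrt c"
  shows "\<exists>C>0. \<forall>t x. \<bar>(deriv ^^ s) (soliton p c y t) x\<bar> \<le> C * exp (- k * \<bar>x - c * t\<bar>)"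
proof -
  obtain P where P: "(deriv ^^ s) (ground_state p) = (\<lambda>x. ground_state p x * poly P (tanh ((real p - 1) / 2 * x)))"
    using ground_state_funpow_deriv by blast
  obtain M where M: "M > 0" "\<And>t::real. \<bar>t\<bar> \<le> 1 \<Longrightarrow> \<bar>poly P t\<bar> \<le> M"
    using poly_bounded_on_unit_interval by blast
  define A where "A = c powr (1 / (real p - 1)) * (sqrt c ^ s * ((2 * (real p + 1)) powr (1 / (real p - 1)) * M))"
  have A: "A > 0" using c M(1) by (simp add: A_def)
  have "\<bar>(deriv ^^ s) (soliton p c y t) x\<bar> \<le> A * exp (k * \<bar>y\<bar>) * exp (- k * \<bar>x - c * t\<bar>)" for t x
  proof -
    define z where "z = sqrt c * x + sqrt c * (- c * t - y)"
    have "\<bar>(deriv ^^ s) (ground_state p) z\<bar> \<le> ((2 * (real p + 1)) powr (1 / (real p - 1)) * exp (- \<bar>z\<bar>)) * M"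
      unfolding P abs_mult using ground_state_le[of z] tanh_real_bounds[of "(real p - 1) / 2 * z"]
      by (intro mult_mono M) (auto simp: abs_le_iff)
    hence "\<bar>(deriv ^^ s) (soliton p c y t) x\<bar> \<le>
      c powr (1 / (real p - 1)) * (sqrt c ^ s * (((2 * (real p + 1)) powr (1 / (real p - 1)) * exp (- \<bar>z\<bar>)) * M))"
      unfolding soliton_funpow_deriv z_def[symmetric] abs_mult using c
      by (intro mult_mono) auto
    also have "\<dots> = A * exp (- \<bar>z\<bar>)" by (simp add: A_def)
    also have "exp (- \<bar>z\<bar>) \<le> exp (k * \<bar>y\<bar>) * exp (- k * \<bar>x - c * t\<bar>)"
    proof -
      have "k * \<bar>x - c * t\<bar> - k * \<bar>y\<bar> \<le> k * \<bar>x - c * t - y\<bar>"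
        using mult_left_mono[OF abs_triangle_ineq2[of "x - c * t" y] k(1)] by (simp add: algebra_simps)
      also have "\<dots> \<le> sqrt c * \<bar>x - c * t - y\<bar>" using k by (intro mult_right_mono) auto
      also have "\<dots> = \<bar>sqrt c * (x - c * t - y)\<bar>" using c by (simp add: abs_mult)
      also have "sqrt c * (x - c * t - y) = z" by (simp add: z_def algebra_simps)
      finally show ?thesis by (simp flip: exp_add)
    qed
    finally show ?thesis using A by (simp add: mult.assoc)
  qed
  thus ?thesis using A by (intro exI[of _ "A * exp (k * \<bar>y\<bar>)"]) simp
qed

end

lemma smooth_sum:
  assumes "finite J" "\<And>j. j \<in> J \<Longrightarrow> smooth (f j)"
  shows "smooth (\<lambda>x. \<Sum>j\<in>J. f j x)" "(deriv ^^ k) (\<lambda>x. \<Sum>j\<in>J. f j x) = (\<lambda>x. \<Sum>j\<in>J. (deriv ^^ k) (f j) x)"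
proof -
  let ?F = "\<lambda>i x. \<Sum>j\<in>J. (deriv ^^ i) (f j) x"
  have *: "\<And>i x. (?F i has_real_derivative ?F (Suc i) x) (at x)"
    by (intro DERIV_sum smooth_DERIV assms)
  show "smooth (\<lambda>x. \<Sum>j\<in>J. f j x)" using smoothI_jets[of ?F, OF *] by simp
  show "(deriv ^^ k) (\<lambda>x. \<Sum>j\<in>J. f j x) = (\<lambda>x. \<Sum>j\<in>J. (deriv ^^ k) (f j) x)"
    using funpow_deriv_eqI[of ?F, OF *] by simp
qed

lemma soliton_sum_eq: "soliton_sum p N c y t = (\<lambda>x. \<Sum>j=1..N. soliton p (c j) (y j) t x)"
  by (simp add: fun_eq_iff soliton_sum_def)

lemma smooth_soliton_sum: "p \<ge> 2 \<Longrightarrow> smooth (soliton_sum p N c y t)"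
  unfolding soliton_sum_eq by (intro smooth_sum smooth_soliton) auto

lemma soliton_sum_funpow_deriv_bound:
  assumes p: "p \<ge> 2" and c: "\<And>j. j \<in> {1..N} \<Longrightarrow> 0 < c j" and k: "0 \<le> k" "\<And>j. j \<in> {1..N} \<Longrightarrow> k \<le> sqrt (c j)"
  obtains C where "C > 0" "\<And>t x. \<bar>(deriv ^^ s) (soliton_sum p N c y t) x\<bar> \<le> C * (\<Sum>j=1..N. exp (- k * \<bar>x - c j * t\<bar>))"
proof -
  have "\<forall>j\<in>{1..N}. \<exists>C>0. \<forall>t x. \<bar>(deriv ^^ s) (soliton p (c j) (y j) t) x\<bar> \<le> C * exp (- k * \<bar>x - c j * t\<bar>)"
    using soliton_funpow_deriv_bound[OF p] c k by blast
  then obtain C where C: "\<And>j. j \<in> {1..N} \<Longrightarrow> C j > 0 \<and> (\<forall>t x. \<bar>(deriv ^^ s) (soliton p (c j) (y j) t) x\<bar> \<le> C j * exp (- k * \<bar>x - c j * t\<bar>))"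
    by metis
  \<comment> \<open>The summand 1 keeps the constant positive when the sum is empty.\<close>
  define D where "D = 1 + (\<Sum>j=1..N. C j)"
  have nn: "(\<Sum>j=1..N. C j) \<ge> 0" using C by (intro sum_nonneg) (auto simp: less_imp_le)
  have CD: "C j \<le> D" if "j \<in> {1..N}" for j
    using member_le_sum[of j "{1..N}" C] C that by (auto simp: D_def less_imp_le)
  show thesis
  proof (rule that[of D])
    show "D > 0" using nn by (simp add: D_def)
    fix t x
    have "\<bar>(deriv ^^ s) (soliton_sum p N c y t) x\<bar> \<le> (\<Sum>j=1..N. \<bar>(deriv ^^ s) (soliton p (c j) (y j) t) x\<bar>)"
      unfolding soliton_sum_eq
      by (subst smooth_sum(2)) (auto intro!: smooth_soliton p sum_abs)
    also have "\<dots> \<le> (\<Sum>j=1..N. D * exp (- k * \<bar>x - c j * t\<bar>))"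
    proof (intro sum_mono)
      fix j assume j: "j \<in> {1..N}"
      have "\<bar>(deriv ^^ s) (soliton p (c j) (y j) t) x\<bar> \<le> C j * exp (- k * \<bar>x - c j * t\<bar>)" using C[OF j] by blast
      also have "\<dots> \<le> D * exp (- k * \<bar>x - c j * t\<bar>)" by (intro mult_right_mono CD j) auto
      finally show "\<bar>(deriv ^^ s) (soliton p (c j) (y j) t) x\<bar> \<le> D * exp (- k * \<bar>x - c j * t\<bar>)" .
    qed
    finally show "\<bar>(deriv ^^ s) (soliton_sum p N c y t) x\<bar> \<le> D * (\<Sum>j=1..N. exp (- k * \<bar>x - c j * t\<bar>))"
      by (simp add: sum_distrib_left)
  qed
qed

section \<open>Derivatives of the nonlinearity\<close>

text \<open>Every monomial has degree at least two: in the energy estimate for \<open>\<partial>\<^sub>x\<^sup>m u\<close> this leaves a square to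
  integrate and one further factor that is small.\<close>

inductive jetpoly :: "nat \<Rightarrow> ((nat \<Rightarrow> real) \<Rightarrow> real) \<Rightarrow> bool" for m where
  base: "i \<le> m \<Longrightarrow> j \<le> m \<Longrightarrow> jetpoly m (\<lambda>a. a i * a j)"
| mult: "i \<le> m \<Longrightarrow> jetpoly m P \<Longrightarrow> jetpoly m (\<lambda>a. a i * P a)"
| cmult: "jetpoly m P \<Longrightarrow> jetpoly m (\<lambda>a. k * P a)"
| add: "jetpoly m P \<Longrightarrow> jetpoly m Q \<Longrightarrow> jetpoly m (\<lambda>a. P a + Q a)"

lemma jetpoly_mono:
  assumes "jetpoly m P" "m \<le> n" shows "jetpoly n P"
  using assms by induction (auto intro: jetpoly.intros)

lemma jetpoly_power_mult: "jetpoly m P \<Longrightarrow> jetpoly m (\<lambda>a. a 0 ^ n * P a)"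
proof (induction n)
  case (Suc n)
  from jetpoly.mult[OF le0 Suc.IH[OF Suc.prems]] show ?case by (simp add: mult.assoc)
qed simp

text \<open>\<open>P'\<close> is chosen before the jet \<open>F\<close>. Applied at each time to the
  derivatives of the solution, the same polynomial serves for all times, and so do the constants
  derived from it.\<close>

lemma jetpoly_deriv:
  assumes "jetpoly m P"
  shows "\<exists>P'. jetpoly (Suc m) P' \<and> (\<forall>F x. (\<forall>i. (F i has_real_derivative F (Suc i) x) (at x)) \<longrightarrow>
    ((\<lambda>y. P (\<lambda>i. F i y)) has_real_derivative P' (\<lambda>i. F i x)) (at x))"
  using assms
proof induction
  case (base i j)
  show ?case
  proof (intro exI conjI allI impI)
    show "jetpoly (Suc m) (\<lambda>a. a (Suc i) * a j + a i * a (Suc j))"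
      using base by (intro jetpoly.add jetpoly.base) auto
    fix F :: "nat \<Rightarrow> real \<Rightarrow> real" and x assume "\<forall>i. (F i has_real_derivative F (Suc i) x) (at x)"
    thus "((\<lambda>y. F i y * F j y) has_real_derivative F (Suc i) x * F j x + F i x * F (Suc j) x) (at x)"
      by (auto intro!: derivative_eq_intros)
  qed
next
  case (mult i P)
  then obtain P' where "jetpoly (Suc m) P'" "\<forall>F x. (\<forall>i. (F i has_real_derivative F (Suc i) x) (at x)) \<longrightarrow>
    ((\<lambda>y. P (\<lambda>i. F i y)) has_real_derivative P' (\<lambda>i. F i x)) (at x)" by blast
  thus ?case using mult(1) jetpoly_mono[OF mult(2), of "Suc m"]
    by (intro exI[of _ "\<lambda>a. a (Suc i) * P a + a i * P' a"]) (auto intro!: jetpoly.intros derivative_eq_intros)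
next
  case (cmult P k)
  then obtain P' where "jetpoly (Suc m) P'" "\<forall>F x. (\<forall>i. (F i has_real_derivative F (Suc i) x) (at x)) \<longrightarrow>
    ((\<lambda>y. P (\<lambda>i. F i y)) has_real_derivative P' (\<lambda>i. F i x)) (at x)" by blast
  thus ?case by (intro exI[of _ "\<lambda>a. k * P' a"]) (auto intro!: jetpoly.intros DERIV_cmult)
next
  case (add P Q)
  then obtain P' Q' where "jetpoly (Suc m) P'" "\<forall>F x. (\<forall>i. (F i has_real_derivative F (Suc i) x) (at x)) \<longrightarrow>
    ((\<lambda>y. P (\<lambda>i. F i y)) has_real_derivative P' (\<lambda>i. F i x)) (at x)"
    "jetpoly (Suc m) Q'" "\<forall>F x. (\<forall>i. (F i has_real_derivative F (Suc i) x) (at x)) \<longrightarrow>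
    ((\<lambda>y. Q (\<lambda>i. F i y)) has_real_derivative Q' (\<lambda>i. F i x)) (at x)" by blast
  thus ?case by (intro exI[of _ "\<lambda>a. P' a + Q' a"]) (auto intro!: jetpoly.intros DERIV_add)
qed

text \<open>Two factors of each monomial are kept and turned into squares, the others are replaced
  by their a priori bounds \<open>K i\<close>.\<close>

lemma jetpoly_bound:
  assumes "jetpoly m P" and K: "\<And>i. K i \<ge> 0"
  shows "\<exists>C\<ge>0. \<forall>a. (\<forall>i. \<bar>a i\<bar> \<le> K i) \<longrightarrow> \<bar>P a\<bar> \<le> C * (\<Sum>i\<le>m. (a i)\<^sup>2)"
  using assms(1)
proof induction
  case (base i j)
  have "\<bar>a i * a j\<bar> \<le> 2 * (\<Sum>i\<le>m. (a i)\<^sup>2)" for a :: "nat \<Rightarrow> real"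
  proof -
    have "2 * \<bar>a i * a j\<bar> \<le> (a i)\<^sup>2 + (a j)\<^sup>2"
      using sum_squares_bound[of "\<bar>a i\<bar>" "\<bar>a j\<bar>"] by (simp add: abs_mult mult.assoc)
    moreover have "(a i)\<^sup>2 \<le> (\<Sum>i\<le>m. (a i)\<^sup>2)" "(a j)\<^sup>2 \<le> (\<Sum>i\<le>m. (a i)\<^sup>2)"
      using base by (auto intro: member_le_sum[of _ "{..m}" "\<lambda>i. (a i)\<^sup>2"])
    ultimately show ?thesis using abs_ge_zero[of "a i * a j"] by linarith
  qed
  thus ?case by (intro exI[of _ 2]) auto
next
  case (mult i P)
  then obtain C where C: "C \<ge> 0" "\<And>a. (\<forall>i. \<bar>a i\<bar> \<le> K i) \<Longrightarrow> \<bar>P a\<bar> \<le> C * (\<Sum>i\<le>m. (a i)\<^sup>2)" by blast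
  have "\<bar>a i * P a\<bar> \<le> K i * C * (\<Sum>i\<le>m. (a i)\<^sup>2)" if "\<forall>i. \<bar>a i\<bar> \<le> K i" for a
    unfolding abs_mult mult.assoc using that C K by (intro mult_mono) auto
  thus ?case using C(1) K[of i] by (intro exI[of _ "K i * C"]) auto
next
  case (cmult P k)
  then obtain C where C: "C \<ge> 0" "\<And>a. (\<forall>i. \<bar>a i\<bar> \<le> K i) \<Longrightarrow> \<bar>P a\<bar> \<le> C * (\<Sum>i\<le>m. (a i)\<^sup>2)" by blast
  have "\<bar>k * P a\<bar> \<le> \<bar>k\<bar> * C * (\<Sum>i\<le>m. (a i)\<^sup>2)" if "\<forall>i. \<bar>a i\<bar> \<le> K i" for a
    unfolding abs_mult mult.assoc using that C by (intro mult_left_mono) auto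
  thus ?case using C(1) by (intro exI[of _ "\<bar>k\<bar> * C"]) auto
next
  case (add P Q)
  then obtain C D where C: "C \<ge> 0" "\<And>a. (\<forall>i. \<bar>a i\<bar> \<le> K i) \<Longrightarrow> \<bar>P a\<bar> \<le> C * (\<Sum>i\<le>m. (a i)\<^sup>2)"
    "D \<ge> 0" "\<And>a. (\<forall>i. \<bar>a i\<bar> \<le> K i) \<Longrightarrow> \<bar>Q a\<bar> \<le> D * (\<Sum>i\<le>m. (a i)\<^sup>2)" by blast
  have "\<bar>P a + Q a\<bar> \<le> (C + D) * (\<Sum>i\<le>m. (a i)\<^sup>2)" if "\<forall>i. \<bar>a i\<bar> \<le> K i" for a
    using C(2)[OF that] C(4)[OF that] abs_triangle_ineq[of "P a" "Q a"] by (simp add: ring_distribs)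
  thus ?case using C by (intro exI[of _ "C + D"]) auto
qed

lemma jetpoly_continuous_on:
  fixes F :: "nat \<Rightarrow> 'b::topological_space \<Rightarrow> real"
  assumes "jetpoly m P" "\<And>i. continuous_on S (F i)"
  shows "continuous_on S (\<lambda>z. P (\<lambda>i. F i z))"
  using assms(1) by induction (auto intro!: continuous_intros assms(2))

text \<open>Only when all derivatives fall on one factor does the order s + 1 appear. This term
  cannot be bounded by squares of order at most \<open>s\<close> and is isolated in order to be
  integrated by parts later.\<close>

lemma funpow_deriv_power:
  assumes p: "p \<ge> 2"
  shows "\<exists>P. jetpoly s P \<and> (\<forall>F. (\<forall>i x. (F i has_real_derivative F (Suc i) x) (at x)) \<longrightarrow>
    (deriv ^^ Suc s) (\<lambda>x. F 0 x ^ p) = (\<lambda>x. real p * F 0 x ^ (p - 1) * F (Suc s) x + P (\<lambda>i. F i x)))"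
proof (induction s)
  case 0
  \<comment> \<open>The remainder vanishes at this order; it is written as a null multiple of a
    quadratic monomial in order to be a \<open>jetpoly\<close>.\<close>
  have "deriv (\<lambda>x. F 0 x ^ p) = (\<lambda>x. real p * F 0 x ^ (p - 1) * F (Suc 0) x + 0 * (F 0 x * F 0 x))"
    if "\<forall>i x. (F i has_real_derivative F (Suc i) x) (at x)" for F :: "nat \<Rightarrow> real \<Rightarrow> real"
    using that by (intro ext DERIV_imp_deriv) (auto intro!: derivative_eq_intros)
  moreover have "jetpoly 0 (\<lambda>a. 0 * (a 0 * a 0))" by (intro jetpoly.cmult jetpoly.base) auto
  ultimately show ?case by (intro exI[of _ "\<lambda>a. 0 * (a 0 * a 0)"]) auto
next
  case (Suc s)
  then obtain P where P: "jetpoly s P" "\<And>F. (\<forall>i x. (F i has_real_derivative F (Suc i) x) (at x)) \<Longrightarrow>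
    (deriv ^^ Suc s) (\<lambda>x. F 0 x ^ p) = (\<lambda>x. real p * F 0 x ^ (p - 1) * F (Suc s) x + P (\<lambda>i. F i x))" by blast
  obtain P' where P': "jetpoly (Suc s) P'" "\<And>F x. (\<forall>i. (F i has_real_derivative F (Suc i) x) (at x)) \<Longrightarrow>
    ((\<lambda>y. P (\<lambda>i. F i y)) has_real_derivative P' (\<lambda>i. F i x)) (at x)"
    using jetpoly_deriv[OF P(1)] by blast
  \<comment> \<open>The first term arises when the derivative falls on the power
    \<open>F 0 x ^ (p - 1)\<close> of the leading term.\<close>
  define R where "R = (\<lambda>a. real p * real (p - 1) * (a 0 ^ (p - 2) * (a 1 * a (Suc s))) + P' a)"
  have R: "jetpoly (Suc s) R" unfolding R_def
    by (intro jetpoly.add jetpoly.cmult jetpoly_power_mult jetpoly.base P') auto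
  have "(deriv ^^ Suc (Suc s)) (\<lambda>x. F 0 x ^ p) = (\<lambda>x. real p * F 0 x ^ (p - 1) * F (Suc (Suc s)) x + R (\<lambda>i. F i x))"
    if F: "\<forall>i x. (F i has_real_derivative F (Suc i) x) (at x)" for F
  proof -
    have "((\<lambda>x. real p * F 0 x ^ (p - 1) * F (Suc s) x + P (\<lambda>i. F i x)) has_real_derivative
       real p * F 0 x ^ (p - 1) * F (Suc (Suc s)) x + R (\<lambda>i. F i x)) (at x)" for x
      using F p by (auto intro!: derivative_eq_intros P'(2) simp: R_def algebra_simps numeral_2_eq_2)
    hence "deriv (\<lambda>x. real p * F 0 x ^ (p - 1) * F (Suc s) x + P (\<lambda>i. F i x)) =
      (\<lambda>x. real p * F 0 x ^ (p - 1) * F (Suc (Suc s)) x + R (\<lambda>i. F i x))" by (auto intro!: DERIV_imp_deriv)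
    thus ?thesis using P(2)[OF F] by simp
  qed
  thus ?case using R by blast
qed

lemma smooth_power: "smooth f \<Longrightarrow> smooth (\<lambda>x. f x ^ n)"
proof (induction n)
  case 0
  show ?case by (rule smooth_coinduct[where S="range (\<lambda>c x. c)"]) (auto intro!: bexI derivative_eq_intros)
next
  case (Suc n)
  thus ?case using smooth_mult[of f "\<lambda>x. f x ^ n"] by simp
qed

section \<open>A backward Gronwall inequality\<close>

text \<open>The coefficient is integrable up to infinity, so its integrating factor tends to 1
  there. Since \<open>G\<close> vanishes at infinity, the only thing left in the limit is the
  source, and the bound is proportional to \<open>\<rho>\<close>.\<close>

lemma backward_gronwall:
  fixes G :: "real \<Rightarrow> real"
  assumes \<gamma>: "\<gamma> > 0" and C: "C \<ge> 0" and \<rho>: "\<rho> \<ge> 0"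
    and c: "continuous_on {T..} G" and lim: "(G \<longlongrightarrow> 0) at_top"
    and G: "\<And>t1 t2. T \<le> t1 \<Longrightarrow> t1 \<le> t2 \<Longrightarrow> G t1 \<le> G t2 + integral {t1..t2} (\<lambda>\<tau>. C * exp (- \<gamma> * \<tau>) * (G \<tau> + \<rho>))"
    and t: "T \<le> t"
  shows "G t \<le> C / \<gamma> * exp (C / \<gamma> * exp (- \<gamma> * T)) * \<rho> * exp (- \<gamma> * t)"
proof -
  define a where "a = (\<lambda>\<tau>. C * exp (- \<gamma> * \<tau>) * (G \<tau> + \<rho>))"
  \<comment> \<open>The integral of \<open>C * exp (- \<gamma> * \<tau>)\<close> over all later
    times.\<close>
  define A where "A = (\<lambda>\<tau>. C / \<gamma> * exp (- \<gamma> * \<tau>))"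
  have A0: "A \<tau> \<ge> 0" for \<tau> using C \<gamma> by (simp add: A_def)
  have step: "G t + \<rho> \<le> (G t2 + \<rho>) * exp (A t - A t2)" if t2: "t \<le> t2" for t2
  proof -
    have ca: "continuous_on {t..t2} a" unfolding a_def
      by (intro continuous_intros continuous_on_subset[OF c]) (use t in auto)
    \<comment> \<open>A differentiable majorant of \<open>G\<close>, which is itself only
      continuous: the right side of the integral inequality between \<tau> and
      \<open>t2\<close>.\<close>
    define H where "H = (\<lambda>\<tau>. G t2 + (integral {t..t2} a - integral {t..\<tau>} a))"
    define M where "M = (\<lambda>\<tau>. (H \<tau> + \<rho>) * exp (- A \<tau>))"
    have GH: "G \<tau> \<le> H \<tau>" if "t \<le> \<tau>" "\<tau> \<le> t2" for \<tau>
    proof -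
      have "integral {t..\<tau>} a + integral {\<tau>..t2} a = integral {t..t2} a"
        by (rule Henstock_Kurzweil_Integration.integral_combine)
          (use that integrable_continuous_real[OF ca] in simp_all)
      thus ?thesis using G[of \<tau> t2] t that by (simp add: H_def a_def)
    qed
    have dM: "(M has_real_derivative (C * exp (- \<gamma> * \<tau>) * (H \<tau> - G \<tau>)) * exp (- A \<tau>)) (at \<tau> within {t..t2})"
      if "\<tau> \<in> {t..t2}" for \<tau>
    proof -
      have dI: "((\<lambda>\<tau>. integral {t..\<tau>} a) has_real_derivative a \<tau>) (at \<tau> within {t..t2})"
        by (rule integral_has_real_derivative[OF ca that])
      have dA: "(A has_real_derivative - (C * exp (- \<gamma> * \<tau>))) (at \<tau> within {t..t2})"
        unfolding A_def using \<gamma> by (auto intro!: derivative_eq_intros)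
      have dH: "((\<lambda>\<tau>. H \<tau> + \<rho>) has_real_derivative 0 + (0 - a \<tau>) + 0) (at \<tau> within {t..t2})"
        unfolding H_def by (rule DERIV_add[OF DERIV_add[OF DERIV_const DERIV_diff[OF DERIV_const dI]] DERIV_const])
      have dE: "((\<lambda>\<tau>. exp (- A \<tau>)) has_real_derivative exp (- A \<tau>) * - (- (C * exp (- \<gamma> * \<tau>)))) (at \<tau> within {t..t2})"
        by (rule DERIV_chain2[OF DERIV_exp DERIV_minus[OF dA]])
      have "(M has_real_derivative (0 + (0 - a \<tau>) + 0) * exp (- A \<tau>) + exp (- A \<tau>) * - (- (C * exp (- \<gamma> * \<tau>))) * (H \<tau> + \<rho>))
          (at \<tau> within {t..t2})"
        unfolding M_def by (rule DERIV_mult[OF dH dE])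
      thus ?thesis by (rule DERIV_cong) (simp add: a_def algebra_simps)
    qed
    have "M t \<le> M t2"
    proof (rule DERIV_nonneg_imp_increasing_open[OF t2])
      show "continuous_on {t..t2} M" by (rule DERIV_continuous_on[OF dM])
      fix \<tau> assume \<tau>: "t < \<tau>" "\<tau> < t2"
      have "at \<tau> within {t..t2} = at \<tau>" using \<tau> by (intro at_within_interior) auto
      moreover have "0 \<le> (C * exp (- \<gamma> * \<tau>) * (H \<tau> - G \<tau>)) * exp (- A \<tau>)" using GH[of \<tau>] \<tau> C by simp
      ultimately show "\<exists>y. (M has_real_derivative y) (at \<tau>) \<and> 0 \<le> y" using dM[of \<tau>] \<tau> by auto
    qed
    hence "(H t + \<rho>) * exp (- A t) \<le> (G t2 + \<rho>) * exp (- A t2)" by (simp add: M_def H_def)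
    hence "(H t + \<rho>) * exp (- A t) * exp (A t) \<le> (G t2 + \<rho>) * exp (- A t2) * exp (A t)" by (intro mult_right_mono) auto
    hence "H t + \<rho> \<le> (G t2 + \<rho>) * exp (A t - A t2)" by (simp add: mult.assoc flip: exp_add)
    thus ?thesis using GH[of t] t2 by simp
  qed
  have "((\<lambda>t2. exp (- \<gamma> * t2)) \<longlongrightarrow> 0) at_top"
    using \<gamma> by (intro filterlim_compose[OF exp_at_bot] filterlim_tendsto_neg_mult_at_bot[OF tendsto_const])
      (auto intro: filterlim_ident)
  hence "(A \<longlongrightarrow> C / \<gamma> * 0) at_top" unfolding A_def by (intro tendsto_intros)
  hence "((\<lambda>t2. (G t2 + \<rho>) * exp (A t - A t2)) \<longlongrightarrow> (0 + \<rho>) * exp (A t - C / \<gamma> * 0)) at_top"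
    by (intro tendsto_intros lim)
  hence "G t + \<rho> \<le> (0 + \<rho>) * exp (A t - C / \<gamma> * 0)"
    by (rule tendsto_lowerbound) (use step in \<open>auto intro: eventually_mono[OF eventually_ge_at_top[of t]]\<close>)
  hence "G t \<le> \<rho> * (exp (A t) - 1)" by (simp add: algebra_simps)
  \<comment> \<open>The inequality exp(A) - 1 \<le> A exp(A) recovers the factor exp(-\<gamma> t)
    contained in \<open>A t\<close>.\<close>
  also have "\<dots> \<le> \<rho> * (A t * exp (A T))"
  proof (intro mult_left_mono \<rho>)
    have "1 - A t \<le> exp (- A t)" using exp_ge_add_one_self[of "- A t"] by simp
    hence "(1 - A t) * exp (A t) \<le> exp (- A t) * exp (A t)" by (intro mult_right_mono) auto
    hence "exp (A t) - 1 \<le> A t * exp (A t)" by (simp add: algebra_simps flip: exp_add)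
    also have "\<dots> \<le> A t * exp (A T)"
    proof (intro mult_left_mono A0)
      have "A t \<le> A T" unfolding A_def using t \<gamma> C by (intro mult_left_mono) auto
      thus "exp (A t) \<le> exp (A T)" by simp
    qed
    finally show "exp (A t) - 1 \<le> A t * exp (A T)" .
  qed
  finally show ?thesis by (simp add: A_def mult_ac)
qed

section \<open>Weighted energy estimates\<close>

text \<open>Interface of the energy method; solitons do not occur in it. The space derivatives form
  a family \<open>U\<close> instead of iterated \<open>deriv\<close>, and time derivatives are taken
  within the half-line so that the initial time is included.\<close>

locale gkdv_flow =
  fixes p :: nat and U :: "nat \<Rightarrow> real \<Rightarrow> real \<Rightarrow> real" and T :: real
  assumes p: "p \<ge> 2"
    and dx: "\<And>i t x. T \<le> t \<Longrightarrow> (U i t has_real_derivative U (Suc i) t x) (at x)"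
    and cont: "\<And>i. continuous_on ({T..} \<times> UNIV) (\<lambda>z. U i (fst z) (snd z))"
    and sup_bound: "\<And>i. \<exists>K. \<forall>t\<ge>T. \<forall>x. \<bar>U i t x\<bar> \<le> K"
    and L2: "\<And>i t. T \<le> t \<Longrightarrow> L2 (U i t)"
    and L2_bound: "\<And>i. \<exists>K. \<forall>t\<ge>T. (LINT x|lborel. (U i t x)\<^sup>2) \<le> K"
    and pde: "\<And>i t x. T \<le> t \<Longrightarrow> ((\<lambda>\<tau>. U i \<tau> x) has_real_derivative
        - U (i + 3) t x - (deriv ^^ Suc i) (\<lambda>x. U 0 t x ^ p) x) (at t within {T..})"
begin

definition sup_U :: "nat \<Rightarrow> real" where "sup_U i = (SOME K. \<forall>t\<ge>T. \<forall>x. \<bar>U i t x\<bar> \<le> K)"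

lemma sup_U: "T \<le> t \<Longrightarrow> \<bar>U i t x\<bar> \<le> sup_U i"
  using someI_ex[OF sup_bound[of i]] by (simp add: sup_U_def)

lemma sup_U_nonneg: "0 \<le> sup_U i"
  using sup_U[of T i 0] by simp

definition S :: "nat \<Rightarrow> real \<Rightarrow> real \<Rightarrow> real" where "S m t x = (\<Sum>i\<le>m. (U i t x)\<^sup>2)"

lemma S_nonneg: "0 \<le> S m t x" by (simp add: S_def sum_nonneg)

lemma S_mono: "m \<le> n \<Longrightarrow> S m t x \<le> S n t x"
  unfolding S_def by (intro sum_mono2) auto

lemma square_le_S: "i \<le> m \<Longrightarrow> (U i t x)\<^sup>2 \<le> S m t x"
  unfolding S_def by (intro member_le_sum[of _ "{..m}" "\<lambda>i. (U i t x)\<^sup>2"]) auto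

lemma prod_le_S:
  assumes "i \<le> m" "j \<le> m" shows "\<bar>U i t x * U j t x\<bar> \<le> S m t x"
proof -
  have "2 * \<bar>U i t x * U j t x\<bar> \<le> (U i t x)\<^sup>2 + (U j t x)\<^sup>2"
    using sum_squares_bound[of "\<bar>U i t x\<bar>" "\<bar>U j t x\<bar>"] by (simp add: abs_mult mult.assoc)
  thus ?thesis using square_le_S[OF assms(1), of t x] square_le_S[OF assms(2), of t x] by linarith
qed

lemma continuous_U: "T \<le> t \<Longrightarrow> continuous_on A (U i t)"
  by (meson DERIV_continuous_on has_field_derivative_at_within dx)

lemma integrable_square: "T \<le> t \<Longrightarrow> integrable lborel (\<lambda>x. (U i t x)\<^sup>2)"
  using L2[of t i] by (simp add: L2_def)

lemma integrable_S: "T \<le> t \<Longrightarrow> integrable lborel (S m t)"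
  unfolding S_def[abs_def] by (intro Bochner_Integration.integrable_sum integrable_square)

lemma integral_S_bound: "\<exists>K\<ge>0. \<forall>t\<ge>T. (LINT x|lborel. S m t x) \<le> K"
proof -
  obtain K where K: "\<And>i t. t \<ge> T \<Longrightarrow> (LINT x|lborel. (U i t x)\<^sup>2) \<le> K i" using L2_bound by metis
  have "(LINT x|lborel. S m t x) \<le> (\<Sum>i\<le>m. \<bar>K i\<bar>)" if "T \<le> t" for t
  proof -
    have "(LINT x|lborel. S m t x) = (\<Sum>i\<le>m. LINT x|lborel. (U i t x)\<^sup>2)"
      unfolding S_def by (intro Bochner_Integration.integral_sum integrable_square that)
    also have "\<dots> \<le> (\<Sum>i\<le>m. \<bar>K i\<bar>)" by (intro sum_mono order_trans[OF K[OF that]]) simp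
    finally show ?thesis .
  qed
  thus ?thesis by (intro exI[of _ "\<Sum>i\<le>m. \<bar>K i\<bar>"]) (auto intro: sum_nonneg)
qed

lemma integrable_le_S:
  assumes t: "T \<le> t" and g: "continuous_on UNIV g" "\<And>x. \<bar>g x\<bar> \<le> M * S m t x"
  shows "integrable lborel g" "(LINT x|lborel. \<bar>g x\<bar>) \<le> M * (LINT x|lborel. S m t x)"
proof -
  show *: "integrable lborel g"
  proof (rule Bochner_Integration.integrable_bound)
    show "integrable lborel (\<lambda>x. M * S m t x)" using integrable_S[OF t] by simp
    show "g \<in> borel_measurable lborel" using g(1) by (simp add: borel_measurable_continuous_onI)
    show "AE x in lborel. norm (g x) \<le> norm (M * S m t x)" using g(2) by (auto intro: order_trans[OF _ abs_ge_self])
  qed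
  have "(LINT x|lborel. \<bar>g x\<bar>) \<le> (LINT x|lborel. M * S m t x)"
    using * integrable_S[OF t] g(2) by (intro integral_mono) auto
  thus "(LINT x|lborel. \<bar>g x\<bar>) \<le> M * (LINT x|lborel. S m t x)" by simp
qed

text \<open>What remains of the differentiated nonlinearity without its top-order term: an
  expression in the derivatives of order at most \<open>s\<close>.\<close>

definition R :: "nat \<Rightarrow> real \<Rightarrow> real \<Rightarrow> real" where
  "R s t x = (deriv ^^ Suc s) (\<lambda>x. U 0 t x ^ p) x - real p * U 0 t x ^ (p - 1) * U (Suc s) t x"

lemma R_props:
  shows R_bound: "\<exists>C\<ge>0. \<forall>t\<ge>T. \<forall>x. \<bar>R s t x\<bar> \<le> C * S s t x"
    and R_cont: "continuous_on ({T..} \<times> UNIV) (\<lambda>z. R s (fst z) (snd z))"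
proof -
  obtain P where P: "jetpoly s P" "\<And>F. (\<forall>i x. (F i has_real_derivative F (Suc i) x) (at x)) \<Longrightarrow>
    (deriv ^^ Suc s) (\<lambda>x. F 0 x ^ p) = (\<lambda>x. real p * F 0 x ^ (p - 1) * F (Suc s) x + P (\<lambda>i. F i x))"
    using funpow_deriv_power[OF p, of s] by blast
  have eq: "R s t x = P (\<lambda>i. U i t x)" if "T \<le> t" for t x
    using P(2)[of "\<lambda>i. U i t"] dx[OF that] by (simp add: R_def del: funpow.simps)
  obtain C where C: "C \<ge> 0" "\<And>a. (\<forall>i. \<bar>a i\<bar> \<le> sup_U i) \<Longrightarrow> \<bar>P a\<bar> \<le> C * (\<Sum>i\<le>s. (a i)\<^sup>2)"
    using jetpoly_bound[OF P(1), of sup_U] sup_U_nonneg by blast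
  show "\<exists>C\<ge>0. \<forall>t\<ge>T. \<forall>x. \<bar>R s t x\<bar> \<le> C * S s t x"
    using C sup_U by (intro exI[of _ C]) (auto simp: eq S_def)
  show "continuous_on ({T..} \<times> UNIV) (\<lambda>z. R s (fst z) (snd z))"
    by (rule continuous_on_eq[OF jetpoly_continuous_on[OF P(1), of _ "\<lambda>i z. U i (fst z) (snd z)"]])
       (auto simp: eq intro: cont)
qed

lemma R_cont_x: "T \<le> t \<Longrightarrow> continuous_on UNIV (R s t)"
  using continuous_on_compose2[OF R_cont[of s], of UNIV "\<lambda>x. (t, x)"] by (force intro!: continuous_intros)

lemma dt:
  assumes "T \<le> t"
  shows "((\<lambda>\<tau>. U s \<tau> x) has_real_derivative
    - U (s + 3) t x - real p * U 0 t x ^ (p - 1) * U (Suc s) t x - R s t x) (at t within {T..})"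
  using pde[OF assms, of s x] by (simp add: R_def algebra_simps del: funpow.simps)

text \<open>The nonlinear terms of the energy identity below, with \<open>q\<close> and \<open>q'\<close> standing for the
  weight and its derivative.\<close>

definition nonlin :: "nat \<Rightarrow> real \<Rightarrow> real \<Rightarrow> real \<Rightarrow> real \<Rightarrow> real" where
  "nonlin s t x q q' = real p * (U s t x)\<^sup>2 * (real (p - 1) * U 0 t x ^ (p - 2) * U 1 t x * q + U 0 t x ^ (p - 1) * q')
     - 2 * U s t x * R s t x * q"

text \<open>In each term one factor \<open>U i\<close> is paired with the weight, two others give
  \<open>S s t x\<close>, and the rest is bounded. Only the product of solution and weight has to be
  small, not the solution itself. Later \<open>E\<close> is exp(-\<gamma> t) times the weight plus
  \<open>\<rho>\<close>.\<close>

lemma nonlin_bound: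
  assumes K1: "K1 \<ge> 0" and A: "\<And>i. A i \<ge> 0"
  shows "\<exists>C\<ge>0. \<forall>t\<ge>T. \<forall>x q q' E. 0 \<le> q \<longrightarrow> \<bar>q'\<bar> \<le> K1 * q \<longrightarrow> 0 \<le> E \<longrightarrow> (\<forall>i. \<bar>U i t x\<bar> * q \<le> A i * E)
    \<longrightarrow> \<bar>nonlin s t x q q'\<bar> \<le> C * E * S s t x"
proof -
  obtain C where C: "C \<ge> 0" "\<And>t x. t \<ge> T \<Longrightarrow> \<bar>R s t x\<bar> \<le> C * S s t x" using R_bound by blast
  define B where "B = sup_U 0 ^ (p - 2)"
  have B0: "B \<ge> 0" by (simp add: B_def sup_U_nonneg)
  define D where "D = real p * (real (p - 1) * B * A 1 + B * K1 * A 0) + 2 * C * A s"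
  show ?thesis
  proof (intro exI[of _ D] conjI allI impI)
    show "D \<ge> 0" unfolding D_def using B0 A K1 C(1) by (intro add_nonneg_nonneg mult_nonneg_nonneg) auto
    fix t x q q' E
    assume t: "T \<le> t" and q: "0 \<le> q" "\<bar>q'\<bar> \<le> K1 * q" and E: "0 \<le> E" and UA: "\<forall>i. \<bar>U i t x\<bar> * q \<le> A i * E"
    have uB: "\<bar>U 0 t x ^ (p - 2)\<bar> \<le> B" unfolding B_def power_abs using sup_U[OF t] by (intro power_mono) auto
    have 1: "\<bar>real (p - 1) * U 0 t x ^ (p - 2) * U 1 t x * q\<bar> \<le> real (p - 1) * B * (A 1 * E)"
    proof -
      have "\<bar>real (p - 1) * U 0 t x ^ (p - 2) * U 1 t x * q\<bar> = (real (p - 1) * \<bar>U 0 t x ^ (p - 2)\<bar>) * (\<bar>U 1 t x\<bar> * q)"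
        using q by (simp add: abs_mult)
      also have "\<dots> \<le> (real (p - 1) * B) * (A 1 * E)"
        by (rule mult_mono[OF mult_left_mono[OF uB] UA[rule_format]]) (use B0 q in auto)
      finally show ?thesis .
    qed
    have 2: "\<bar>U 0 t x ^ (p - 1) * q'\<bar> \<le> B * (K1 * (A 0 * E))"
    proof -
      \<comment> \<open>Since p \<ge> 2, one factor \<open>U 0\<close> can be split off to meet the
        weight.\<close>
      have "U 0 t x ^ (p - 1) = U 0 t x ^ (p - 2) * U 0 t x"
        using p power_minus_mult[of "p - 1" "U 0 t x"] by (simp add: numeral_2_eq_2)
      hence "\<bar>U 0 t x ^ (p - 1) * q'\<bar> = \<bar>U 0 t x ^ (p - 2)\<bar> * (\<bar>U 0 t x\<bar> * \<bar>q'\<bar>)" by (simp add: abs_mult)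
      also have "\<dots> \<le> \<bar>U 0 t x ^ (p - 2)\<bar> * (\<bar>U 0 t x\<bar> * (K1 * q))"
        by (intro mult_left_mono q) auto
      also have "\<dots> = \<bar>U 0 t x ^ (p - 2)\<bar> * (K1 * (\<bar>U 0 t x\<bar> * q))" by (simp add: mult_ac)
      also have "\<dots> \<le> B * (K1 * (A 0 * E))"
        by (rule mult_mono[OF uB mult_left_mono[OF UA[rule_format] K1]]) (use B0 q K1 in auto)
      finally show ?thesis .
    qed
    have 3: "\<bar>2 * U s t x * R s t x * q\<bar> \<le> 2 * (A s * E) * (C * S s t x)"
    proof -
      have "\<bar>2 * U s t x * R s t x * q\<bar> = 2 * (\<bar>U s t x\<bar> * q) * \<bar>R s t x\<bar>" using q by (simp add: abs_mult)
      also have "\<dots> \<le> 2 * (A s * E) * (C * S s t x)"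
        by (rule mult_mono[OF mult_left_mono[OF UA[rule_format]] C(2)[OF t]]) (use A E in auto)
      finally show ?thesis .
    qed
    have "\<bar>real p * (U s t x)\<^sup>2 * (real (p - 1) * U 0 t x ^ (p - 2) * U 1 t x * q + U 0 t x ^ (p - 1) * q')\<bar>
       \<le> real p * S s t x * (real (p - 1) * B * (A 1 * E) + B * (K1 * (A 0 * E)))"
    proof -
      have "\<bar>real p * (U s t x)\<^sup>2 * (real (p - 1) * U 0 t x ^ (p - 2) * U 1 t x * q + U 0 t x ^ (p - 1) * q')\<bar>
        = real p * (U s t x)\<^sup>2 * \<bar>real (p - 1) * U 0 t x ^ (p - 2) * U 1 t x * q + U 0 t x ^ (p - 1) * q'\<bar>"
        by (simp add: abs_mult)
      also have "\<dots> \<le> real p * S s t x * (real (p - 1) * B * (A 1 * E) + B * (K1 * (A 0 * E)))"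
        by (rule mult_mono[OF mult_left_mono[OF square_le_S] order_trans[OF abs_triangle_ineq add_mono[OF 1 2]]])
          (use S_nonneg[of s t x] in auto)
      finally show ?thesis .
    qed
    hence "\<bar>nonlin s t x q q'\<bar> \<le> real p * S s t x * (real (p - 1) * B * (A 1 * E) + B * (K1 * (A 0 * E))) + 2 * (A s * E) * (C * S s t x)"
      unfolding nonlin_def using 3 by linarith
    also have "\<dots> = D * E * S s t x" by (simp add: D_def algebra_simps)
    finally show "\<bar>nonlin s t x q q'\<bar> \<le> D * E * S s t x" .
  qed
qed

end

text \<open>The derivatives are arguments because the concrete weights have closed formulas for
  them; three occur because the dispersive term has order three. Boundedness makes the integrals
  against squares of L2 functions converge.\<close>

definition weight :: "(real \<Rightarrow> real) \<Rightarrow> (real \<Rightarrow> real) \<Rightarrow> (real \<Rightarrow> real) \<Rightarrow> (real \<Rightarrow> real) \<Rightarrow> bool" where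
  "weight w0 w1 w2 w3 \<longleftrightarrow>
     (\<forall>x. (w0 has_real_derivative w1 x) (at x)) \<and> (\<forall>x. (w1 has_real_derivative w2 x) (at x)) \<and>
     (\<forall>x. (w2 has_real_derivative w3 x) (at x)) \<and> continuous_on UNIV w3 \<and>
     (\<exists>W. \<forall>x. \<bar>w0 x\<bar> \<le> W \<and> \<bar>w1 x\<bar> \<le> W \<and> \<bar>w2 x\<bar> \<le> W \<and> \<bar>w3 x\<bar> \<le> W)"

lemma weight_continuous:
  assumes "weight w0 w1 w2 w3"
  shows "continuous_on UNIV w0" "continuous_on UNIV w1" "continuous_on UNIV w2" "continuous_on UNIV w3"
  using assms unfolding weight_def by (meson DERIV_continuous_on has_field_derivative_at_within)+

section \<open>Energy identity for a moving weight\<close>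

context gkdv_flow
begin

definition bounded_field :: "(real \<Rightarrow> real \<Rightarrow> real) \<Rightarrow> bool" where
  "bounded_field h \<longleftrightarrow> (\<exists>B\<ge>0. \<forall>t\<ge>T. \<forall>x. \<bar>h t x\<bar> \<le> B)"

text \<open>A certificate of integrability: the integral of \<open>S m t\<close> is bounded
  uniformly in time, so a continuous dominated field is integrable in space and, over bounded time
  intervals, in space-time.\<close>

definition dominated :: "nat \<Rightarrow> (real \<Rightarrow> real \<Rightarrow> real) \<Rightarrow> bool" where
  "dominated m g \<longleftrightarrow> (\<exists>M\<ge>0. \<forall>t\<ge>T. \<forall>x. \<bar>g t x\<bar> \<le> M * S m t x)"

lemma bounded_field_const: "bounded_field (\<lambda>t x. k)"
  unfolding bounded_field_def by (intro exI[of _ "\<bar>k\<bar>"]) auto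

lemma bounded_field_mult:
  assumes "bounded_field g" "bounded_field h" shows "bounded_field (\<lambda>t x. g t x * h t x)"
proof -
  obtain B D where "B \<ge> 0" "\<And>t x. t \<ge> T \<Longrightarrow> \<bar>g t x\<bar> \<le> B" "D \<ge> 0" "\<And>t x. t \<ge> T \<Longrightarrow> \<bar>h t x\<bar> \<le> D"
    using assms unfolding bounded_field_def by metis
  thus ?thesis unfolding bounded_field_def abs_mult by (intro exI[of _ "B * D"]) (auto intro!: mult_mono)
qed

lemma bounded_field_U: "bounded_field (U i)"
  using sup_U sup_U_nonneg unfolding bounded_field_def by blast

lemma bounded_field_power: "bounded_field g \<Longrightarrow> bounded_field (\<lambda>t x. g t x ^ n)"
  by (induction n) (auto intro: bounded_field_const bounded_field_mult)

lemma dominated_add: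
  assumes "dominated m g" "dominated m h" shows "dominated m (\<lambda>t x. g t x + h t x)"
proof -
  obtain B D where *: "B \<ge> 0" "\<And>t x. t \<ge> T \<Longrightarrow> \<bar>g t x\<bar> \<le> B * S m t x" "D \<ge> 0" "\<And>t x. t \<ge> T \<Longrightarrow> \<bar>h t x\<bar> \<le> D * S m t x"
    using assms unfolding dominated_def by metis
  have "\<bar>g t x + h t x\<bar> \<le> (B + D) * S m t x" if "t \<ge> T" for t x
    using *(2)[OF that, of x] *(4)[OF that, of x] abs_triangle_ineq[of "g t x" "h t x"] by (simp add: ring_distribs)
  thus ?thesis using * unfolding dominated_def by (intro exI[of _ "B + D"]) auto
qed

lemma dominated_mult:
  assumes "bounded_field h" "dominated m g" shows "dominated m (\<lambda>t x. h t x * g t x)"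
proof -
  obtain B D where *: "B \<ge> 0" "\<And>t x. t \<ge> T \<Longrightarrow> \<bar>h t x\<bar> \<le> B" "D \<ge> 0" "\<And>t x. t \<ge> T \<Longrightarrow> \<bar>g t x\<bar> \<le> D * S m t x"
    using assms unfolding dominated_def bounded_field_def by metis
  thus ?thesis unfolding dominated_def abs_mult mult.assoc
    by (intro exI[of _ "B * D"]) (auto simp: mult.assoc intro!: mult_mono)
qed

lemma dominated_U: "i \<le> m \<Longrightarrow> j \<le> m \<Longrightarrow> dominated m (\<lambda>t x. U i t x * U j t x)"
  unfolding dominated_def using prod_le_S by (intro exI[of _ 1]) auto

lemma dominated_R: "s \<le> m \<Longrightarrow> dominated m (R s)"
proof -
  assume s: "s \<le> m"
  obtain C where C: "C \<ge> 0" "\<And>t x. t \<ge> T \<Longrightarrow> \<bar>R s t x\<bar> \<le> C * S s t x" using R_bound by blast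
  have "\<bar>R s t x\<bar> \<le> C * S m t x" if "t \<ge> T" for t x
    using order_trans[OF C(2)[OF that] mult_left_mono[OF S_mono[OF s] C(1)]] .
  thus ?thesis using C(1) unfolding dominated_def by blast
qed

text \<open>Integrand of the time derivative of the weighted energy in its final form: after
  integration by parts the second and third derivatives of \<open>U s\<close> are gone.\<close>

definition energy_rate :: "nat \<Rightarrow> real \<Rightarrow> (real \<Rightarrow> real) \<Rightarrow> (real \<Rightarrow> real) \<Rightarrow> (real \<Rightarrow> real) \<Rightarrow> real \<Rightarrow> real \<Rightarrow> real" where
  "energy_rate s \<sigma> w0 w1 w3 t x = - 3 * (U (Suc s) t x)\<^sup>2 * w1 (x - \<sigma> * t)
     + (U s t x)\<^sup>2 * (w3 (x - \<sigma> * t) - \<sigma> * w1 (x - \<sigma> * t))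
     + nonlin s t x (w0 (x - \<sigma> * t)) (w1 (x - \<sigma> * t))"

context
  fixes w0 w1 w2 w3 :: "real \<Rightarrow> real" and \<sigma> :: real and s :: nat
  assumes w: "weight w0 w1 w2 w3"
begin

lemma bounded_weights:
  "bounded_field (\<lambda>t x. w0 (x - \<sigma> * t))" "bounded_field (\<lambda>t x. w1 (x - \<sigma> * t))"
  "bounded_field (\<lambda>t x. w2 (x - \<sigma> * t))" "bounded_field (\<lambda>t x. w3 (x - \<sigma> * t))"
proof -
  obtain W where W: "\<forall>x. \<bar>w0 x\<bar> \<le> W \<and> \<bar>w1 x\<bar> \<le> W \<and> \<bar>w2 x\<bar> \<le> W \<and> \<bar>w3 x\<bar> \<le> W" using w by (auto simp: weight_def)
  moreover from this have "W \<ge> 0" by (meson abs_ge_zero order_trans)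
  ultimately show "bounded_field (\<lambda>t x. w0 (x - \<sigma> * t))" "bounded_field (\<lambda>t x. w1 (x - \<sigma> * t))"
    "bounded_field (\<lambda>t x. w2 (x - \<sigma> * t))" "bounded_field (\<lambda>t x. w3 (x - \<sigma> * t))"
    unfolding bounded_field_def by blast+
qed

text \<open>All integrations by parts of the energy identity at once: the x-derivative of this
  function is \<open>energy_rate\<close> minus \<open>density_rate\<close>. The first four terms
  stem from the third derivative in the equation, the last from the top-order part of the
  nonlinearity.\<close>

definition flux :: "real \<Rightarrow> real \<Rightarrow> real" where
  "flux t x = (2 * w0 (x - \<sigma> * t)) * (U s t x * U (s + 2) t x) + ((-1) * w0 (x - \<sigma> * t)) * (U (s + 1) t x * U (s + 1) t x)
     + ((-2) * w1 (x - \<sigma> * t)) * (U s t x * U (s + 1) t x) + w2 (x - \<sigma> * t) * (U s t x * U s t x)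
     + (real p * (U 0 t x ^ (p - 1) * w0 (x - \<sigma> * t))) * (U s t x * U s t x)"

text \<open>The time derivative, at a fixed point, of the square of \<open>U s\<close> times the
  moving weight, with the equation inserted. Its third derivative is the origin of the order
  \<open>s + 3\<close> in the bounds.\<close>

definition density_rate :: "real \<Rightarrow> real \<Rightarrow> real" where
  "density_rate t x = ((-2) * w0 (x - \<sigma> * t)) * (U s t x * U (s + 3) t x)
     + ((-2) * (real p * (U 0 t x ^ (p - 1) * w0 (x - \<sigma> * t)))) * (U s t x * U (s + 1) t x)
     + ((-2) * (w0 (x - \<sigma> * t) * U s t x)) * R s t x + ((- \<sigma>) * w1 (x - \<sigma> * t)) * (U s t x * U s t x)"

lemma dominated_flux: "dominated (s + 3) flux"
  unfolding flux_def[abs_def]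
  by (intro dominated_add dominated_mult dominated_U bounded_field_mult bounded_field_const bounded_weights
      bounded_field_power bounded_field_U) auto

lemma dominated_density_rate: "dominated (s + 3) density_rate"
  unfolding density_rate_def[abs_def]
  by (intro dominated_add dominated_mult dominated_U dominated_R bounded_field_mult bounded_field_const bounded_weights
      bounded_field_power bounded_field_U) auto

lemma dominated_energy_rate: "dominated (s + 3) (energy_rate s \<sigma> w0 w1 w3)"
proof -
  have "dominated (s + 3) (\<lambda>t x. ((-3) * w1 (x - \<sigma> * t)) * (U (s + 1) t x * U (s + 1) t x)
     + w3 (x - \<sigma> * t) * (U s t x * U s t x) + ((- \<sigma>) * w1 (x - \<sigma> * t)) * (U s t x * U s t x)
     + (real p * (real (p - 1) * (U 0 t x ^ (p - 2) * (U 1 t x * w0 (x - \<sigma> * t))))) * (U s t x * U s t x)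
     + (real p * (U 0 t x ^ (p - 1) * w1 (x - \<sigma> * t))) * (U s t x * U s t x)
     + ((-2) * (w0 (x - \<sigma> * t) * U s t x)) * R s t x)"
    by (intro dominated_add dominated_mult dominated_U dominated_R bounded_field_mult bounded_field_const bounded_weights
      bounded_field_power bounded_field_U) auto
  moreover have "energy_rate s \<sigma> w0 w1 w3 = (\<lambda>t x. ((-3) * w1 (x - \<sigma> * t)) * (U (s + 1) t x * U (s + 1) t x)
     + w3 (x - \<sigma> * t) * (U s t x * U s t x) + ((- \<sigma>) * w1 (x - \<sigma> * t)) * (U s t x * U s t x)
     + (real p * (real (p - 1) * (U 0 t x ^ (p - 2) * (U 1 t x * w0 (x - \<sigma> * t))))) * (U s t x * U s t x)
     + (real p * (U 0 t x ^ (p - 1) * w1 (x - \<sigma> * t))) * (U s t x * U s t x)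
     + ((-2) * (w0 (x - \<sigma> * t) * U s t x)) * R s t x)"
    by (intro ext) (simp add: energy_rate_def nonlin_def power2_eq_square algebra_simps)
  ultimately show ?thesis by simp
qed

lemma continuous_weights_x:
  "continuous_on A (\<lambda>x. w0 (x - \<sigma> * t))" "continuous_on A (\<lambda>x. w1 (x - \<sigma> * t))"
  "continuous_on A (\<lambda>x. w2 (x - \<sigma> * t))" "continuous_on A (\<lambda>x. w3 (x - \<sigma> * t))"
proof -
  have c: "continuous_on A (\<lambda>x. x - \<sigma> * t)" by (intro continuous_intros)
  show "continuous_on A (\<lambda>x. w0 (x - \<sigma> * t))" "continuous_on A (\<lambda>x. w1 (x - \<sigma> * t))"
    "continuous_on A (\<lambda>x. w2 (x - \<sigma> * t))" "continuous_on A (\<lambda>x. w3 (x - \<sigma> * t))"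
    by (rule continuous_on_compose2[OF weight_continuous(1)[OF w] c subset_UNIV]
        continuous_on_compose2[OF weight_continuous(2)[OF w] c subset_UNIV]
        continuous_on_compose2[OF weight_continuous(3)[OF w] c subset_UNIV]
        continuous_on_compose2[OF weight_continuous(4)[OF w] c subset_UNIV])+
qed

lemma continuous_energy_rate: "T \<le> t \<Longrightarrow> continuous_on UNIV (energy_rate s \<sigma> w0 w1 w3 t)"
  unfolding energy_rate_def[abs_def] nonlin_def
  by (intro continuous_intros continuous_weights_x continuous_U R_cont_x)

lemma continuous_density_rate_x: "T \<le> t \<Longrightarrow> continuous_on UNIV (density_rate t)"
  unfolding density_rate_def[abs_def]
  by (intro continuous_intros continuous_weights_x continuous_U R_cont_x)

lemma continuous_flux: "T \<le> t \<Longrightarrow> continuous_on UNIV (flux t)"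
  unfolding flux_def[abs_def]
  by (intro continuous_intros continuous_weights_x continuous_U)

lemma continuous_density_rate: "continuous_on ({T..} \<times> UNIV) (\<lambda>z. density_rate (fst z) (snd z))"
proof -
  have "continuous_on ({T..} \<times> UNIV) (\<lambda>z. w0 (snd z - \<sigma> * fst z))"
    by (rule continuous_on_compose2[OF weight_continuous(1)[OF w]]) (auto intro!: continuous_intros)
  moreover have "continuous_on ({T..} \<times> UNIV) (\<lambda>z. w1 (snd z - \<sigma> * fst z))"
    by (rule continuous_on_compose2[OF weight_continuous(2)[OF w]]) (auto intro!: continuous_intros)
  ultimately show ?thesis unfolding density_rate_def by (intro continuous_intros cont R_cont)
qed

lemma flux_DERIV:
  assumes t: "T \<le> t"
  shows "(flux t has_real_derivative energy_rate s \<sigma> w0 w1 w3 t x - density_rate t x) (at x)"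
proof -
  have sh: "((\<lambda>x. f (x - \<sigma> * t)) has_real_derivative d) (at x)"
    if f: "(f has_real_derivative d) (at (x - \<sigma> * t))" for f d x
  proof -
    have "((\<lambda>x. x - \<sigma> * t) has_real_derivative 1) (at x)" by (auto intro!: derivative_eq_intros)
    from DERIV_chain2[OF f this] show ?thesis by simp
  qed
  have wd: "((\<lambda>x. w0 (x - \<sigma> * t)) has_real_derivative w1 (x - \<sigma> * t)) (at x)"
    "((\<lambda>x. w1 (x - \<sigma> * t)) has_real_derivative w2 (x - \<sigma> * t)) (at x)"
    "((\<lambda>x. w2 (x - \<sigma> * t)) has_real_derivative w3 (x - \<sigma> * t)) (at x)" for x
    using w unfolding weight_def by (intro sh; blast)+
  have UU: "((\<lambda>x. U i t x * U j t x) has_real_derivative U i t x * U (Suc j) t x + U (Suc i) t x * U j t x) (at x)" for i j x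
    by (rule DERIV_mult'[OF dx[OF t] dx[OF t]])
  have P: "((\<lambda>x. U 0 t x ^ (p - 1)) has_real_derivative real (p - 1) * (U (Suc 0) t x * U 0 t x ^ (p - 1 - Suc 0))) (at x)" for x
    by (rule DERIV_power[OF dx[OF t]])
  note term1 = DERIV_mult'[OF DERIV_cmult[OF wd(1), of 2] UU[of s "s + 2"]]
  note term2 = DERIV_mult'[OF DERIV_cmult[OF wd(1), of "- 1"] UU[of "s + 1" "s + 1"]]
  note term3 = DERIV_mult'[OF DERIV_cmult[OF wd(2), of "- 2"] UU[of s "s + 1"]]
  note term4 = DERIV_mult'[OF wd(3) UU[of s s]]
  note term5 = DERIV_mult'[OF DERIV_cmult[OF DERIV_mult'[OF P wd(1)], of "real p"] UU[of s s]]
  have "p - 1 - Suc 0 = p - 2" by simp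
  thus ?thesis unfolding flux_def[abs_def]
    by (intro DERIV_cong[OF DERIV_add[OF DERIV_add[OF DERIV_add[OF DERIV_add[OF term1 term2] term3] term4] term5]])
      (simp add: energy_rate_def density_rate_def nonlin_def power2_eq_square numeral_2_eq_2 numeral_3_eq_3 algebra_simps)
qed

lemma integral_density_rate:
  assumes t: "T \<le> t"
  shows "(LINT x|lborel. density_rate t x) = (LINT x|lborel. energy_rate s \<sigma> w0 w1 w3 t x)"
    "integrable lborel (density_rate t)" "integrable lborel (energy_rate s \<sigma> w0 w1 w3 t)"
proof -
  obtain M1 M2 M3 where M: "\<And>x. \<bar>flux t x\<bar> \<le> M1 * S (s + 3) t x" "\<And>x. \<bar>density_rate t x\<bar> \<le> M2 * S (s + 3) t x"
    "\<And>x. \<bar>energy_rate s \<sigma> w0 w1 w3 t x\<bar> \<le> M3 * S (s + 3) t x"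
    using dominated_flux dominated_density_rate dominated_energy_rate t unfolding dominated_def by metis
  show i: "integrable lborel (density_rate t)" "integrable lborel (energy_rate s \<sigma> w0 w1 w3 t)"
    by (rule integrable_le_S[OF t continuous_density_rate_x[OF t] M(2)], rule integrable_le_S[OF t continuous_energy_rate[OF t] M(3)])
  have "(LINT x|lborel. energy_rate s \<sigma> w0 w1 w3 t x - density_rate t x) = 0"
    by (rule C1_integral_deriv_eq_0[OF flux_DERIV[OF t]])
      (use i integrable_le_S(1)[OF t continuous_flux[OF t] M(1)] in
        \<open>auto intro!: continuous_intros continuous_energy_rate continuous_density_rate_x t\<close>)
  thus "(LINT x|lborel. density_rate t x) = (LINT x|lborel. energy_rate s \<sigma> w0 w1 w3 t x)" using i by simp
qed

lemma integrable_square_weight: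
  assumes t: "T \<le> t"
  shows "integrable lborel (\<lambda>x. (U i t x)\<^sup>2 * w0 (x - \<sigma> * t))"
proof -
  obtain W where W: "\<forall>x. \<bar>w0 x\<bar> \<le> W" using w unfolding weight_def by blast
  show ?thesis
    by (rule integrable_bounded_mult[OF integrable_square[OF t] continuous_weights_x(1), where M=W]) (use W in auto)
qed

text \<open>Stated in integrated form to avoid differentiating under the integral: the fundamental
  theorem in time at each fixed x, Fubini, and the vanishing integral of the flux derivative at each
  fixed time.\<close>

lemma energy_identity:
  assumes t: "T \<le> t1" "t1 \<le> t2"
  shows "integrable lborel (\<lambda>\<tau>. indicator {t1..t2} \<tau> * (LINT x|lborel. energy_rate s \<sigma> w0 w1 w3 \<tau> x))"
    and "(LINT x|lborel. (U s t2 x)\<^sup>2 * w0 (x - \<sigma> * t2)) - (LINT x|lborel. (U s t1 x)\<^sup>2 * w0 (x - \<sigma> * t1))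
      = (LINT \<tau>|lborel. indicator {t1..t2} \<tau> * (LINT x|lborel. energy_rate s \<sigma> w0 w1 w3 \<tau> x))"
proof -
  define f where "f = (\<lambda>\<tau> x. indicator {t1..t2} \<tau> * density_rate \<tau> x)"
  obtain M where M: "M \<ge> 0" "\<And>t x. t \<ge> T \<Longrightarrow> \<bar>density_rate t x\<bar> \<le> M * S (s + 3) t x"
    using dominated_density_rate by (auto simp: dominated_def)
  obtain K where K: "K \<ge> 0" "\<And>t. t \<ge> T \<Longrightarrow> (LINT x|lborel. S (s + 3) t x) \<le> K"
    using integral_S_bound by blast
  have meas: "case_prod f \<in> borel_measurable (lborel \<Otimes>\<^sub>M lborel)"
  proof -
    have "(\<lambda>z. indicator ({t1..t2} \<times> UNIV) z *\<^sub>R density_rate (fst z) (snd z)) \<in> borel_measurable borel"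
      by (rule borel_measurable_continuous_on_indicator)
        (use t in \<open>auto intro!: continuous_on_subset[OF continuous_density_rate] borel_closed closed_Times\<close>)
    moreover have "(\<lambda>z. indicator ({t1..t2} \<times> UNIV) z *\<^sub>R density_rate (fst z) (snd z)) = case_prod f"
      by (auto simp: f_def indicator_def)
    ultimately show ?thesis by (simp add: borel_prod[symmetric] cong: measurable_cong_sets)
  qed
  have fx: "integrable lborel (f \<tau>)" for \<tau>
    using integral_density_rate(2)[of \<tau>] t by (cases "\<tau> \<in> {t1..t2}") (auto simp: f_def)
  have fint: "integrable (lborel \<Otimes>\<^sub>M lborel) (case_prod f)"
  proof (rule lborel_pair.Fubini_integrable[OF meas])
    show "AE x in lborel. integrable lborel (\<lambda>y. case (x, y) of (x, y) \<Rightarrow> f x y)" using fx by simp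
    show "integrable lborel (\<lambda>x. LINT y|lborel. norm (case (x, y) of (x, y) \<Rightarrow> f x y))"
    proof (rule Bochner_Integration.integrable_bound)
      \<comment> \<open>The uniform bound \<open>K\<close> of the integral of
        \<open>S (s + 3)\<close> provides a constant majorant on the bounded time interval.\<close>
      show "integrable lborel (\<lambda>\<tau>. indicator {t1..t2} \<tau> * (M * K))"
        using borel_integrable_atLeastAtMost'[of t1 t2 "\<lambda>_. M * K"] by (simp add: set_integrable_def)
      show "(\<lambda>x. LINT y|lborel. norm (case (x, y) of (x, y) \<Rightarrow> f x y)) \<in> borel_measurable lborel"
        using meas by measurable
      have "(LINT y|lborel. \<bar>f \<tau> y\<bar>) \<le> indicator {t1..t2} \<tau> * (M * K)" for \<tau>
      proof (cases "\<tau> \<in> {t1..t2}")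
        case True
        hence \<tau>: "T \<le> \<tau>" using t by simp
        have "(LINT y|lborel. \<bar>density_rate \<tau> y\<bar>) \<le> M * (LINT x|lborel. S (s + 3) \<tau> x)"
          by (rule integrable_le_S[OF \<tau> continuous_density_rate_x[OF \<tau>] M(2)[OF \<tau>]])
        also have "\<dots> \<le> M * K" by (intro mult_left_mono K \<tau> M)
        finally show ?thesis using True by (simp add: f_def)
      qed (simp add: f_def)
      thus "AE \<tau> in lborel. norm (LINT y|lborel. norm (case (\<tau>, y) of (x, y) \<Rightarrow> f x y)) \<le> norm (indicator {t1..t2} \<tau> * (M * K))"
        by (auto intro: order_trans[OF _ abs_ge_self])
    qed
  qed
  have inner: "(LINT x|lborel. f \<tau> x) = indicator {t1..t2} \<tau> * (LINT x|lborel. energy_rate s \<sigma> w0 w1 w3 \<tau> x)" for \<tau>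
    using integral_density_rate(1)[of \<tau>] t by (cases "\<tau> \<in> {t1..t2}") (auto simp: f_def)
  show "integrable lborel (\<lambda>\<tau>. indicator {t1..t2} \<tau> * (LINT x|lborel. energy_rate s \<sigma> w0 w1 w3 \<tau> x))"
    using lborel_pair.integrable_fst'[OF fint] by (simp add: inner)
  have outer: "(LINT \<tau>|lborel. f \<tau> x) = (U s t2 x)\<^sup>2 * w0 (x - \<sigma> * t2) - (U s t1 x)\<^sup>2 * w0 (x - \<sigma> * t1)" for x
  proof -
    have "(LINT \<tau>|lborel. indicator {t1..t2} \<tau> *\<^sub>R density_rate \<tau> x) = (U s t2 x)\<^sup>2 * w0 (x - \<sigma> * t2) - (U s t1 x)\<^sup>2 * w0 (x - \<sigma> * t1)"
    proof (rule integral_FTC_atLeastAtMost[OF t(2)])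
      show "continuous_on {t1..t2} (\<lambda>\<tau>. density_rate \<tau> x)"
        using continuous_on_compose2[OF continuous_density_rate, of "{t1..t2}" "\<lambda>\<tau>. (\<tau>, x)"] t
        by (force intro!: continuous_intros)
      fix \<tau> assume \<tau>: "t1 \<le> \<tau>" "\<tau> \<le> t2"
      have dU: "((\<lambda>\<tau>. U s \<tau> x) has_real_derivative
          - U (s + 3) \<tau> x - real p * U 0 \<tau> x ^ (p - 1) * U (Suc s) \<tau> x - R s \<tau> x) (at \<tau> within {t1..t2})"
        by (rule has_field_derivative_subset[OF dt]) (use t \<tau> in auto)
      have dw: "((\<lambda>\<tau>. w0 (x - \<sigma> * \<tau>)) has_real_derivative w1 (x - \<sigma> * \<tau>) * - \<sigma>) (at \<tau> within {t1..t2})"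
        by (rule DERIV_chain2) (use w in \<open>auto simp: weight_def intro!: derivative_eq_intros\<close>)
      have "((\<lambda>\<tau>. (U s \<tau> x * U s \<tau> x) * w0 (x - \<sigma> * \<tau>)) has_real_derivative density_rate \<tau> x) (at \<tau> within {t1..t2})"
        by (rule DERIV_cong[OF DERIV_mult[OF DERIV_mult[OF dU dU] dw]]) (simp add: density_rate_def algebra_simps)
      thus "((\<lambda>\<tau>. (U s \<tau> x)\<^sup>2 * w0 (x - \<sigma> * \<tau>)) has_vector_derivative density_rate \<tau> x) (at \<tau> within {t1..t2})"
        by (simp add: has_real_derivative_iff_has_vector_derivative power2_eq_square)
    qed
    thus ?thesis by (simp add: f_def)
  qed
  have "(LINT x|lborel. (U s t2 x)\<^sup>2 * w0 (x - \<sigma> * t2)) - (LINT x|lborel. (U s t1 x)\<^sup>2 * w0 (x - \<sigma> * t1))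
      = (LINT x|lborel. (LINT \<tau>|lborel. f \<tau> x))"
    unfolding outer using integrable_square_weight t by simp
  also have "\<dots> = (LINT \<tau>|lborel. (LINT x|lborel. f \<tau> x))"
    using lborel_pair.Fubini_integral[OF fint] by simp
  finally show "(LINT x|lborel. (U s t2 x)\<^sup>2 * w0 (x - \<sigma> * t2)) - (LINT x|lborel. (U s t1 x)\<^sup>2 * w0 (x - \<sigma> * t1))
      = (LINT \<tau>|lborel. indicator {t1..t2} \<tau> * (LINT x|lborel. energy_rate s \<sigma> w0 w1 w3 \<tau> x))"
    by (simp add: inner)
qed

text \<open>The energy identity bounds increments by \<open>M * K\<close> times the elapsed time.
  Continuity is what \<open>backward_gronwall\<close> asks of the energy.\<close>

lemma continuous_energy: "continuous_on {T..} (\<lambda>t. LINT x|lborel. (U s t x)\<^sup>2 * w0 (x - \<sigma> * t))"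
proof -
  obtain M where M: "M \<ge> 0" "\<And>t x. t \<ge> T \<Longrightarrow> \<bar>energy_rate s \<sigma> w0 w1 w3 t x\<bar> \<le> M * S (s + 3) t x"
    using dominated_energy_rate by (auto simp: dominated_def)
  obtain K where K: "K \<ge> 0" "\<And>t. t \<ge> T \<Longrightarrow> (LINT x|lborel. S (s + 3) t x) \<le> K"
    using integral_S_bound by blast
  let ?F = "\<lambda>t. LINT x|lborel. (U s t x)\<^sup>2 * w0 (x - \<sigma> * t)"
  have *: "\<bar>?F t2 - ?F t1\<bar> \<le> M * K * (t2 - t1)" if t: "T \<le> t1" "t1 \<le> t2" for t1 t2
  proof -
    have E: "\<bar>LINT x|lborel. energy_rate s \<sigma> w0 w1 w3 \<tau> x\<bar> \<le> M * K" if \<tau>: "T \<le> \<tau>" for \<tau>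
    proof -
      have "\<bar>LINT x|lborel. energy_rate s \<sigma> w0 w1 w3 \<tau> x\<bar> \<le> (LINT x|lborel. \<bar>energy_rate s \<sigma> w0 w1 w3 \<tau> x\<bar>)"
        using integral_norm_bound[of lborel "energy_rate s \<sigma> w0 w1 w3 \<tau>"] unfolding real_norm_def .
      also have "\<dots> \<le> M * (LINT x|lborel. S (s + 3) \<tau> x)"
        by (rule integrable_le_S[OF \<tau> continuous_energy_rate[OF \<tau>] M(2)[OF \<tau>]])
      also have "\<dots> \<le> M * K" by (intro mult_left_mono K \<tau> M)
      finally show ?thesis .
    qed
    have "\<bar>?F t2 - ?F t1\<bar> \<le> (LINT \<tau>|lborel. \<bar>indicator {t1..t2} \<tau> * (LINT x|lborel. energy_rate s \<sigma> w0 w1 w3 \<tau> x)\<bar>)"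
      unfolding energy_identity(2)[OF t]
      using integral_norm_bound[of lborel "\<lambda>\<tau>. indicator {t1..t2} \<tau> * (LINT x|lborel. energy_rate s \<sigma> w0 w1 w3 \<tau> x)"]
      unfolding real_norm_def .
    also have "\<dots> \<le> (LINT \<tau>|lborel. indicator {t1..t2} \<tau> * (M * K))"
    proof (rule integral_mono)
      show "integrable lborel (\<lambda>\<tau>. indicator {t1..t2} \<tau> * (M * K))"
        using borel_integrable_atLeastAtMost'[of t1 t2 "\<lambda>_. M * K"] by (simp add: set_integrable_def)
      show "integrable lborel (\<lambda>\<tau>. \<bar>indicator {t1..t2} \<tau> * (LINT x|lborel. energy_rate s \<sigma> w0 w1 w3 \<tau> x)\<bar>)"
        using energy_identity(1)[OF t] by simp
      show "\<bar>indicator {t1..t2} \<tau> * (LINT x|lborel. energy_rate s \<sigma> w0 w1 w3 \<tau> x)\<bar> \<le> indicator {t1..t2} \<tau> * (M * K)" for \<tau>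
        using E[of \<tau>] t by (cases "\<tau> \<in> {t1..t2}") auto
    qed
    also have "\<dots> = M * K * (t2 - t1)" using t by (simp add: mult.commute)
    finally show ?thesis .
  qed
  have "(M * K)-lipschitz_on {T..} ?F"
  proof (rule lipschitz_onI)
    fix x y assume "x \<in> {T..}" "y \<in> {T..}"
    thus "dist (?F x) (?F y) \<le> M * K * dist x y"
      using *[of x y] *[of y x] by (cases "x \<le> y") (auto simp: dist_real_def abs_minus_commute)
  qed (use M K in auto)
  thus ?thesis by (rule lipschitz_on_continuous_on)
qed

end

text \<open>Here \<open>\<rho>\<close> is the size of the weight at the solitons; a smaller \<open>\<rho>\<close> is the whole gain of the estimate.\<close>

definition decaying_weight :: "real \<Rightarrow> real \<Rightarrow> (nat \<Rightarrow> real) \<Rightarrow> (nat \<Rightarrow> real) \<Rightarrow>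
    (real \<Rightarrow> real) \<Rightarrow> (real \<Rightarrow> real) \<Rightarrow> (real \<Rightarrow> real) \<Rightarrow> real \<Rightarrow> real \<Rightarrow> bool" where
  "decaying_weight \<gamma> K A B w0 w1 w3 \<sigma> \<rho> \<longleftrightarrow> 0 \<le> \<rho> \<and> (\<forall>x. 0 \<le> w0 x) \<and> (\<forall>x. \<bar>w1 x\<bar> \<le> K * w0 x) \<and>
    (\<forall>t\<ge>T. \<forall>x i. \<bar>U i t x\<bar> * w0 (x - \<sigma> * t) \<le> A i * (exp (- \<gamma> * t) * (w0 (x - \<sigma> * t) + \<rho>))) \<and>
    (\<forall>t\<ge>T. \<forall>i. (LINT x|lborel. 3 * (U (Suc i) t x)\<^sup>2 * w1 (x - \<sigma> * t)
        - (U i t x)\<^sup>2 * (w3 (x - \<sigma> * t) - \<sigma> * w1 (x - \<sigma> * t))) \<le> B i * exp (- \<gamma> * t) * \<rho>) \<and>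
    (\<forall>i. ((\<lambda>t. LINT x|lborel. (U i t x)\<^sup>2 * w0 (x - \<sigma> * t)) \<longlongrightarrow> 0) at_top)"

text \<open>The constant is chosen before the weight, its speed and \<open>\<rho>\<close>; later the
  weight is shifted by Y and decay is read off from the dependence of \<open>\<rho>\<close> on Y.
  All orders up to \<open>s\<close> are estimated together, because the nonlinear term at order
  \<open>s\<close> is bounded by \<open>S s\<close>, which contains the lower ones.\<close>

lemma weighted_decay:
  assumes \<gamma>: "\<gamma> > 0" and K1: "K1 \<ge> 0" and A: "\<And>i. A i \<ge> 0" and B: "\<And>i. B i \<ge> 0"
  shows "\<exists>C\<ge>0. \<forall>w0 w1 w2 w3 \<sigma> \<rho> t. weight w0 w1 w2 w3 \<longrightarrow> decaying_weight \<gamma> K1 A B w0 w1 w3 \<sigma> \<rho> \<longrightarrow> T \<le> t \<longrightarrow>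
    (LINT x|lborel. (U s t x)\<^sup>2 * w0 (x - \<sigma> * t)) \<le> C * \<rho> * exp (- \<gamma> * t)"
proof -
  obtain C where C: "\<And>i. C i \<ge> 0" "\<And>i t x q q' E. t \<ge> T \<Longrightarrow> 0 \<le> q \<Longrightarrow> \<bar>q'\<bar> \<le> K1 * q \<Longrightarrow> 0 \<le> E \<Longrightarrow>
      (\<And>j. \<bar>U j t x\<bar> * q \<le> A j * E) \<Longrightarrow> \<bar>nonlin i t x q q'\<bar> \<le> C i * E * S i t x"
    using nonlin_bound[OF K1, of A] A by metis
  obtain K where K: "\<And>m. K m \<ge> 0" "\<And>m t. t \<ge> T \<Longrightarrow> (LINT x|lborel. S m t x) \<le> K m"
    using integral_S_bound by metis
  \<comment> \<open>\<open>B i\<close> covers the linear terms. In the nonlinear ones the smallness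
    factor has a weight part, which integrates to at most \<open>G\<close>, and a part
    \<open>\<rho>\<close>, which integrates to at most \<open>\<rho> * K i\<close>.\<close>
  define c where "c = (\<lambda>i. B i + C i * (1 + K i))"
  have c: "c i \<ge> 0" for i unfolding c_def using B C K by (intro add_nonneg_nonneg mult_nonneg_nonneg) auto
  define D where "D = (\<Sum>i\<le>s. c i)"
  have D: "D \<ge> 0" unfolding D_def using c by (intro sum_nonneg) auto
  show ?thesis
  proof (intro exI[of _ "D / \<gamma> * exp (D / \<gamma> * exp (- \<gamma> * T))"] conjI allI impI)
    show "0 \<le> D / \<gamma> * exp (D / \<gamma> * exp (- \<gamma> * T))" using D \<gamma> by simp
    fix w0 w1 w2 w3 \<sigma> \<rho> t
    assume w: "weight w0 w1 w2 w3" and dw: "decaying_weight \<gamma> K1 A B w0 w1 w3 \<sigma> \<rho>" and t: "T \<le> t"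
    from dw have \<rho>: "0 \<le> \<rho>" and w0: "\<forall>x. 0 \<le> w0 x" and w1: "\<forall>x. \<bar>w1 x\<bar> \<le> K1 * w0 x"
      and UA: "\<forall>t\<ge>T. \<forall>x i. \<bar>U i t x\<bar> * w0 (x - \<sigma> * t) \<le> A i * (exp (- \<gamma> * t) * (w0 (x - \<sigma> * t) + \<rho>))"
      and lin: "\<forall>t\<ge>T. \<forall>i. (LINT x|lborel. 3 * (U (Suc i) t x)\<^sup>2 * w1 (x - \<sigma> * t)
        - (U i t x)\<^sup>2 * (w3 (x - \<sigma> * t) - \<sigma> * w1 (x - \<sigma> * t))) \<le> B i * exp (- \<gamma> * t) * \<rho>"
      and lim: "\<forall>i. ((\<lambda>t. LINT x|lborel. (U i t x)\<^sup>2 * w0 (x - \<sigma> * t)) \<longlongrightarrow> 0) at_top"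
      unfolding decaying_weight_def by - (elim conjE, assumption)+
    define F where "F = (\<lambda>i t. LINT x|lborel. (U i t x)\<^sup>2 * w0 (x - \<sigma> * t))"
    define G where "G = (\<lambda>t. \<Sum>i\<le>s. F i t)"
    have F0: "F i t \<ge> 0" for i t unfolding F_def using w0 by simp
    have cF: "continuous_on {T..} (F i)" for i unfolding F_def by (rule continuous_energy[OF w])
    have cG: "continuous_on {T..} G" unfolding G_def by (intro continuous_intros cF)
    have G0: "G t \<ge> 0" for t unfolding G_def by (intro sum_nonneg F0)
    note sw = integrable_square_weight[OF w]
    have rate: "- (LINT x|lborel. energy_rate i \<sigma> w0 w1 w3 \<tau> x) \<le> c i * exp (- \<gamma> * \<tau>) * (G \<tau> + \<rho>)"
      if \<tau>: "T \<le> \<tau>" and i: "i \<le> s" for i \<tau>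
    proof -
      let ?w = "\<lambda>x. w0 (x - \<sigma> * \<tau>)" and ?e = "exp (- \<gamma> * \<tau>)"
      let ?l = "\<lambda>x. 3 * (U (Suc i) \<tau> x)\<^sup>2 * w1 (x - \<sigma> * \<tau>) - (U i \<tau> x)\<^sup>2 * (w3 (x - \<sigma> * \<tau>) - \<sigma> * w1 (x - \<sigma> * \<tau>))"
      let ?n = "\<lambda>x. C i * (?e * (?w x + \<rho>)) * S i \<tau> x"
      obtain W where W: "\<forall>x. \<bar>w0 x\<bar> \<le> W \<and> \<bar>w1 x\<bar> \<le> W \<and> \<bar>w2 x\<bar> \<le> W \<and> \<bar>w3 x\<bar> \<le> W"
        using w unfolding weight_def by blast
      note cw = continuous_weights_x[OF w, of UNIV \<sigma> \<tau>]
      have i1: "integrable lborel (\<lambda>x. (U j \<tau> x)\<^sup>2 * w1 (x - \<sigma> * \<tau>))" "integrable lborel (\<lambda>x. (U j \<tau> x)\<^sup>2 * w3 (x - \<sigma> * \<tau>))" for j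
        by (rule integrable_bounded_mult[OF integrable_square[OF \<tau>] cw(2), where M=W], use W in blast)
           (rule integrable_bounded_mult[OF integrable_square[OF \<tau>] cw(4), where M=W], use W in blast)
      have il: "integrable lborel ?l"
      proof -
        have "?l = (\<lambda>x. 3 * ((U (Suc i) \<tau> x)\<^sup>2 * w1 (x - \<sigma> * \<tau>)) - ((U i \<tau> x)\<^sup>2 * w3 (x - \<sigma> * \<tau>) - \<sigma> * ((U i \<tau> x)\<^sup>2 * w1 (x - \<sigma> * \<tau>))))"
          by (simp add: fun_eq_iff algebra_simps)
        thus ?thesis using i1 by simp
      qed
      have iSw: "integrable lborel (\<lambda>x. S i \<tau> x * ?w x)" and eqSw: "(LINT x|lborel. S i \<tau> x * ?w x) = (\<Sum>j\<le>i. F j \<tau>)"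
        unfolding S_def F_def sum_distrib_right using sw[OF \<tau>] by (auto intro!: Bochner_Integration.integrable_sum Bochner_Integration.integral_sum)
      have n_eq: "?n = (\<lambda>x. C i * ?e * (S i \<tau> x * ?w x) + C i * ?e * \<rho> * S i \<tau> x)" by (simp add: fun_eq_iff algebra_simps)
      have i_n: "integrable lborel ?n" unfolding n_eq using iSw integrable_S[OF \<tau>] by simp
      have "- (LINT x|lborel. energy_rate i \<sigma> w0 w1 w3 \<tau> x) = (LINT x|lborel. - energy_rate i \<sigma> w0 w1 w3 \<tau> x)" by simp
      also have "\<dots> \<le> (LINT x|lborel. ?l x + ?n x)"
      proof (rule integral_mono)
        show "integrable lborel (\<lambda>x. - energy_rate i \<sigma> w0 w1 w3 \<tau> x)" using integral_density_rate(3)[OF w \<tau>] by simp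
        show "integrable lborel (\<lambda>x. ?l x + ?n x)" using il i_n by simp
        fix x
        have "\<bar>nonlin i \<tau> x (?w x) (w1 (x - \<sigma> * \<tau>))\<bar> \<le> ?n x"
          using UA \<tau> w0 w1 \<rho> by (intro C(2)) auto
        thus "- energy_rate i \<sigma> w0 w1 w3 \<tau> x \<le> ?l x + ?n x" unfolding energy_rate_def by linarith
      qed
      also have "\<dots> = (LINT x|lborel. ?l x) + (LINT x|lborel. ?n x)" using il i_n by simp
      also have "(LINT x|lborel. ?n x) = C i * ?e * (\<Sum>j\<le>i. F j \<tau>) + C i * ?e * \<rho> * (LINT x|lborel. S i \<tau> x)"
        unfolding n_eq using iSw integrable_S[OF \<tau>] by (simp add: eqSw)
      also have "\<dots> \<le> C i * ?e * G \<tau> + C i * ?e * \<rho> * K i"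
      proof (intro add_mono mult_left_mono K \<tau>)
        show "(\<Sum>j\<le>i. F j \<tau>) \<le> G \<tau>" unfolding G_def using i F0 by (intro sum_mono2) auto
      qed (use C \<rho> in auto)
      also have "(LINT x|lborel. ?l x) \<le> B i * ?e * \<rho>" using lin \<tau> by blast
      finally have "- (LINT x|lborel. energy_rate i \<sigma> w0 w1 w3 \<tau> x) \<le> B i * ?e * \<rho> + (C i * ?e * G \<tau> + C i * ?e * \<rho> * K i)" by simp
      also have "\<dots> \<le> c i * ?e * (G \<tau> + \<rho>)"
      proof -
        have "c i * ?e * (G \<tau> + \<rho>) - (B i * ?e * \<rho> + (C i * ?e * G \<tau> + C i * ?e * \<rho> * K i))
            = ?e * (B i * G \<tau> + C i * \<rho> + C i * K i * G \<tau>)" by (simp add: c_def algebra_simps)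
        moreover have "\<dots> \<ge> 0" using B C K \<rho> G0 by (intro mult_nonneg_nonneg add_nonneg_nonneg) auto
        ultimately show ?thesis by linarith
      qed
      finally show ?thesis .
    qed
    have "G t \<le> D / \<gamma> * exp (D / \<gamma> * exp (- \<gamma> * T)) * \<rho> * exp (- \<gamma> * t)"
    proof (rule backward_gronwall[OF \<gamma> D \<rho> cG _ _ t])
      have "(G \<longlongrightarrow> (\<Sum>i\<le>s. 0)) at_top" unfolding G_def F_def using lim by (intro tendsto_sum) auto
      thus "(G \<longlongrightarrow> 0) at_top" by simp
      fix t1 t2 assume t12: "T \<le> t1" "t1 \<le> t2"
      let ?g = "\<lambda>\<tau>. exp (- \<gamma> * \<tau>) * (G \<tau> + \<rho>)"
      have cg: "continuous_on {t1..t2} ?g"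
        by (intro continuous_intros continuous_on_subset[OF cG]) (use t12 in auto)
      have ig: "integrable lborel (\<lambda>\<tau>. indicator {t1..t2} \<tau> * ?g \<tau>)"
        using borel_integrable_atLeastAtMost'[OF cg] by (simp add: set_integrable_def)
      have eqg: "(LINT \<tau>|lborel. indicator {t1..t2} \<tau> * ?g \<tau>) = integral {t1..t2} ?g"
        using set_borel_integral_eq_integral(2)[OF borel_integrable_atLeastAtMost'[OF cg]] by (simp add: set_lebesgue_integral_def)
      have "F i t1 \<le> F i t2 + c i * integral {t1..t2} ?g" if i: "i \<le> s" for i
      proof -
        note ei = energy_identity[OF w t12, where s=i and \<sigma>=\<sigma>]
        have "F i t1 - F i t2 = (LINT \<tau>|lborel. - (indicator {t1..t2} \<tau> * (LINT x|lborel. energy_rate i \<sigma> w0 w1 w3 \<tau> x)))"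
          using ei(2) by (simp add: F_def)
        also have "\<dots> \<le> (LINT \<tau>|lborel. c i * (indicator {t1..t2} \<tau> * ?g \<tau>))"
        proof (rule integral_mono)
          show "integrable lborel (\<lambda>\<tau>. - (indicator {t1..t2} \<tau> * (LINT x|lborel. energy_rate i \<sigma> w0 w1 w3 \<tau> x)))" using ei(1) by simp
          show "integrable lborel (\<lambda>\<tau>. c i * (indicator {t1..t2} \<tau> * ?g \<tau>))" using ig by simp
          show "- (indicator {t1..t2} \<tau> * (LINT x|lborel. energy_rate i \<sigma> w0 w1 w3 \<tau> x)) \<le> c i * (indicator {t1..t2} \<tau> * ?g \<tau>)" for \<tau>
            using rate[of \<tau> i] t12 i by (cases "\<tau> \<in> {t1..t2}") (auto simp: mult.assoc)
        qed
        finally show ?thesis using eqg by simp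
      qed
      hence "G t1 \<le> (\<Sum>i\<le>s. F i t2 + c i * integral {t1..t2} ?g)" unfolding G_def by (intro sum_mono) auto
      also have "\<dots> = G t2 + D * integral {t1..t2} ?g" by (simp add: G_def D_def sum.distrib sum_distrib_right)
      also have "D * integral {t1..t2} ?g = integral {t1..t2} (\<lambda>\<tau>. D * exp (- \<gamma> * \<tau>) * (G \<tau> + \<rho>))"
        by (subst integral_mult_right[symmetric]) (simp add: mult.assoc)
      finally show "G t1 \<le> G t2 + integral {t1..t2} (\<lambda>\<tau>. D * exp (- \<gamma> * \<tau>) * (G \<tau> + \<rho>))" .
    qed
    moreover have "F s t \<le> G t" unfolding G_def using F0 by (intro member_le_sum) auto
    ultimately show "(LINT x|lborel. (U s t x)\<^sup>2 * w0 (x - \<sigma> * t)) \<le> D / \<gamma> * exp (D / \<gamma> * exp (- \<gamma> * T)) * \<rho> * exp (- \<gamma> * t)"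
      unfolding F_def by linarith
  qed
qed

end

section \<open>Pointwise form of the equation\<close>

text \<open>Integrating the weak identity in time and exchanging integrals shows that
  \<open>V t2 - V t1\<close> minus the time integral of \<open>G\<close> annihilates every test
  function. Being continuous in x, it is zero, and the resulting formula can be differentiated in
  time because \<open>G\<close> is continuous.\<close>

lemma pointwise_time_derivative:
  fixes V G :: "real \<Rightarrow> real \<Rightarrow> real"
  assumes V: "\<And>t. T \<le> t \<Longrightarrow> continuous_on UNIV (V t)"
    and G: "continuous_on ({T..} \<times> UNIV) (\<lambda>z. G (fst z) (snd z))"
    and weak: "\<And>\<phi> t. test_function \<phi> \<Longrightarrow> T \<le> t \<Longrightarrow>
      ((\<lambda>\<tau>. LINT x|lborel. V \<tau> x * \<phi> x) has_real_derivative (LINT x|lborel. G t x * \<phi> x)) (at t within {T..})"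
    and t: "T \<le> t"
  shows "((\<lambda>\<tau>. V \<tau> x) has_real_derivative G t x) (at t within {T..})"
proof -
  have Gx: "continuous_on UNIV (G t)" if "T \<le> t" for t
    using continuous_on_compose2[OF G, of UNIV "\<lambda>x. (t, x)"] that by (force intro!: continuous_intros)
  have Gt: "continuous_on {a..b} (\<lambda>\<tau>. G \<tau> x)" if "T \<le> a" for a b x
    using continuous_on_compose2[OF G, of "{a..b}" "\<lambda>\<tau>. (\<tau>, x)"] that by (force intro!: continuous_intros)
  have int_eq: "V t2 x - V t1 x - integral {t1..t2} (\<lambda>\<tau>. G \<tau> x) = 0" if t12: "T \<le> t1" "t1 \<le> t2" for t1 t2 x
  proof -
    define J where "J = (\<lambda>x. integral {t1..t2} (\<lambda>\<tau>. G \<tau> x))"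
    have cJ: "continuous_on UNIV J"
    proof (intro continuous_at_imp_continuous_on ballI)
      fix y :: real
      have "continuous_on (cbox (y - 1) (y + 1)) (\<lambda>x. integral (cbox t1 t2) (\<lambda>\<tau>. G \<tau> x))"
      proof (rule integral_continuous_on_param)
        show "continuous_on (cbox (y - 1) (y + 1) \<times> cbox t1 t2) (\<lambda>(x, \<tau>). G \<tau> x)"
          unfolding case_prod_beta
          by (rule continuous_on_compose2[OF G, of _ "\<lambda>z. (snd z, fst z)", simplified])
            (use t12 in \<open>auto intro!: continuous_intros\<close>)
      qed
      thus "isCont J y" unfolding J_def by (intro continuous_on_interior[of "{y-1..y+1}"]) auto
    qed
    have "(LINT x|lborel. (V t2 x - V t1 x - J x) * \<phi> x) = 0" if \<phi>: "test_function \<phi>" for \<phi>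
    proof -
      obtain r where r: "\<forall>x. r < \<bar>x\<bar> \<longrightarrow> \<phi> x = 0" using \<phi> by (auto simp: test_function_iff)
      have c\<phi>: "continuous_on A \<phi>" for A by (intro smooth_continuous0 test_function_smooth \<phi>)
      have local: "(LINT x|lborel. f x * \<phi> x) = integral {-r..r} (\<lambda>x. f x * \<phi> x)" if "continuous_on UNIV f" for f
        by (intro integrable_compact_support continuous_intros that c\<phi>) (use r in auto)
      have "((\<lambda>\<tau>. LINT x|lborel. G \<tau> x * \<phi> x) has_integral
          (LINT x|lborel. V t2 x * \<phi> x) - (LINT x|lborel. V t1 x * \<phi> x)) {t1..t2}"
      proof (rule fundamental_theorem_of_calculus[OF t12(2)])
        fix \<tau> assume "\<tau> \<in> {t1..t2}"
        thus "((\<lambda>\<tau>. LINT x|lborel. V \<tau> x * \<phi> x) has_vector_derivative (LINT x|lborel. G \<tau> x * \<phi> x)) (at \<tau> within {t1..t2})"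
          using has_field_derivative_subset[OF weak[OF \<phi>, of \<tau>], of "{t1..t2}"] t12
          by (auto simp: has_real_derivative_iff_has_vector_derivative)
      qed
      hence "(LINT x|lborel. V t2 x * \<phi> x) - (LINT x|lborel. V t1 x * \<phi> x) = integral {t1..t2} (\<lambda>\<tau>. LINT x|lborel. G \<tau> x * \<phi> x)"
        by (simp add: integral_unique)
      also have "\<dots> = integral {t1..t2} (\<lambda>\<tau>. integral {-r..r} (\<lambda>x. G \<tau> x * \<phi> x))"
        by (intro integral_cong local Gx) (use t12 in auto)
      also have "\<dots> = integral {-r..r} (\<lambda>x. integral {t1..t2} (\<lambda>\<tau>. G \<tau> x * \<phi> x))"
      proof -
        have "continuous_on (cbox (t1, -r) (t2, r)) (\<lambda>z. G (fst z) (snd z))"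
          by (rule continuous_on_subset[OF G]) (use t12 in \<open>auto simp: cbox_Pair_eq\<close>)
        moreover have "continuous_on (cbox (t1, -r) (t2, r)) (\<lambda>z. \<phi> (snd z))"
          by (rule continuous_on_compose2[OF c\<phi>[of UNIV]]) (auto intro!: continuous_intros)
        ultimately have "continuous_on (cbox (t1, -r) (t2, r)) (\<lambda>(\<tau>, x). G \<tau> x * \<phi> x)"
          unfolding case_prod_beta by (rule continuous_on_mult)
        from integral_swap_continuous[OF this] show ?thesis by simp
      qed
      also have "\<dots> = integral {-r..r} (\<lambda>x. J x * \<phi> x)" by (simp add: J_def)
      also have "\<dots> = (LINT x|lborel. J x * \<phi> x)" by (rule local[OF cJ, symmetric])
      finally have eq: "(LINT x|lborel. V t2 x * \<phi> x) - (LINT x|lborel. V t1 x * \<phi> x) = (LINT x|lborel. J x * \<phi> x)" .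
      have "integrable lborel (\<lambda>x. V t2 x * \<phi> x)" "integrable lborel (\<lambda>x. V t1 x * \<phi> x)" "integrable lborel (\<lambda>x. J x * \<phi> x)"
        using t12 by (intro integrable_test_mult \<phi> V cJ; simp)+
      thus ?thesis using eq by (simp add: left_diff_distrib)
    qed
    hence "V t2 x - V t1 x - J x = 0"
      using t12 by (intro continuous_eq_0_if_test_integrals_0[where q="\<lambda>x. V t2 x - V t1 x - J x"] continuous_intros V cJ) auto
    thus ?thesis by (simp add: J_def)
  qed
  have "((\<lambda>\<tau>. V T x + integral {T..\<tau>} (\<lambda>\<tau>. G \<tau> x)) has_real_derivative 0 + G t x) (at t within {T..t+1})"
    by (intro DERIV_add DERIV_const integral_has_real_derivative Gt) (use t in auto)
  moreover have "at t within {T..t+1} = at t within {T..}"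
    by (rule at_within_nhd[of t "{..<t+1}"]) auto
  ultimately have "((\<lambda>\<tau>. V T x + integral {T..\<tau>} (\<lambda>\<tau>. G \<tau> x)) has_real_derivative G t x) (at t within {T..})" by simp
  thus ?thesis
  proof (rule has_field_derivative_transform_within[where d=1])
    fix \<tau> assume "\<tau> \<in> {T..}"
    thus "V T x + integral {T..\<tau>} (\<lambda>\<tau>. G \<tau> x) = V \<tau> x"
      using int_eq[of T \<tau> x] unfolding atLeast_iff by linarith
  qed (use t in auto)
qed

section \<open>Multi-solitons\<close>

locale gkdv_multi_soliton =
  fixes p N :: nat and c x0 :: "nat \<Rightarrow> real" and u :: "real \<Rightarrow> real \<Rightarrow> real"
    and T0 \<theta> :: real and \<Lambda> :: "nat \<Rightarrow> real"
  assumes p: "p \<ge> 2" and N: "N \<ge> 1"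
    and c_pos: "\<And>j. j \<in> {1..N} \<Longrightarrow> 0 < c j" and c_mono: "strict_mono_on {1..N} c"
    and T0: "T0 \<ge> 0"
    and solution: "H1_solution p {T0..} u"
    and u_cont: "\<And>t. t \<ge> T0 \<Longrightarrow> continuous_on UNIV (u t)"
    and u_sobolev: "\<And>s. continuous_in_sobolev s {T0..} u"
    and \<theta>: "\<theta> > 0" and \<Lambda>: "\<And>s. \<Lambda> s > 0"
    and close: "\<And>s t. t \<ge> T0 \<Longrightarrow>
           sobolev_norm s (\<lambda>x. u t x - soliton_sum p N c x0 t x) \<le> \<Lambda> s * exp (- \<theta> * t)"
begin

text \<open>Half the decay rate of the slowest soliton. It is admissible for all solitons, and its
  square \<open>c 1 / 4\<close> stays below the speed \<open>c 1 / 2\<close> of the left frame. The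
  rate in the final theorem is smaller.\<close>

definition \<kappa> :: real where "\<kappa> = sqrt (c 1) / 2"

text \<open>Envelope centred at \<open>c j * t\<close>; the phases \<open>x0 j\<close> are absorbed
  into constants.\<close>

definition E :: "nat \<Rightarrow> real \<Rightarrow> real \<Rightarrow> real" where "E j t x = exp (- \<kappa> * \<bar>x - c j * t\<bar>)"

definition U :: "nat \<Rightarrow> real \<Rightarrow> real \<Rightarrow> real" where "U i t = (deriv ^^ i) (u t)"

definition Q :: "nat \<Rightarrow> real \<Rightarrow> real \<Rightarrow> real" where "Q i t = (deriv ^^ i) (soliton_sum p N c x0 t)"

lemma c_le: "j \<in> {1..N} \<Longrightarrow> c 1 \<le> c j" "j \<in> {1..N} \<Longrightarrow> c j \<le> c N"
  using strict_mono_on_leD[OF c_mono, of 1 j] strict_mono_on_leD[OF c_mono, of j N] N by auto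

lemma c1_pos: "0 < c 1" using c_pos[of 1] N by simp

lemma \<kappa>_pos: "0 < \<kappa>" using c1_pos by (simp add: \<kappa>_def)

lemma \<kappa>_le: "j \<in> {1..N} \<Longrightarrow> \<kappa> \<le> sqrt (c j)"
proof -
  assume "j \<in> {1..N}"
  hence "sqrt (c 1) \<le> sqrt (c j)" by (intro real_sqrt_le_mono c_le)
  moreover have "0 \<le> sqrt (c 1)" using c1_pos by simp
  ultimately show ?thesis unfolding \<kappa>_def by linarith
qed

lemma E_pos: "0 < E j t x" and E_le_1: "E j t x \<le> 1"
  using \<kappa>_pos by (auto simp: E_def)

lemma integral_E: "integrable lborel (E j t)" "(LINT x|lborel. E j t x) = (LINT x|lborel. exp (- \<kappa> * \<bar>x\<bar>))"
  unfolding E_def[abs_def] using exp_minus_abs_shift[OF \<kappa>_pos, of "c j * t"] by auto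

lemma sum_E_nonneg: "0 \<le> (\<Sum>j=1..N. E j t x)"
  by (intro sum_nonneg less_imp_le E_pos)

lemma sum_E_le: "(\<Sum>j=1..N. E j t x) \<le> real N"
  using sum_bounded_above[of "{1..N}" "\<lambda>j. E j t x" 1] E_le_1 by simp

lemma sum_E_square_le: "(\<Sum>j=1..N. E j t x)\<^sup>2 \<le> real N * (\<Sum>j=1..N. E j t x)"
  unfolding power2_eq_square by (intro mult_right_mono sum_E_le sum_E_nonneg)

lemma Q_bound: "\<exists>C>0. \<forall>t x. \<bar>Q i t x\<bar> \<le> C * (\<Sum>j=1..N. E j t x)"
proof (rule soliton_sum_funpow_deriv_bound[where p=p and N=N and c=c and k=\<kappa> and s=i and y=x0])
  fix C assume "C > 0" "\<And>t x. \<bar>(deriv ^^ i) (soliton_sum p N c x0 t) x\<bar> \<le> C * (\<Sum>j=1..N. exp (- \<kappa> * \<bar>x - c j * t\<bar>))"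
  thus ?thesis unfolding Q_def E_def by blast
qed (rule p c_pos \<kappa>_le less_imp_le[OF \<kappa>_pos]; assumption?)+

lemma Q_smooth: "smooth (soliton_sum p N c x0 t)"
  by (rule smooth_soliton_sum[OF p])

lemma Q_continuous: "continuous_on A (Q i t)"
  unfolding Q_def by (rule smooth_continuous[OF Q_smooth])

text \<open>The square of the sum of envelopes is at most N times the sum, and by translation each
  envelope has the same integral at all times.\<close>

lemma Q_square_integral:
  shows "L2 (Q i t)" "\<exists>K\<ge>0. \<forall>t. (LINT x|lborel. (Q i t x)\<^sup>2) \<le> K"
proof -
  obtain C where C: "C > 0" "\<And>t x. \<bar>Q i t x\<bar> \<le> C * (\<Sum>j=1..N. E j t x)" using Q_bound by blast
  have le: "(Q i t x)\<^sup>2 \<le> C\<^sup>2 * real N * (\<Sum>j=1..N. E j t x)" for t x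
  proof -
    have "\<bar>Q i t x\<bar>\<^sup>2 \<le> (C * (\<Sum>j=1..N. E j t x))\<^sup>2" using C by (intro power_mono) auto
    also have "\<dots> \<le> C\<^sup>2 * (real N * (\<Sum>j=1..N. E j t x))"
      unfolding power_mult_distrib by (intro mult_left_mono sum_E_square_le) auto
    finally show ?thesis by (simp add: mult.assoc)
  qed
  have iE: "integrable lborel (\<lambda>x. C\<^sup>2 * real N * (\<Sum>j=1..N. E j t x))" for t
    by (intro integrable_mult_right Bochner_Integration.integrable_sum integral_E)
  have m: "Q i t \<in> borel_measurable lborel" for t using Q_continuous by (simp add: borel_measurable_continuous_onI)
  have iQ: "integrable lborel (\<lambda>x. (Q i t x)\<^sup>2)" for t
    by (rule Bochner_Integration.integrable_bound[OF iE[of t]]) (use m order_trans[OF le abs_ge_self] in auto)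
  show "L2 (Q i t)" using m iQ by (simp add: L2_def)
  have "(LINT x|lborel. (Q i t x)\<^sup>2) \<le> C\<^sup>2 * real N * (\<Sum>j=1..N. LINT x|lborel. exp (- \<kappa> * \<bar>x\<bar>))" for t
  proof -
    have "(LINT x|lborel. (Q i t x)\<^sup>2) \<le> (LINT x|lborel. C\<^sup>2 * real N * (\<Sum>j=1..N. E j t x))"
      by (intro integral_mono iQ iE le)
    also have "\<dots> = C\<^sup>2 * real N * (\<Sum>j=1..N. LINT x|lborel. exp (- \<kappa> * \<bar>x\<bar>))"
      by (simp add: integral_E Bochner_Integration.integral_sum)
    finally show ?thesis .
  qed
  moreover have "0 \<le> C\<^sup>2 * real N * (\<Sum>j=1..N. LINT x|lborel. exp (- \<kappa> * \<bar>x\<bar>))"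
    by (intro mult_nonneg_nonneg sum_nonneg) auto
  ultimately show "\<exists>K\<ge>0. \<forall>t. (LINT x|lborel. (Q i t x)\<^sup>2) \<le> K" by blast
qed

section \<open>The multi-soliton as a classical solution\<close>

lemma u_sobolev_at: "T0 \<le> t \<Longrightarrow> sobolev s (u t)"
  using u_sobolev by (simp add: continuous_in_sobolev_def)

lemma u_smooth: "T0 \<le> t \<Longrightarrow> smooth (u t)" and U_L2: "T0 \<le> t \<Longrightarrow> L2 (U i t)"
  unfolding U_def using sobolev_regularity(1,2)[OF u_cont u_sobolev_at] by auto

lemma U_DERIV: "T0 \<le> t \<Longrightarrow> (U i t has_real_derivative U (Suc i) t x) (at x)"
  unfolding U_def by (rule smooth_DERIV[OF u_smooth])

lemma U_continuous: "T0 \<le> t \<Longrightarrow> continuous_on A (U i t)"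
  unfolding U_def by (rule smooth_continuous[OF u_smooth])

text \<open>The pointwise bound costs one derivative, hence \<open>Suc i\<close>. This is harmless
  since the rate \<theta> is the same in every Sobolev norm and only the constant changes.\<close>

lemma difference:
  assumes t: "T0 \<le> t"
  shows difference_pointwise: "\<bar>U i t x - Q i t x\<bar> \<le> 2 * \<Lambda> (Suc i) * exp (- \<theta> * t)"
    and difference_L2: "L2 (\<lambda>x. U i t x - Q i t x)" "(LINT x|lborel. (U i t x - Q i t x)\<^sup>2) \<le> (\<Lambda> i * exp (- \<theta> * t))\<^sup>2"
proof -
  let ?d = "\<lambda>x. u t x - soliton_sum p N c x0 t x"
  have d: "(deriv ^^ i) ?d = (\<lambda>x. U i t x - Q i t x)"
    unfolding U_def Q_def by (rule smooth_diff(2)[OF u_smooth[OF t] Q_smooth])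
  have cd: "continuous_on UNIV ?d" by (rule smooth_continuous0[OF smooth_diff(1)[OF u_smooth[OF t] Q_smooth]])
  have sd: "sobolev s ?d" for s
    by (intro sobolev_diff u_sobolev_at t sobolev_if_smooth_L2 Q_smooth) (use Q_square_integral(1) in \<open>simp add: Q_def\<close>)
  show "\<bar>U i t x - Q i t x\<bar> \<le> 2 * \<Lambda> (Suc i) * exp (- \<theta> * t)"
    using sobolev_pointwise[OF cd sd, of i x] close[OF t, of "Suc i"] by (simp add: d)
  show "L2 (\<lambda>x. U i t x - Q i t x)" using sobolev_regularity(2)[OF cd sd, of i] by (simp add: d)
  have "0 \<le> sobolev_norm i ?d" unfolding sobolev_norm_def by (intro real_sqrt_ge_zero sum_nonneg) auto
  hence "(sobolev_norm i ?d)\<^sup>2 \<le> (\<Lambda> i * exp (- \<theta> * t))\<^sup>2" by (intro power_mono close t)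
  thus "(LINT x|lborel. (U i t x - Q i t x)\<^sup>2) \<le> (\<Lambda> i * exp (- \<theta> * t))\<^sup>2"
    using sobolev_regularity(3)[OF cd sd, of i i] by (simp add: d)
qed

lemma U_pointwise: "\<exists>C>0. \<forall>t\<ge>T0. \<forall>x. \<bar>U i t x\<bar> \<le> C * ((\<Sum>j=1..N. E j t x) + exp (- \<theta> * t))"
proof -
  obtain C where C: "C > 0" "\<And>t x. \<bar>Q i t x\<bar> \<le> C * (\<Sum>j=1..N. E j t x)" using Q_bound by blast
  define D where "D = C + 2 * \<Lambda> (Suc i)"
  have "\<bar>U i t x\<bar> \<le> D * ((\<Sum>j=1..N. E j t x) + exp (- \<theta> * t))" if t: "T0 \<le> t" for t x
  proof -
    have "\<bar>U i t x\<bar> \<le> \<bar>Q i t x\<bar> + \<bar>U i t x - Q i t x\<bar>" by linarith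
    also have "\<dots> \<le> C * (\<Sum>j=1..N. E j t x) + 2 * \<Lambda> (Suc i) * exp (- \<theta> * t)"
      by (intro add_mono C difference_pointwise t)
    also have "\<dots> \<le> D * (\<Sum>j=1..N. E j t x) + D * exp (- \<theta> * t)"
      using C(1) \<Lambda>[of "Suc i"] sum_E_nonneg[of t x] by (intro add_mono mult_right_mono) (auto simp: D_def)
    finally show ?thesis by (simp add: ring_distribs)
  qed
  moreover have "D > 0" using C(1) \<Lambda>[of "Suc i"] by (simp add: D_def)
  ultimately show ?thesis by blast
qed

text \<open>Continuity in time with values in the Sobolev space of order i + 1 gives convergence of
  the i-th derivative uniformly in x; continuity in x at the one time \<open>t\<close> then
  suffices.\<close>

lemma U_joint_continuous: "continuous_on ({T0..} \<times> UNIV) (\<lambda>z. U i (fst z) (snd z))"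
  unfolding continuous_on_iff
proof (intro ballI allI impI)
  fix z :: "real \<times> real" and e :: real assume z: "z \<in> {T0..} \<times> UNIV" and e: "0 < e"
  obtain t x where tx: "z = (t, x)" by (cases z)
  have t: "T0 \<le> t" using z tx by simp
  have "((\<lambda>\<tau>. sobolev_norm (Suc i) (\<lambda>x. u \<tau> x - u t x)) \<longlongrightarrow> 0) (at t within {T0..})"
    using u_sobolev[of "Suc i"] t by (simp add: continuous_in_sobolev_def)
  from tendstoD[OF this, of "e / 4"] e obtain d1 where d1: "d1 > 0"
    "\<And>\<tau>. T0 \<le> \<tau> \<Longrightarrow> \<tau> \<noteq> t \<Longrightarrow> dist \<tau> t < d1 \<Longrightarrow> \<bar>sobolev_norm (Suc i) (\<lambda>x. u \<tau> x - u t x)\<bar> < e / 4"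
    by (auto simp: eventually_at)
  have "continuous_on UNIV (U i t)" by (rule U_continuous[OF t])
  then obtain d2 where d2: "d2 > 0" "\<And>y. dist y x < d2 \<Longrightarrow> dist (U i t y) (U i t x) < e / 2"
    using e unfolding continuous_on_iff by (metis UNIV_I half_gt_zero)
  have close_t: "\<bar>U i \<tau> y - U i t y\<bar> < e / 2" if \<tau>: "T0 \<le> \<tau>" "dist \<tau> t < d1" for \<tau> y
  proof (cases "\<tau> = t")
    case False
    let ?d = "\<lambda>x. u \<tau> x - u t x"
    have "\<bar>(deriv ^^ i) ?d y\<bar> \<le> 2 * sobolev_norm (Suc i) ?d"
      by (intro sobolev_pointwise smooth_continuous0 smooth_diff(1) u_smooth sobolev_diff u_sobolev_at t \<tau>)
    also have "(deriv ^^ i) ?d y = U i \<tau> y - U i t y"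
      unfolding U_def using smooth_diff(2)[OF u_smooth[OF \<tau>(1)] u_smooth[OF t], of i] by simp
    finally show ?thesis using d1(2)[OF \<tau>(1) False \<tau>(2)] by linarith
  qed (use e in simp)
  show "\<exists>d>0. \<forall>z'\<in>{T0..} \<times> UNIV. dist z' z < d \<longrightarrow> dist (U i (fst z') (snd z')) (U i (fst z) (snd z)) < e"
  proof (intro exI[of _ "min d1 d2"] conjI ballI impI)
    fix z' :: "real \<times> real" assume z': "z' \<in> {T0..} \<times> UNIV" "dist z' z < min d1 d2"
    have "dist (fst z') t < d1" "dist (snd z') x < d2"
      using z'(2) dist_fst_le[of z' z] dist_snd_le[of z' z] tx by auto
    hence "\<bar>U i (fst z') (snd z') - U i t (snd z')\<bar> < e / 2" "dist (U i t (snd z')) (U i t x) < e / 2"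
      using close_t d2(2) z'(1) by auto
    thus "dist (U i (fst z') (snd z')) (U i (fst z) (snd z)) < e" 
      using dist_triangle[of "U i (fst z') (snd z')" "U i t x" "U i t (snd z')"]
      unfolding tx fst_conv snd_conv dist_real_def by linarith
  qed (use d1 d2 in auto)
qed

text \<open>The weak equation is tested with the i-th derivative of \<open>\<phi>\<close>, and all
  derivatives are moved back to the smooth function \<open>u t\<close>. The resulting weak equation
  for \<open>U i\<close> has continuous coefficients and so holds pointwise.\<close>

lemma U_pde:
  assumes t: "T0 \<le> t"
  shows "((\<lambda>\<tau>. U i \<tau> x) has_real_derivative
        - U (i + 3) t x - (deriv ^^ Suc i) (\<lambda>x. U 0 t x ^ p) x) (at t within {T0..})"
proof (rule pointwise_time_derivative[where G="\<lambda>t x. - U (i + 3) t x - (deriv ^^ Suc i) (\<lambda>x. U 0 t x ^ p) x", OF _ _ _ t])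
  show "continuous_on UNIV (U i t)" if "T0 \<le> t" for t by (rule U_continuous[OF that])
  obtain P where P: "jetpoly i P" "\<And>F. (\<forall>i x. (F i has_real_derivative F (Suc i) x) (at x)) \<Longrightarrow>
    (deriv ^^ Suc i) (\<lambda>x. F 0 x ^ p) = (\<lambda>x. real p * F 0 x ^ (p - 1) * F (Suc i) x + P (\<lambda>i. F i x))"
    using funpow_deriv_power[OF p, of i] by blast
  have eq: "(deriv ^^ Suc i) (\<lambda>x. U 0 t x ^ p) x = real p * U 0 t x ^ (p - 1) * U (Suc i) t x + P (\<lambda>i. U i t x)"
    if "T0 \<le> t" for t x
    using P(2)[of "\<lambda>i. U i t"] U_DERIV[OF that] by simp
  have "continuous_on ({T0..} \<times> UNIV) (\<lambda>z. - U (i + 3) (fst z) (snd z)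
      - (real p * U 0 (fst z) (snd z) ^ (p - 1) * U (Suc i) (fst z) (snd z) + P (\<lambda>i. U i (fst z) (snd z))))"
    by (intro continuous_intros U_joint_continuous jetpoly_continuous_on[OF P(1), of _ "\<lambda>i z. U i (fst z) (snd z)"])
  thus "continuous_on ({T0..} \<times> UNIV) (\<lambda>z. - U (i + 3) (fst z) (snd z) - (deriv ^^ Suc i) (\<lambda>x. U 0 (fst z) x ^ p) (snd z))"
    by (rule continuous_on_eq) (auto simp: eq simp del: funpow.simps)
  fix \<phi> t assume \<phi>: "test_function \<phi>" and t: "T0 \<le> t"
  let ?\<psi> = "(deriv ^^ i) \<phi>"
  have \<psi>: "test_function ?\<psi>" by (rule test_function_funpow_deriv[OF \<phi>])
  have parts: "(LINT x|lborel. f x * ?\<psi> x) = (-1) ^ i * (LINT x|lborel. (deriv ^^ i) f x * \<phi> x)" if "smooth f" for f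
    by (rule integral_by_parts_test_funpow[OF that \<phi>])
  have su: "smooth (u t)" by (rule u_smooth[OF t])
  have sp: "smooth (\<lambda>x. u t x ^ p)" by (rule smooth_power[OF su])
  have "((\<lambda>\<tau>. LINT x|lborel. u \<tau> x * ?\<psi> x) has_real_derivative
          (LINT x|lborel. u t x * (deriv ^^ 3) ?\<psi> x + u t x ^ p * deriv ?\<psi> x)) (at t within {T0..})"
    using solution \<psi> t unfolding H1_solution_def by auto
  hence "((\<lambda>\<tau>. (-1) ^ i * (LINT x|lborel. u \<tau> x * ?\<psi> x)) has_real_derivative
          (-1) ^ i * (LINT x|lborel. u t x * (deriv ^^ 3) ?\<psi> x + u t x ^ p * deriv ?\<psi> x)) (at t within {T0..})"
    by (rule DERIV_cmult)
  moreover have "(-1) ^ i * (LINT x|lborel. u \<tau> x * ?\<psi> x) = (LINT x|lborel. U i \<tau> x * \<phi> x)" if "T0 \<le> \<tau>" for \<tau>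
    using parts[OF u_smooth[OF that]] by (simp add: U_def flip: power_mult_distrib mult.assoc)
  moreover have "(-1) ^ i * (LINT x|lborel. u t x * (deriv ^^ 3) ?\<psi> x + u t x ^ p * deriv ?\<psi> x)
      = (LINT x|lborel. (- U (i + 3) t x - (deriv ^^ Suc i) (\<lambda>x. U 0 t x ^ p) x) * \<phi> x)"
  proof -
    have i1: "integrable lborel (\<lambda>x. u t x * (deriv ^^ 3) ?\<psi> x)" "integrable lborel (\<lambda>x. u t x ^ p * deriv ?\<psi> x)"
      by (intro integrable_test_mult test_function_funpow_deriv test_function_deriv \<psi> smooth_continuous0 su sp)+
    have i2: "integrable lborel (\<lambda>x. U (i + 3) t x * \<phi> x)" "integrable lborel (\<lambda>x. (deriv ^^ Suc i) (\<lambda>x. u t x ^ p) x * \<phi> x)"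
      by (intro integrable_test_mult \<phi> U_continuous t smooth_continuous[OF sp])+
    have "(LINT x|lborel. u t x * (deriv ^^ 3) ?\<psi> x) = - (LINT x|lborel. (deriv ^^ 3) (u t) x * ?\<psi> x)"
      using integral_by_parts_test_funpow[OF su \<psi>, of 3] by simp
    also have "\<dots> = - ((-1) ^ i * (LINT x|lborel. U (i + 3) t x * \<phi> x))"
      using parts[OF smooth_funpow_deriv[OF su, of 3]] by (simp add: U_def funpow_add)
    finally have 1: "(LINT x|lborel. u t x * (deriv ^^ 3) ?\<psi> x) = - ((-1) ^ i * (LINT x|lborel. U (i + 3) t x * \<phi> x))" .
    have "(LINT x|lborel. u t x ^ p * deriv ?\<psi> x) = - (LINT x|lborel. deriv (\<lambda>x. u t x ^ p) x * ?\<psi> x)"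
      using integral_by_parts_test_funpow[OF sp \<psi>, of 1] by simp
    also have "\<dots> = - ((-1) ^ i * (LINT x|lborel. (deriv ^^ Suc i) (\<lambda>x. u t x ^ p) x * \<phi> x))"
      using parts[OF smooth_deriv[OF sp]] by (simp only: deriv_funpow_deriv)
    finally have 2: "(LINT x|lborel. u t x ^ p * deriv ?\<psi> x) = - ((-1) ^ i * (LINT x|lborel. (deriv ^^ Suc i) (\<lambda>x. u t x ^ p) x * \<phi> x))" .
    \<comment> \<open>The sign from moving i derivatives occurs on both sides of the equation and
      cancels.\<close>
    have s1: "(-1) ^ i * ((-1) ^ i * y) = (y :: real)" for y by (simp flip: power_mult_distrib mult.assoc)
    have U0: "U 0 t = u t" by (simp add: U_def)
    have "(-1) ^ i * (LINT x|lborel. u t x * (deriv ^^ 3) ?\<psi> x + u t x ^ p * deriv ?\<psi> x)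
        = - (LINT x|lborel. U (i + 3) t x * \<phi> x) - (LINT x|lborel. (deriv ^^ Suc i) (\<lambda>x. u t x ^ p) x * \<phi> x)"
      using i1 by (simp add: 1 2 s1 ring_distribs del: funpow.simps)
    also have "\<dots> = (LINT x|lborel. (- U (i + 3) t x - (deriv ^^ Suc i) (\<lambda>x. u t x ^ p) x) * \<phi> x)"
      using i2 by (simp add: left_diff_distrib del: funpow.simps)
    finally show ?thesis unfolding U0 .
  qed
  ultimately show "((\<lambda>\<tau>. LINT x|lborel. U i \<tau> x * \<phi> x) has_real_derivative
     (LINT x|lborel. (- U (i + 3) t x - (deriv ^^ Suc i) (\<lambda>x. U 0 t x ^ p) x) * \<phi> x)) (at t within {T0..})"
    using has_field_derivative_transform_within[of "\<lambda>\<tau>. (-1) ^ i * (LINT x|lborel. u \<tau> x * ?\<psi> x)" _ t "{T0..}" 1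
        "\<lambda>\<tau>. LINT x|lborel. U i \<tau> x * \<phi> x"] t by (simp del: funpow.simps)
qed

sublocale gkdv_flow p U T0
proof
  show "2 \<le> p" by (rule p)
  fix i
  show "\<And>t x. T0 \<le> t \<Longrightarrow> (U i t has_real_derivative U (Suc i) t x) (at x)" by (rule U_DERIV)
  show "continuous_on ({T0..} \<times> UNIV) (\<lambda>z. U i (fst z) (snd z))" by (rule U_joint_continuous)
  show "\<And>t. T0 \<le> t \<Longrightarrow> L2 (U i t)" by (rule U_L2)
  show "\<And>t x. T0 \<le> t \<Longrightarrow> ((\<lambda>\<tau>. U i \<tau> x) has_real_derivative
        - U (i + 3) t x - (deriv ^^ Suc i) (\<lambda>x. U 0 t x ^ p) x) (at t within {T0..})" by (rule U_pde)
  have e1: "exp (- \<theta> * t) \<le> 1" if "T0 \<le> t" for t using that T0 \<theta> by simp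
  obtain C where C: "C > 0" "\<And>t x. T0 \<le> t \<Longrightarrow> \<bar>U i t x\<bar> \<le> C * ((\<Sum>j=1..N. E j t x) + exp (- \<theta> * t))"
    using U_pointwise by blast
  have "\<bar>U i t x\<bar> \<le> C * (real N + 1)" if t: "T0 \<le> t" for t x
    by (rule order_trans[OF C(2)[OF t] mult_left_mono[OF add_mono[OF sum_E_le e1[OF t]]]]) (use C in auto)
  thus "\<exists>K. \<forall>t\<ge>T0. \<forall>x. \<bar>U i t x\<bar> \<le> K" by blast
  obtain K where K: "K \<ge> 0" "\<And>t. (LINT x|lborel. (Q i t x)\<^sup>2) \<le> K" using Q_square_integral(2) by blast
  have "(LINT x|lborel. (U i t x)\<^sup>2) \<le> 2 * (\<Lambda> i)\<^sup>2 + 2 * K" if t: "T0 \<le> t" for t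
  proof -
    have id: "integrable lborel (\<lambda>x. (U i t x - Q i t x)\<^sup>2)" "integrable lborel (\<lambda>x. (Q i t x)\<^sup>2)" "integrable lborel (\<lambda>x. (U i t x)\<^sup>2)"
      using difference_L2(1)[OF t, of i] Q_square_integral(1)[of i t] U_L2[OF t, of i] by (auto simp: L2_def)
    have "(LINT x|lborel. (U i t x)\<^sup>2) \<le> (LINT x|lborel. 2 * (U i t x - Q i t x)\<^sup>2 + 2 * (Q i t x)\<^sup>2)"
    proof (rule integral_mono)
      fix x show "(U i t x)\<^sup>2 \<le> 2 * (U i t x - Q i t x)\<^sup>2 + 2 * (Q i t x)\<^sup>2"
        \<comment> \<open>The difference of the two sides is exactly this square.\<close>
        using zero_le_power2[of "U i t x - 2 * Q i t x"] by (simp add: power2_eq_square algebra_simps)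
    qed (use id in auto)
    also have "\<dots> = 2 * (LINT x|lborel. (U i t x - Q i t x)\<^sup>2) + 2 * (LINT x|lborel. (Q i t x)\<^sup>2)" using id by simp
    also have "\<dots> \<le> 2 * (\<Lambda> i * exp (- \<theta> * t))\<^sup>2 + 2 * K"
      by (intro add_mono mult_left_mono difference_L2 t K) auto
    also have "(\<Lambda> i * exp (- \<theta> * t))\<^sup>2 \<le> (\<Lambda> i)\<^sup>2"
      using e1[OF t] \<Lambda>[of i] by (intro power_mono mult_left_le) auto
    finally show ?thesis by simp
  qed
  thus "\<exists>K. \<forall>t\<ge>T0. (LINT x|lborel. (U i t x)\<^sup>2) \<le> K" by blast
qed

end

section \<open>Logistic weights\<close>

text \<open>With b the logistic function, its derivatives are polynomials in b with the factor b (1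
  - b). Hence the first is at most k times b and the third at most the square of k times the first,
  which are the two inequalities the energy method demands of a weight.\<close>

definition logistic :: "real \<Rightarrow> real \<Rightarrow> real" where "logistic k z = 1 / (1 + exp (- k * z))"

definition logistic1 :: "real \<Rightarrow> real \<Rightarrow> real" where
  "logistic1 k z = k * (logistic k z * (1 - logistic k z))"

definition logistic2 :: "real \<Rightarrow> real \<Rightarrow> real" where
  "logistic2 k z = k\<^sup>2 * (logistic k z * (1 - logistic k z) * (1 - 2 * logistic k z))"

definition logistic3 :: "real \<Rightarrow> real \<Rightarrow> real" where
  "logistic3 k z = k ^ 3 * (logistic k z * (1 - logistic k z) * (1 - 6 * logistic k z + 6 * (logistic k z)\<^sup>2))"

text \<open>An antiderivative of \<open>logistic k\<close>; it is the means to average translates of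
  the logistic weight.\<close>

definition softplus :: "real \<Rightarrow> real \<Rightarrow> real" where "softplus k z = ln (1 + exp (k * z)) / k"

lemma logistic_pos: "0 < logistic k z" and logistic_less_1: "logistic k z < 1"
  by (auto simp: logistic_def add_pos_pos)

lemma logistic_eq: "logistic k z = exp (k * z) / (1 + exp (k * z))"
proof -
  have "1 + exp (- k * z) = (1 + exp (k * z)) / exp (k * z)" by (simp add: exp_minus field_simps)
  thus ?thesis by (simp add: logistic_def)
qed

lemma logistic_le_exp: "logistic k z \<le> exp (k * z)"
  unfolding logistic_eq by (rule mult_imp_div_pos_le) (auto simp: add_pos_pos algebra_simps)

lemma logistic_0: "logistic k 0 = 1 / 2"
  by (simp add: logistic_def)

lemma logistic_mono: "0 \<le> k \<Longrightarrow> x \<le> y \<Longrightarrow> logistic k x \<le> logistic k y"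
  unfolding logistic_def by (intro divide_left_mono) (auto simp: add_pos_pos mult_left_mono)

lemma logistic_DERIV: "(logistic k has_real_derivative logistic1 k z) (at z)"
proof -
  have p: "1 + exp (- k * z) \<noteq> 0" using exp_gt_zero[of "- k * z"] by linarith
  have "(logistic k has_real_derivative - (- k * exp (- k * z)) / (1 + exp (- k * z))\<^sup>2) (at z)"
    unfolding logistic_def[abs_def] using p by (auto intro!: derivative_eq_intros simp: power2_eq_square)
  moreover have "logistic1 k z = - (- k * exp (- k * z)) / (1 + exp (- k * z))\<^sup>2"
    unfolding logistic1_def logistic_def using p by (simp add: field_simps power2_eq_square)
  ultimately show ?thesis by simp
qed

lemma logistic1_DERIV: "(logistic1 k has_real_derivative logistic2 k z) (at z)"
  unfolding logistic1_def[abs_def]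
  by (rule DERIV_cong, (rule derivative_eq_intros logistic_DERIV refl)+)
    (simp add: logistic1_def logistic2_def power2_eq_square algebra_simps)

lemma logistic2_DERIV: "(logistic2 k has_real_derivative logistic3 k z) (at z)"
  unfolding logistic2_def[abs_def]
  by (rule DERIV_cong, (rule derivative_eq_intros logistic_DERIV refl)+)
    (simp add: logistic1_def logistic3_def power2_eq_square power3_eq_cube algebra_simps)

lemma logistic_continuous: "continuous_on A (logistic k)" "continuous_on A (logistic1 k)"
    "continuous_on A (logistic2 k)" "continuous_on A (logistic3 k)"
proof -
  show c: "continuous_on A (logistic k)" by (rule DERIV_continuous_on, rule has_field_derivative_at_within[OF logistic_DERIV])
  show "continuous_on A (logistic1 k)" "continuous_on A (logistic2 k)" "continuous_on A (logistic3 k)"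
    unfolding logistic1_def[abs_def] logistic2_def[abs_def] logistic3_def[abs_def] by (intro continuous_intros c)+
qed

context
  fixes k :: real
  assumes k: "0 \<le> k"
begin

lemma logistic1_nonneg: "0 \<le> logistic1 k z" and logistic1_le: "logistic1 k z \<le> k * logistic k z"
  unfolding logistic1_def using logistic_pos[of k z] logistic_less_1[of k z] k
  by (auto intro!: mult_left_mono mult_left_le)

lemma logistic2_le: "\<bar>logistic2 k z\<bar> \<le> k\<^sup>2 * logistic k z"
proof -
  have "\<bar>(1 - logistic k z) * (1 - 2 * logistic k z)\<bar> \<le> 1 * 1"
    unfolding abs_mult using logistic_pos[of k z] logistic_less_1[of k z] by (intro mult_mono) auto
  hence "\<bar>logistic2 k z\<bar> \<le> k\<^sup>2 * (logistic k z * 1)"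
    unfolding logistic2_def abs_mult mult.assoc using logistic_pos[of k z] by (intro mult_mono) auto
  thus ?thesis by simp
qed

text \<open>The last factor is 1 - 6 b (1 - b), and b (1 - b) lies between 0 and 1/4, so the factor
  lies between -1/2 and 1.\<close>

lemma logistic3_le: "\<bar>logistic3 k z\<bar> \<le> k\<^sup>2 * logistic1 k z"
proof -
  define b where "b = logistic k z"
  have b: "0 < b" "b < 1" using logistic_pos logistic_less_1 by (auto simp: b_def)
  have q: "0 \<le> b * (1 - b)" using b by simp
  have "b * (1 - b) \<le> 1 / 4" using zero_le_power2[of "b - 1/2"] by (simp add: power2_eq_square algebra_simps)
  hence "\<bar>1 - 6 * b + 6 * b\<^sup>2\<bar> \<le> 1" using q by (simp add: power2_eq_square algebra_simps abs_le_iff)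
  hence "\<bar>logistic3 k z\<bar> \<le> k ^ 3 * (b * (1 - b) * 1)"
    unfolding logistic3_def b_def[symmetric] abs_mult using b k by (intro mult_mono) auto
  also have "\<dots> = k\<^sup>2 * logistic1 k z" by (simp add: logistic1_def b_def power2_eq_square power3_eq_cube)
  finally show ?thesis .
qed

lemma logistic_bounds: "\<bar>logistic k z\<bar> \<le> 1" "\<bar>logistic1 k z\<bar> \<le> k" "\<bar>logistic2 k z\<bar> \<le> k\<^sup>2" "\<bar>logistic3 k z\<bar> \<le> k\<^sup>2 * k"
proof -
  have l: "0 < logistic k z" "logistic k z \<le> 1" using logistic_pos logistic_less_1 by (auto simp: less_imp_le)
  show "\<bar>logistic k z\<bar> \<le> 1" using l by simp
  show 1: "\<bar>logistic1 k z\<bar> \<le> k"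
    using logistic1_nonneg[of z] order_trans[OF logistic1_le mult_left_mono[OF l(2) k]] by simp
  show "\<bar>logistic2 k z\<bar> \<le> k\<^sup>2" using order_trans[OF logistic2_le mult_left_mono[OF l(2), of "k\<^sup>2"]] by simp
  show "\<bar>logistic3 k z\<bar> \<le> k\<^sup>2 * k"
    using order_trans[OF logistic3_le mult_left_mono[of "logistic1 k z" k "k\<^sup>2"]] 1 by simp
qed

end

lemma softplus_DERIV: "k > 0 \<Longrightarrow> (softplus k has_real_derivative logistic k z) (at z)"
  unfolding softplus_def[abs_def] logistic_eq
  by (auto intro!: derivative_eq_intros simp: add_pos_pos)

lemma weight_logistic:
  assumes k: "0 \<le> k"
  shows "weight (\<lambda>y. logistic k (y - Y)) (\<lambda>y. logistic1 k (y - Y)) (\<lambda>y. logistic2 k (y - Y)) (\<lambda>y. logistic3 k (y - Y))"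
  unfolding weight_def
proof (intro conjI allI)
  have d: "((\<lambda>y. y - Y) has_real_derivative 1) (at x)" for x :: real by (auto intro!: derivative_eq_intros)
  show "((\<lambda>y. logistic k (y - Y)) has_real_derivative logistic1 k (x - Y)) (at x)" for x
    using DERIV_chain2[OF logistic_DERIV d] by simp
  show "((\<lambda>y. logistic1 k (y - Y)) has_real_derivative logistic2 k (x - Y)) (at x)" for x
    using DERIV_chain2[OF logistic1_DERIV d] by simp
  show "((\<lambda>y. logistic2 k (y - Y)) has_real_derivative logistic3 k (x - Y)) (at x)" for x
    using DERIV_chain2[OF logistic2_DERIV d] by simp
  show "continuous_on UNIV (\<lambda>y. logistic3 k (y - Y))"
    by (rule continuous_on_compose2[OF logistic_continuous(4)[of UNIV]]) (auto intro!: continuous_intros)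
  show "\<exists>W. \<forall>x. \<bar>logistic k (x - Y)\<bar> \<le> W \<and> \<bar>logistic1 k (x - Y)\<bar> \<le> W \<and> \<bar>logistic2 k (x - Y)\<bar> \<le> W \<and> \<bar>logistic3 k (x - Y)\<bar> \<le> W"
    using logistic_bounds[OF k] k
    by (intro exI[of _ "1 + k + k\<^sup>2 + k\<^sup>2 * k"]) (auto simp: add_increasing add_increasing2)
qed

text \<open>Reflection makes the weight decreasing in y, and each differentiation brings one
  sign.\<close>

lemma weight_left:
  assumes k: "0 \<le> k"
  shows "weight (\<lambda>y. logistic k (- y - Y)) (\<lambda>y. - logistic1 k (- y - Y)) (\<lambda>y. logistic2 k (- y - Y)) (\<lambda>y. - logistic3 k (- y - Y))"
  unfolding weight_def
proof (intro conjI allI)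
  have d: "((\<lambda>y. - y - Y) has_real_derivative -1) (at x)" for x :: real by (auto intro!: derivative_eq_intros)
  show "((\<lambda>y. logistic k (- y - Y)) has_real_derivative - logistic1 k (- x - Y)) (at x)" for x
    using DERIV_chain2[OF logistic_DERIV d] by simp
  show "((\<lambda>y. - logistic1 k (- y - Y)) has_real_derivative logistic2 k (- x - Y)) (at x)" for x
    using DERIV_minus[OF DERIV_chain2[OF logistic1_DERIV d]] by simp
  show "((\<lambda>y. logistic2 k (- y - Y)) has_real_derivative - logistic3 k (- x - Y)) (at x)" for x
    using DERIV_chain2[OF logistic2_DERIV d] by simp
  show "continuous_on UNIV (\<lambda>y. - logistic3 k (- y - Y))"
    by (intro continuous_on_minus continuous_on_compose2[OF logistic_continuous(4)[of UNIV]]) (auto intro!: continuous_intros)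
  show "\<exists>W. \<forall>x. \<bar>logistic k (- x - Y)\<bar> \<le> W \<and> \<bar>- logistic1 k (- x - Y)\<bar> \<le> W \<and> \<bar>logistic2 k (- x - Y)\<bar> \<le> W \<and> \<bar>- logistic3 k (- x - Y)\<bar> \<le> W"
    using logistic_bounds[OF k] k
    by (intro exI[of _ "1 + k + k\<^sup>2 + k\<^sup>2 * k"]) (auto simp: add_increasing add_increasing2)
qed

text \<open>The average of \<open>logistic k (z - \<eta>)\<close> over \<open>\<eta> \<in> [Y, 2Y]\<close>: its derivatives gain a factor \<open>1 / Y\<close>.\<close>

definition averaged_logistic :: "real \<Rightarrow> real \<Rightarrow> real \<Rightarrow> real" where
  "averaged_logistic k Y z = (softplus k (z - Y) - softplus k (z - 2 * Y)) / Y"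

context
  fixes k Y :: real
  assumes k: "k > 0" and Y: "Y > 0"
begin

text \<open>By the mean value theorem the difference quotient of \<open>softplus\<close> is a value
  of \<open>logistic k\<close> between the two endpoints.\<close>

lemma averaged_logistic_between: "logistic k (z - 2 * Y) \<le> averaged_logistic k Y z" "averaged_logistic k Y z \<le> logistic k (z - Y)"
proof -
  obtain \<xi> where \<xi>: "z - 2 * Y < \<xi>" "\<xi> < z - Y"
    "softplus k (z - Y) - softplus k (z - 2 * Y) = ((z - Y) - (z - 2 * Y)) * logistic k \<xi>"
    using MVT2[of "z - 2 * Y" "z - Y" "softplus k" "logistic k"] softplus_DERIV[OF k] Y by auto
  hence "averaged_logistic k Y z = logistic k \<xi>" using Y by (simp add: averaged_logistic_def)
  thus "logistic k (z - 2 * Y) \<le> averaged_logistic k Y z" "averaged_logistic k Y z \<le> logistic k (z - Y)"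
    using \<xi> k by (auto intro!: logistic_mono)
qed

lemma averaged_logistic_nonneg: "0 \<le> averaged_logistic k Y z"
  using averaged_logistic_between(1)[of z] logistic_pos[of k "z - 2 * Y"] by linarith

text \<open>The second bound is the gain 1 / Y. The third is the one that weighted estimates ask
  for; it holds because \<open>k * softplus k x - logistic k x\<close> is nondecreasing in
  x.\<close>

lemma averaged_logistic_deriv_le:
  "0 \<le> (logistic k (z - Y) - logistic k (z - 2 * Y)) / Y"
  "(logistic k (z - Y) - logistic k (z - 2 * Y)) / Y \<le> logistic k (z - Y) / Y"
  "(logistic k (z - Y) - logistic k (z - 2 * Y)) / Y \<le> k * averaged_logistic k Y z"
proof -
  have "logistic k (z - 2 * Y) \<le> logistic k (z - Y)" using k Y by (intro logistic_mono) auto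
  thus "0 \<le> (logistic k (z - Y) - logistic k (z - 2 * Y)) / Y" using Y by simp
  show "(logistic k (z - Y) - logistic k (z - 2 * Y)) / Y \<le> logistic k (z - Y) / Y"
    using Y logistic_pos[of k "z - 2 * Y"] by (intro divide_right_mono) auto
  have "k * softplus k (z - 2 * Y) - logistic k (z - 2 * Y) \<le> k * softplus k (z - Y) - logistic k (z - Y)"
  proof (rule DERIV_nonneg_imp_nondecreasing[where f="\<lambda>x. k * softplus k x - logistic k x"])
    show "z - 2 * Y \<le> z - Y" using Y by simp
    fix x
    have "((\<lambda>x. k * softplus k x - logistic k x) has_real_derivative k * logistic k x - logistic1 k x) (at x)"
      by (intro DERIV_diff DERIV_cmult softplus_DERIV logistic_DERIV k)
    thus "\<exists>y. ((\<lambda>x. k * softplus k x - logistic k x) has_real_derivative y) (at x) \<and> 0 \<le> y"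
      using logistic1_le[of k x] k by auto
  qed
  hence "logistic k (z - Y) - logistic k (z - 2 * Y) \<le> k * (softplus k (z - Y) - softplus k (z - 2 * Y))"
    by (simp add: right_diff_distrib)
  from divide_right_mono[OF this, of Y]
  show "(logistic k (z - Y) - logistic k (z - 2 * Y)) / Y \<le> k * averaged_logistic k Y z"
    using Y by (simp add: averaged_logistic_def)
qed

text \<open>The factor 1 / Y is explicit in the formula, so the triangle inequality suffices;
  monotonicity of the logistic function moves both terms to the nearer translate.\<close>

lemma averaged_logistic_deriv3_le:
  "\<bar>(logistic2 k (z - Y) - logistic2 k (z - 2 * Y)) / Y\<bar> \<le> 2 * k\<^sup>2 * logistic k (z - Y) / Y"
proof -
  have "\<bar>logistic2 k (z - Y) - logistic2 k (z - 2 * Y)\<bar> \<le> k\<^sup>2 * logistic k (z - Y) + k\<^sup>2 * logistic k (z - 2 * Y)"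
    using logistic2_le[of k "z - Y"] logistic2_le[of k "z - 2 * Y"] k by linarith
  also have "k\<^sup>2 * logistic k (z - 2 * Y) \<le> k\<^sup>2 * logistic k (z - Y)"
    using k Y by (intro mult_left_mono logistic_mono) auto
  finally have "\<bar>logistic2 k (z - Y) - logistic2 k (z - 2 * Y)\<bar> \<le> 2 * k\<^sup>2 * logistic k (z - Y)" by (simp add: mult_ac)
  from divide_right_mono[OF this, of Y] show ?thesis using Y by simp
qed

lemma weight_right:
  "weight (averaged_logistic k Y) (\<lambda>z. (logistic k (z - Y) - logistic k (z - 2 * Y)) / Y)
    (\<lambda>z. (logistic1 k (z - Y) - logistic1 k (z - 2 * Y)) / Y) (\<lambda>z. (logistic2 k (z - Y) - logistic2 k (z - 2 * Y)) / Y)"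
  unfolding weight_def
proof (intro conjI allI)
  have d: "((\<lambda>z. z - a) has_real_derivative 1) (at x)" for x a :: real by (auto intro!: derivative_eq_intros)
  have D: "((\<lambda>z. (f (z - Y) - f (z - 2 * Y)) / Y) has_real_derivative (g (x - Y) - g (x - 2 * Y)) / Y) (at x)"
    if "\<And>x. (f has_real_derivative g x) (at x)" for f g :: "real \<Rightarrow> real" and x
  proof -
    have "((\<lambda>z. f (z - Y) - f (z - 2 * Y)) has_real_derivative g (x - Y) * 1 - g (x - 2 * Y) * 1) (at x)"
      by (intro DERIV_diff DERIV_chain2[OF that d])
    from DERIV_cdivide[OF this, of Y] show ?thesis by simp
  qed
  show "(averaged_logistic k Y has_real_derivative (logistic k (x - Y) - logistic k (x - 2 * Y)) / Y) (at x)" for x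
    unfolding averaged_logistic_def[abs_def] by (intro D softplus_DERIV k)
  show "((\<lambda>z. (logistic k (z - Y) - logistic k (z - 2 * Y)) / Y) has_real_derivative (logistic1 k (x - Y) - logistic1 k (x - 2 * Y)) / Y) (at x)" for x
    by (intro D logistic_DERIV)
  show "((\<lambda>z. (logistic1 k (z - Y) - logistic1 k (z - 2 * Y)) / Y) has_real_derivative (logistic2 k (x - Y) - logistic2 k (x - 2 * Y)) / Y) (at x)" for x
    by (intro D logistic1_DERIV)
  have "continuous_on UNIV (\<lambda>z. logistic2 k (z - a))" for a
    by (rule continuous_on_compose2[OF logistic_continuous(3)[of UNIV]]) (auto intro!: continuous_intros)
  thus "continuous_on UNIV (\<lambda>z. (logistic2 k (z - Y) - logistic2 k (z - 2 * Y)) / Y)"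
    using Y by (intro continuous_intros) auto
  define W where "W = 1 + 2 * (1 + k + k\<^sup>2) / Y"
  have diff: "\<bar>(a - b) / Y\<bar> \<le> W" if "\<bar>a\<bar> \<le> 1 + k + k\<^sup>2" "\<bar>b\<bar> \<le> 1 + k + k\<^sup>2" for a b :: real
  proof -
    have "\<bar>a - b\<bar> \<le> (1 + k + k\<^sup>2) + (1 + k + k\<^sup>2)" by (rule order_trans[OF abs_triangle_ineq4 add_mono[OF that]])
    hence "\<bar>a - b\<bar> \<le> 2 * (1 + k + k\<^sup>2)" by simp
    hence "\<bar>a - b\<bar> / Y \<le> 2 * (1 + k + k\<^sup>2) / Y" using Y by (intro divide_right_mono) auto
    thus ?thesis using Y by (simp add: W_def)
  qed
  have s: "\<bar>logistic k z\<bar> \<le> 1 + k + k\<^sup>2" "\<bar>logistic1 k z\<bar> \<le> 1 + k + k\<^sup>2" "\<bar>logistic2 k z\<bar> \<le> 1 + k + k\<^sup>2" for z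
    using logistic_bounds[of k z] k zero_le_power2[of k] by linarith+
  have "\<bar>averaged_logistic k Y x\<bar> \<le> W" for x
  proof -
    have "averaged_logistic k Y x \<le> 1" using averaged_logistic_between(2)[of x] logistic_less_1[of k "x - Y"] by linarith
    moreover have "1 \<le> W" using k Y by (simp add: W_def)
    ultimately show ?thesis using averaged_logistic_nonneg[of x] by simp
  qed
  thus "\<exists>W. \<forall>x. \<bar>averaged_logistic k Y x\<bar> \<le> W \<and> \<bar>(logistic k (x - Y) - logistic k (x - 2 * Y)) / Y\<bar> \<le> W \<and>
      \<bar>(logistic1 k (x - Y) - logistic1 k (x - 2 * Y)) / Y\<bar> \<le> W \<and> \<bar>(logistic2 k (x - Y) - logistic2 k (x - 2 * Y)) / Y\<bar> \<le> W"
    by (intro exI[of _ W] allI conjI diff s)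
qed

end

section \<open>Decay on both sides of the solitons\<close>

text \<open>Follows from the inequality between exp(z) and the m-th power of 1 + z/m. It turns the
  exponential size of the weight at the solitons into an inverse power of the shift.\<close>

lemma exp_minus_times_power_le:
  assumes k: "k > (0::real)" and y: "y > 0" and m: "m \<ge> 1"
  shows "exp (- k * y) \<le> (real m / k) ^ m / y ^ m"
proof -
  have "(k * y / real m) ^ m \<le> (1 + k * y / real m) ^ m" using k y by (intro power_mono) auto
  also have "\<dots> \<le> exp (k * y)" using k y m by (intro exp_ge_one_plus_x_over_n_power_n) (auto intro: order_trans[of _ 0])
  finally have le: "(k * y / real m) ^ m \<le> exp (k * y)" .
  have pos: "(k * y / real m) ^ m > 0" using k y m by simp
  have "exp (- k * y) = 1 / exp (k * y)" by (simp add: exp_minus inverse_eq_divide)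
  also have "\<dots> \<le> 1 / (k * y / real m) ^ m" using pos by (intro divide_left_mono le) auto
  also have "\<dots> = (real m / k) ^ m / y ^ m" using k y m by (simp add: power_divide power_mult_distrib)
  finally show ?thesis .
qed

lemma tendsto_0_if_exp_bound:
  fixes f :: "real \<Rightarrow> real"
  assumes g: "g > 0" and f: "\<And>t. T \<le> t \<Longrightarrow> 0 \<le> f t" "\<And>t. T \<le> t \<Longrightarrow> f t \<le> D * exp (- g * t)"
  shows "(f \<longlongrightarrow> 0) at_top"
proof (rule tendsto_sandwich)
  show "\<forall>\<^sub>F t in at_top. 0 \<le> f t" "\<forall>\<^sub>F t in at_top. f t \<le> D * exp (- g * t)"
    using f by (auto intro: eventually_mono[OF eventually_ge_at_top[of T]])
  have "((\<lambda>t. exp (- g * t)) \<longlongrightarrow> 0) at_top"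
    using g by (intro filterlim_compose[OF exp_at_bot] filterlim_tendsto_neg_mult_at_bot[OF tendsto_const])
      (auto intro: filterlim_ident)
  hence "((\<lambda>t. D * exp (- g * t)) \<longlongrightarrow> D * 0) at_top" by (intro tendsto_intros)
  thus "((\<lambda>t. D * exp (- g * t)) \<longlongrightarrow> 0) at_top" by simp
qed simp

section \<open>Smallness of the solution under a moving weight\<close>

context gkdv_multi_soliton
begin

text \<open>\<open>\<zeta>\<close> is the position in the moving frame, oriented so that the weight
  may grow like exp(\<kappa> \<zeta>). Majorant and envelope share the rate \<kappa>, so x drops out
  and only the gap of the speeds remains; the last hypothesis expresses this gap.\<close>

lemma E_times_le:
  assumes "q \<le> M * exp (\<kappa> * \<zeta>)" "0 \<le> M" "\<kappa> * \<zeta> - \<kappa> * \<bar>x - c j * t\<bar> \<le> - \<gamma> * t"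
  shows "E j t x * q \<le> M * exp (- \<gamma> * t)"
proof -
  have "E j t x * q \<le> E j t x * (M * exp (\<kappa> * \<zeta>))" using assms(1) E_pos by (intro mult_left_mono) (auto simp: less_imp_le)
  also have "\<dots> = M * exp (\<kappa> * \<zeta> - \<kappa> * \<bar>x - c j * t\<bar>)" by (simp add: E_def exp_diff exp_minus field_simps)
  also have "\<dots> \<le> M * exp (- \<gamma> * t)" using assms(2,3) by (intro mult_left_mono) auto
  finally show ?thesis .
qed

lemma sum_E_times_le:
  assumes "q \<le> M * exp (\<kappa> * \<zeta>)" "0 \<le> M" "\<And>j. j \<in> {1..N} \<Longrightarrow> \<kappa> * \<zeta> - \<kappa> * \<bar>x - c j * t\<bar> \<le> - \<gamma> * t"
  shows "(\<Sum>j=1..N. E j t x) * q \<le> real N * (M * exp (- \<gamma> * t))"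
proof -
  have "(\<Sum>j=1..N. E j t x) * q \<le> (\<Sum>j=1..N. M * exp (- \<gamma> * t))"
    unfolding sum_distrib_right by (intro sum_mono E_times_le[OF assms(1,2)] assms(3))
  thus ?thesis by simp
qed

text \<open>The soliton part of \<open>U i\<close> meets the majorant of the weight and yields
  \<open>M\<close>; the error part is small by itself and keeps the factor \<open>q\<close>. The
  constants \<open>A i\<close> depend neither on the weight nor on its frame.\<close>

lemma U_times_weight:
  "\<exists>A. (\<forall>i. 0 \<le> A i) \<and> (\<forall>i t x \<gamma> q \<zeta> M. T0 \<le> t \<longrightarrow> \<gamma> \<le> \<theta> \<longrightarrow> 0 \<le> q \<longrightarrow> q \<le> M * exp (\<kappa> * \<zeta>) \<longrightarrow> 0 \<le> M \<longrightarrow>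
       (\<forall>j\<in>{1..N}. \<kappa> * \<zeta> - \<kappa> * \<bar>x - c j * t\<bar> \<le> - \<gamma> * t) \<longrightarrow>
       \<bar>U i t x\<bar> * q \<le> A i * (exp (- \<gamma> * t) * (q + M)))"
proof -
  obtain C where C: "\<And>i. C i > 0" "\<And>i t x. T0 \<le> t \<Longrightarrow> \<bar>U i t x\<bar> \<le> C i * ((\<Sum>j=1..N. E j t x) + exp (- \<theta> * t))"
    using U_pointwise by metis
  show ?thesis
  proof (intro exI[of _ "\<lambda>i. C i * (real N + 1)"] conjI allI impI)
    show "0 \<le> C i * (real N + 1)" for i using C(1)[of i] by simp
    fix i t x \<gamma> q \<zeta> M
    assume t: "T0 \<le> t" and \<gamma>: "\<gamma> \<le> \<theta>" and q: "0 \<le> q" "q \<le> M * exp (\<kappa> * \<zeta>)" and M: "0 \<le> M"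
      and j: "\<forall>j\<in>{1..N}. \<kappa> * \<zeta> - \<kappa> * \<bar>x - c j * t\<bar> \<le> - \<gamma> * t"
    have e: "exp (- \<theta> * t) \<le> exp (- \<gamma> * t)" using \<gamma> t T0 by (simp add: mult_right_mono)
    have "\<bar>U i t x\<bar> * q \<le> C i * ((\<Sum>j=1..N. E j t x) + exp (- \<theta> * t)) * q" by (intro mult_right_mono C t q)
    also have "\<dots> = C i * ((\<Sum>j=1..N. E j t x) * q + exp (- \<theta> * t) * q)" by (simp add: algebra_simps)
    also have "\<dots> \<le> C i * (real N * (M * exp (- \<gamma> * t)) + exp (- \<gamma> * t) * q)"
      using C(1)[of i] by (intro mult_left_mono add_mono sum_E_times_le[OF q(2) M j[rule_format]] mult_right_mono e q) auto
    also have "\<dots> \<le> C i * ((real N + 1) * (exp (- \<gamma> * t) * (q + M)))"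
      using C(1)[of i] q(1) M by (intro mult_left_mono) (auto simp: algebra_simps)
    finally show "\<bar>U i t x\<bar> * q \<le> C i * (real N + 1) * (exp (- \<gamma> * t) * (q + M))" by (simp add: mult.assoc)
  qed
qed

lemma integrable_U_mult:
  assumes "T0 \<le> t" "continuous_on UNIV g" "\<And>x. \<bar>g x\<bar> \<le> W"
  shows "integrable lborel (\<lambda>x. (U i t x)\<^sup>2 * g x)"
  by (rule integrable_bounded_mult[OF integrable_square[OF assms(1)] assms(2,3)])

text \<open>The hypotheses of \<open>E_times_le\<close> for a whole weight at one time. Only a
  majorant is asked for, so the same notion covers different shifts of the weight.\<close>

definition soliton_damping :: "real \<Rightarrow> (real \<Rightarrow> real) \<Rightarrow> real \<Rightarrow> real \<Rightarrow> (real \<Rightarrow> real) \<Rightarrow> bool" where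
  "soliton_damping \<gamma> \<zeta> t M w \<longleftrightarrow> continuous_on UNIV w \<and> 0 \<le> M \<and> (\<forall>x. 0 \<le> w x \<and> w x \<le> 1 \<and> w x \<le> M * exp (\<kappa> * \<zeta> x)) \<and>
    (\<forall>x. \<forall>j\<in>{1..N}. \<kappa> * \<zeta> x - \<kappa> * \<bar>x - c j * t\<bar> \<le> - \<gamma> * t)"

text \<open>Direct estimate from closeness to the solitons, without the equation. Of the two
  envelopes in the square of \<open>Q\<close>, one meets the weight and becomes small, the other is
  kept to be integrated. There is no gain for a distant weight; the lemma supplies the vanishing at
  infinity on the left and the start of the induction on the right.\<close>

lemma weighted_U_square:
  "\<exists>C\<ge>0. \<forall>t \<gamma> w \<zeta> M. T0 \<le> t \<longrightarrow> \<gamma> \<le> \<theta> \<longrightarrow> soliton_damping \<gamma> \<zeta> t M w \<longrightarrow>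
       (LINT x|lborel. (U i t x)\<^sup>2 * w x) \<le> C * (1 + M) * exp (- \<gamma> * t)"
proof -
  obtain B where B: "B > 0" "\<And>t x. \<bar>Q i t x\<bar> \<le> B * (\<Sum>j=1..N. E j t x)" using Q_bound by blast
  define I where "I = real N * (LINT x|lborel. exp (- \<kappa> * \<bar>x\<bar>))"
  have I: "I \<ge> 0" by (simp add: I_def)
  define C where "C = 2 * (\<Lambda> i)\<^sup>2 + 2 * (B\<^sup>2 * real N) * I"
  show ?thesis
  proof (intro exI[of _ C] conjI allI impI)
    show "0 \<le> C" using I by (simp add: C_def)
    fix t \<gamma> w \<zeta> M
    assume t: "T0 \<le> t" and \<gamma>: "\<gamma> \<le> \<theta>" and damping: "soliton_damping \<gamma> \<zeta> t M w"
    from damping have cw: "continuous_on UNIV w" and M: "0 \<le> M" and w: "0 \<le> w x" "w x \<le> 1" "w x \<le> M * exp (\<kappa> * \<zeta> x)"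
      and j: "\<forall>x. \<forall>j\<in>{1..N}. \<kappa> * \<zeta> x - \<kappa> * \<bar>x - c j * t\<bar> \<le> - \<gamma> * t" for x
      unfolding soliton_damping_def by blast+
    let ?e = "exp (- \<gamma> * t)"
    have "t \<ge> 0" using t T0 by simp
    have e: "(exp (- \<theta> * t))\<^sup>2 \<le> ?e"
    proof -
      have "(exp (- \<theta> * t))\<^sup>2 \<le> exp (- \<theta> * t)"
        using \<open>t \<ge> 0\<close> \<theta> by (simp add: power2_eq_square mult_left_le)
      also have "\<dots> \<le> ?e" using \<gamma> \<open>t \<ge> 0\<close> by (simp add: mult_right_mono)
      finally show ?thesis .
    qed
    have le: "(U i t x)\<^sup>2 * w x \<le> 2 * (U i t x - Q i t x)\<^sup>2 + 2 * (B\<^sup>2 * real N) * (M * ?e) * (\<Sum>j=1..N. E j t x)" for x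
    proof -
      have "(U i t x)\<^sup>2 \<le> 2 * (U i t x - Q i t x)\<^sup>2 + 2 * (Q i t x)\<^sup>2"
        using zero_le_power2[of "U i t x - 2 * Q i t x"] by (simp add: power2_eq_square algebra_simps)
      hence "(U i t x)\<^sup>2 * w x \<le> (2 * (U i t x - Q i t x)\<^sup>2 + 2 * (Q i t x)\<^sup>2) * w x" by (intro mult_right_mono w)
      also have "\<dots> = 2 * (U i t x - Q i t x)\<^sup>2 * w x + 2 * ((Q i t x)\<^sup>2 * w x)" by (simp add: algebra_simps)
      also have "\<dots> \<le> 2 * (U i t x - Q i t x)\<^sup>2 * 1 + 2 * (B\<^sup>2 * real N * (M * ?e) * (\<Sum>j=1..N. E j t x))"
      proof (intro add_mono mult_left_mono w)
        have "(Q i t x)\<^sup>2 \<le> (B * (\<Sum>j=1..N. E j t x))\<^sup>2"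
          using power_mono[OF B(2)[of t x], of 2] by simp
        hence "(Q i t x)\<^sup>2 * w x \<le> (B * (\<Sum>j=1..N. E j t x))\<^sup>2 * w x" by (intro mult_right_mono w)
        also have "\<dots> = B\<^sup>2 * ((\<Sum>j=1..N. E j t x) * ((\<Sum>j=1..N. E j t x) * w x))" by (simp add: power2_eq_square)
        also have "\<dots> \<le> B\<^sup>2 * ((\<Sum>j=1..N. E j t x) * (real N * (M * ?e)))"
          by (intro mult_left_mono sum_E_times_le[OF w(3) M j[rule_format]] sum_E_nonneg) auto
        finally show "(Q i t x)\<^sup>2 * w x \<le> B\<^sup>2 * real N * (M * ?e) * (\<Sum>j=1..N. E j t x)" by (simp add: mult_ac)
      qed auto
      finally show ?thesis by (simp add: mult_ac)
    qed
    have iD: "integrable lborel (\<lambda>x. (U i t x - Q i t x)\<^sup>2)" using difference_L2(1)[OF t, of i] by (simp add: L2_def)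
    have iS: "integrable lborel (\<lambda>x. \<Sum>j=1..N. E j t x)" by (intro Bochner_Integration.integrable_sum integral_E)
    have "(LINT x|lborel. (U i t x)\<^sup>2 * w x)
        \<le> (LINT x|lborel. 2 * (U i t x - Q i t x)\<^sup>2 + 2 * (B\<^sup>2 * real N) * (M * ?e) * (\<Sum>j=1..N. E j t x))"
    proof (rule integral_mono[OF _ _ le])
      show "integrable lborel (\<lambda>x. (U i t x)\<^sup>2 * w x)" by (rule integrable_U_mult[OF t cw, of 1]) (use w in auto)
    qed (use iD iS in simp)
    also have "\<dots> = 2 * (LINT x|lborel. (U i t x - Q i t x)\<^sup>2) + 2 * (B\<^sup>2 * real N) * (M * ?e) * I"
      using iD iS by (simp add: I_def integral_E Bochner_Integration.integral_sum)
    also have "\<dots> \<le> 2 * ((\<Lambda> i)\<^sup>2 * ?e) + 2 * (B\<^sup>2 * real N) * (M * ?e) * I"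
      using order_trans[OF difference_L2(2)[OF t, of i, unfolded power_mult_distrib] mult_left_mono[OF e]] by simp
    also have "\<dots> \<le> C * (1 + M) * ?e"
    proof -
      have "C * (1 + M) * ?e - (2 * ((\<Lambda> i)\<^sup>2 * ?e) + 2 * (B\<^sup>2 * real N) * (M * ?e) * I)
          = ?e * (2 * (\<Lambda> i)\<^sup>2 * M + 2 * (B\<^sup>2 * real N) * I)" by (simp add: C_def algebra_simps)
      moreover have "\<dots> \<ge> 0" using I M by (intro mult_nonneg_nonneg add_nonneg_nonneg) auto
      ultimately show ?thesis by linarith
    qed
    finally show "(LINT x|lborel. (U i t x)\<^sup>2 * w x) \<le> C * (1 + M) * ?e" .
  qed
qed

text \<open>Turns the weighted energies of orders \<open>s\<close> and s + 1 into a pointwise bound;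
  it is used at the point where the weight equals 1/2.\<close>

lemma U_square_le_weighted:
  assumes t: "T0 \<le> t" and w: "weight w0 w1 w2 w3" and w0: "\<And>x. 0 \<le> w0 x" and w1: "\<And>x. \<bar>w1 x\<bar> \<le> \<kappa> * w0 x"
  shows "(U s t x)\<^sup>2 * w0 (x - \<sigma> * t) \<le> (1 + \<kappa>) *
    ((LINT x|lborel. (U s t x)\<^sup>2 * w0 (x - \<sigma> * t)) + (LINT x|lborel. (U (Suc s) t x)\<^sup>2 * w0 (x - \<sigma> * t)))"
proof -
  obtain W where W: "\<forall>x. \<bar>w0 x\<bar> \<le> W" using w unfolding weight_def by blast
  have "(U s t x)\<^sup>2 * w0 (x - \<sigma> * t) \<le> (1 + \<kappa>) * (LINT x|lborel. ((U s t x)\<^sup>2 + (U (Suc s) t x)\<^sup>2) * w0 (x - \<sigma> * t))"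
  proof (rule weighted_sobolev_inequality[where w'="\<lambda>x. w1 (x - \<sigma> * t)" and M=W])
    show "((\<lambda>x. w0 (x - \<sigma> * t)) has_real_derivative w1 (x - \<sigma> * t)) (at x)" for x
    proof -
      have "(w0 has_real_derivative w1 (x - \<sigma> * t)) (at (x - \<sigma> * t))" using w unfolding weight_def by blast
      moreover have "((\<lambda>x. x - \<sigma> * t) has_real_derivative 1) (at x)" by (auto intro!: derivative_eq_intros)
      ultimately show ?thesis by (auto dest: DERIV_chain2)
    qed
    show "w0 (x - \<sigma> * t) \<le> W" for x using W abs_le_D1 by blast
  qed (use U_DERIV U_continuous U_L2 t w0 w1 continuous_weights_x[OF w] \<kappa>_pos in auto)
  also have "(LINT x|lborel. ((U s t x)\<^sup>2 + (U (Suc s) t x)\<^sup>2) * w0 (x - \<sigma> * t)) =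
      (LINT x|lborel. (U s t x)\<^sup>2 * w0 (x - \<sigma> * t)) + (LINT x|lborel. (U (Suc s) t x)\<^sup>2 * w0 (x - \<sigma> * t))"
    using integrable_square_weight[OF w t] by (simp add: ring_distribs)
  finally show ?thesis .
qed

section \<open>Exponential decay to the left\<close>

lemma \<kappa>_square: "\<kappa>\<^sup>2 = c 1 / 4"
  using c1_pos by (simp add: \<kappa>_def power_divide)

text \<open>The frame moves at half the speed of the slowest soliton: it is slow enough for the
  solitons to run away from it, and fast enough for \<open>\<sigma> * w1\<close> to dominate
  \<open>w3\<close>. The weight has size \<open>exp (- \<kappa> * Y)\<close> at the origin of the
  frame, and this is the \<open>\<rho>\<close> of the energy estimate.\<close>

lemma left_weighted:
  "\<exists>C\<ge>0. \<forall>t\<ge>T0. \<forall>Y. (LINT x|lborel. (U s t x)\<^sup>2 * logistic \<kappa> (- (x - c 1 / 2 * t) - Y)) \<le> C * exp (- \<kappa> * Y)"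
proof -
  define \<gamma> where "\<gamma> = min \<theta> (\<kappa> * (c 1 / 2))"
  have \<gamma>: "\<gamma> > 0" "\<gamma> \<le> \<theta>" using \<theta> \<kappa>_pos c1_pos by (auto simp: \<gamma>_def)
  from U_times_weight obtain A where A: "\<forall>i. 0 \<le> A i"
    "\<forall>i t x \<gamma> q \<zeta> M. T0 \<le> t \<longrightarrow> \<gamma> \<le> \<theta> \<longrightarrow> 0 \<le> q \<longrightarrow> q \<le> M * exp (\<kappa> * \<zeta>) \<longrightarrow> 0 \<le> M \<longrightarrow>
       (\<forall>j\<in>{1..N}. \<kappa> * \<zeta> - \<kappa> * \<bar>x - c j * t\<bar> \<le> - \<gamma> * t) \<longrightarrow>
       \<bar>U i t x\<bar> * q \<le> A i * (exp (- \<gamma> * t) * (q + M))"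
    by (elim exE conjE)
  have k0: "0 \<le> \<kappa>" using \<kappa>_pos by simp
  have dist: "\<kappa> * - (x - c 1 / 2 * t) - \<kappa> * \<bar>x - c j * t\<bar> \<le> - \<gamma> * t" if t: "T0 \<le> t" and j: "j \<in> {1..N}" for t x j
  proof -
    have t0: "0 \<le> t" using t T0 by simp
    \<comment> \<open>x drops out by the triangle inequality, which leaves the speed gap, at least
      \<open>c 1 / 2\<close>.\<close>
    have "- (x - c 1 / 2 * t) - \<bar>x - c j * t\<bar> \<le> c 1 / 2 * t - c j * t" by linarith
    also have "\<dots> \<le> - (c 1 / 2) * t" using mult_right_mono[OF c_le(1)[OF j] t0] by (simp add: algebra_simps)
    finally have "\<kappa> * (- (x - c 1 / 2 * t) - \<bar>x - c j * t\<bar>) \<le> \<kappa> * (- (c 1 / 2) * t)" using k0 by (intro mult_left_mono)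
    also have "\<dots> \<le> - \<gamma> * t" using mult_right_mono[of \<gamma> "\<kappa> * (c 1 / 2)" t] t0 by (simp add: \<gamma>_def mult.assoc)
    finally show ?thesis by (simp add: right_diff_distrib)
  qed
  \<comment> \<open>The linear constants are 0, because the linear integrand is nonpositive at every
    point.\<close>
  from weighted_decay[OF \<gamma>(1) k0, of A "\<lambda>_. 0" s, OF A(1)[rule_format] order_refl]
  obtain C where C: "C \<ge> 0" and C2: "\<forall>w0 w1 w2 w3 \<sigma> \<rho> t. weight w0 w1 w2 w3 \<longrightarrow>
      decaying_weight \<gamma> \<kappa> A (\<lambda>_. 0) w0 w1 w3 \<sigma> \<rho> \<longrightarrow> T0 \<le> t \<longrightarrow>
      (LINT x|lborel. (U s t x)\<^sup>2 * w0 (x - \<sigma> * t)) \<le> C * \<rho> * exp (- \<gamma> * t)"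
    by (elim exE conjE)
  have "(LINT x|lborel. (U s t x)\<^sup>2 * logistic \<kappa> (- (x - c 1 / 2 * t) - Y)) \<le> C * exp (- \<kappa> * Y)" if t: "T0 \<le> t" for t Y
  proof -
    have le: "logistic \<kappa> (- y - Y) \<le> exp (- \<kappa> * Y) * exp (\<kappa> * - y)" for y
    proof -
      have "\<kappa> * (- y - Y) = - \<kappa> * Y + \<kappa> * - y" by (simp add: algebra_simps)
      thus ?thesis using logistic_le_exp[of \<kappa> "- y - Y"] by (simp only: exp_add)
    qed
    have "(LINT x|lborel. (U s t x)\<^sup>2 * logistic \<kappa> (- (x - c 1 / 2 * t) - Y)) \<le> C * exp (- \<kappa> * Y) * exp (- \<gamma> * t)"
    proof (rule C2[rule_format, OF weight_left[OF k0, of Y] _ t, where \<sigma>="c 1 / 2"], unfold decaying_weight_def, intro conjI allI impI)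
      show "0 \<le> exp (- \<kappa> * Y)" by simp
      show "0 \<le> logistic \<kappa> (- x - Y)" for x using logistic_pos less_imp_le by blast
      show "\<bar>- logistic1 \<kappa> (- x - Y)\<bar> \<le> \<kappa> * logistic \<kappa> (- x - Y)" for x
        using logistic1_nonneg[OF k0] logistic1_le[OF k0] by simp
      show "\<bar>U i t x\<bar> * logistic \<kappa> (- (x - c 1 / 2 * t) - Y)
         \<le> A i * (exp (- \<gamma> * t) * (logistic \<kappa> (- (x - c 1 / 2 * t) - Y) + exp (- \<kappa> * Y)))" if "T0 \<le> t" for i t x
        by (rule A(2)[rule_format, OF that \<gamma>(2) _ le _ dist[OF that]]) (auto simp: less_imp_le[OF logistic_pos])
      show "(LINT x|lborel. 3 * (U (Suc i) t x)\<^sup>2 * - logistic1 \<kappa> (- (x - c 1 / 2 * t) - Y)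
        - (U i t x)\<^sup>2 * (- logistic3 \<kappa> (- (x - c 1 / 2 * t) - Y) - c 1 / 2 * - logistic1 \<kappa> (- (x - c 1 / 2 * t) - Y)))
        \<le> 0 * exp (- \<gamma> * t) * exp (- \<kappa> * Y)" for i t
      proof -
        have le0: "3 * (U (Suc i) t x)\<^sup>2 * - logistic1 \<kappa> z - (U i t x)\<^sup>2 * (- logistic3 \<kappa> z - c 1 / 2 * - logistic1 \<kappa> z) \<le> 0" for x z
        proof -
          have l1: "0 \<le> logistic1 \<kappa> z" by (rule logistic1_nonneg[OF k0])
          have "logistic3 \<kappa> z \<le> \<kappa>\<^sup>2 * logistic1 \<kappa> z" using logistic3_le[OF k0, of z] by linarith
          \<comment> \<open>Here the choice of \<kappa> enters: its square is
            \<open>c 1 / 4\<close>.\<close>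
          also have "\<dots> \<le> c 1 / 2 * logistic1 \<kappa> z" using l1 c1_pos by (intro mult_right_mono) (auto simp: \<kappa>_square)
          finally have "(U i t x)\<^sup>2 * (logistic3 \<kappa> z - c 1 / 2 * logistic1 \<kappa> z) \<le> 0"
            by (intro mult_nonneg_nonpos) auto
          moreover have "0 \<le> (U (Suc i) t x)\<^sup>2 * logistic1 \<kappa> z" using l1 by simp
          ultimately show ?thesis by (simp add: algebra_simps)
        qed
        let ?f = "\<lambda>x. 3 * (U (Suc i) t x)\<^sup>2 * - logistic1 \<kappa> (- (x - c 1 / 2 * t) - Y)
          - (U i t x)\<^sup>2 * (- logistic3 \<kappa> (- (x - c 1 / 2 * t) - Y) - c 1 / 2 * - logistic1 \<kappa> (- (x - c 1 / 2 * t) - Y))"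
        have "0 \<le> (LINT x|lborel. - ?f x)"
          using le0 by (intro Bochner_Integration.integral_nonneg) (simp only: neg_0_le_iff_le)
        thus ?thesis by (simp only: Bochner_Integration.integral_minus neg_0_le_iff_le mult_zero_left)
      qed
      show "((\<lambda>t. LINT x|lborel. (U i t x)\<^sup>2 * logistic \<kappa> (- (x - c 1 / 2 * t) - Y)) \<longlongrightarrow> 0) at_top" for i
      proof -
        from weighted_U_square[of i]
        obtain D where D: "0 \<le> D" "\<forall>t \<gamma> w \<zeta> M. T0 \<le> t \<longrightarrow> \<gamma> \<le> \<theta> \<longrightarrow> soliton_damping \<gamma> \<zeta> t M w \<longrightarrow>
            (LINT x|lborel. (U i t x)\<^sup>2 * w x) \<le> D * (1 + M) * exp (- \<gamma> * t)"
          by (elim exE conjE)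
        show ?thesis
        proof (rule tendsto_0_if_exp_bound[OF \<gamma>(1)])
          show "0 \<le> (LINT x|lborel. (U i t x)\<^sup>2 * logistic \<kappa> (- (x - c 1 / 2 * t) - Y))" for t
            by (intro Bochner_Integration.integral_nonneg mult_nonneg_nonneg) (auto simp: less_imp_le[OF logistic_pos])
          fix t assume t: "T0 \<le> t"
          show "(LINT x|lborel. (U i t x)\<^sup>2 * logistic \<kappa> (- (x - c 1 / 2 * t) - Y)) \<le> D * (1 + exp (- \<kappa> * Y)) * exp (- \<gamma> * t)"
          proof (rule D(2)[rule_format, OF t \<gamma>(2)], unfold soliton_damping_def, intro conjI allI ballI)
            show "continuous_on UNIV (\<lambda>x. logistic \<kappa> (- (x - c 1 / 2 * t) - Y))"
              by (rule continuous_on_compose2[OF logistic_continuous(1)[of UNIV]]) (auto intro!: continuous_intros)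
            show "logistic \<kappa> (- (x - c 1 / 2 * t) - Y) \<le> exp (- \<kappa> * Y) * exp (\<kappa> * - (x - c 1 / 2 * t))" for x by (rule le)
          qed (use dist[OF t] in \<open>auto simp: less_imp_le[OF logistic_pos] less_imp_le[OF logistic_less_1]\<close>)
        qed
      qed
    qed
    also have "\<dots> \<le> C * exp (- \<kappa> * Y) * 1" using C \<gamma>(1) t T0 by (intro mult_left_mono) auto
    finally show ?thesis by simp
  qed
  thus ?thesis using C by blast
qed

text \<open>The weight is placed so that it equals 1/2 at the point under consideration; the square
  root then halves the rate. Y may have either sign, so no restriction on \<open>x\<close>
  arises.\<close>

lemma left_pointwise:
  "\<exists>C\<ge>0. \<forall>t\<ge>T0. \<forall>x. \<bar>U s t x\<bar> \<le> C * exp (- \<kappa> * (c 1 / 2 * t - x) / 2)"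
proof -
  have k0: "0 \<le> \<kappa>" using \<kappa>_pos by simp
  obtain C where C: "C \<ge> 0" "\<And>t Y. T0 \<le> t \<Longrightarrow>
      (LINT x|lborel. (U s t x)\<^sup>2 * logistic \<kappa> (- (x - c 1 / 2 * t) - Y)) \<le> C * exp (- \<kappa> * Y)"
    using left_weighted[of s] by blast
  obtain C' where C': "C' \<ge> 0" "\<And>t Y. T0 \<le> t \<Longrightarrow>
      (LINT x|lborel. (U (Suc s) t x)\<^sup>2 * logistic \<kappa> (- (x - c 1 / 2 * t) - Y)) \<le> C' * exp (- \<kappa> * Y)"
    using left_weighted[of "Suc s"] by blast
  define D where "D = 2 * ((1 + \<kappa>) * (C + C'))"
  have D: "D \<ge> 0" unfolding D_def using C(1) C'(1) k0 by (intro mult_nonneg_nonneg add_nonneg_nonneg) auto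
  have "\<bar>U s t x\<bar> \<le> sqrt D * exp (- \<kappa> * (c 1 / 2 * t - x) / 2)" if t: "T0 \<le> t" for t x
  proof -
    define Y where "Y = c 1 / 2 * t - x"
    have "(U s t x)\<^sup>2 * logistic \<kappa> (- (x - c 1 / 2 * t) - Y) \<le> (1 + \<kappa>) *
      ((LINT x|lborel. (U s t x)\<^sup>2 * logistic \<kappa> (- (x - c 1 / 2 * t) - Y)) + (LINT x|lborel. (U (Suc s) t x)\<^sup>2 * logistic \<kappa> (- (x - c 1 / 2 * t) - Y)))"
      by (rule U_square_le_weighted[OF t weight_left[OF k0, of Y]])
        (use logistic1_nonneg[OF k0] logistic1_le[OF k0] in \<open>auto simp: less_imp_le[OF logistic_pos]\<close>)
    also have "\<dots> \<le> (1 + \<kappa>) * (C * exp (- \<kappa> * Y) + C' * exp (- \<kappa> * Y))"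
      using k0 by (intro mult_left_mono add_mono C(2) C'(2) t) auto
    also have "logistic \<kappa> (- (x - c 1 / 2 * t) - Y) = 1 / 2" by (simp add: Y_def logistic_0)
    finally have "(U s t x)\<^sup>2 \<le> D * exp (- \<kappa> * Y)" by (simp add: D_def algebra_simps)
    also have "\<dots> = (sqrt D * exp (- \<kappa> * Y / 2))\<^sup>2"
      using D by (simp add: power_mult_distrib flip: exp_double)
    finally have "\<bar>U s t x\<bar> \<le> \<bar>sqrt D * exp (- \<kappa> * Y / 2)\<bar>" by (rule abs_le_square_iff[THEN iffD2])
    thus ?thesis using D by (simp add: Y_def)
  qed
  thus ?thesis using D by (intro exI[of _ "sqrt D"]) auto
qed

text \<open>Induction on the power n, simultaneously for all orders, since the step at order i uses
  the previous bound at order i + 1. The rate \<gamma> is fixed beforehand and survives every step,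
  which keeps the linear terms integrable in time.\<close>

lemma right_weighted:
  assumes \<beta>: "\<beta> > c N"
  shows "\<exists>\<gamma>>0. \<forall>n s. \<exists>C\<ge>0. \<forall>t\<ge>T0. \<forall>Y>0.
    (LINT x|lborel. (U s t x)\<^sup>2 * logistic \<kappa> (x - \<beta> * t - Y)) \<le> C / Y ^ n * exp (- \<gamma> * t)"
proof -
  define \<gamma> where "\<gamma> = min \<theta> (\<kappa> * (\<beta> - c N))"
  have \<gamma>: "\<gamma> > 0" "\<gamma> \<le> \<theta>" using \<theta> \<kappa>_pos \<beta> by (auto simp: \<gamma>_def)
  have \<beta>0: "\<beta> > 0" using \<beta> c_pos[of N] N by auto
  have k0: "0 \<le> \<kappa>" using \<kappa>_pos by simp
  from U_times_weight obtain A where A: "\<forall>i. 0 \<le> A i"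
    "\<forall>i t x \<gamma> q \<zeta> M. T0 \<le> t \<longrightarrow> \<gamma> \<le> \<theta> \<longrightarrow> 0 \<le> q \<longrightarrow> q \<le> M * exp (\<kappa> * \<zeta>) \<longrightarrow> 0 \<le> M \<longrightarrow>
       (\<forall>j\<in>{1..N}. \<kappa> * \<zeta> - \<kappa> * \<bar>x - c j * t\<bar> \<le> - \<gamma> * t) \<longrightarrow>
       \<bar>U i t x\<bar> * q \<le> A i * (exp (- \<gamma> * t) * (q + M))"
    by (elim exE conjE)
  have dist: "\<kappa> * (x - \<beta> * t) - \<kappa> * \<bar>x - c j * t\<bar> \<le> - \<gamma> * t" if t: "T0 \<le> t" and j: "j \<in> {1..N}" for t x j
  proof -
    have t0: "0 \<le> t" using t T0 by simp
    have "x - \<beta> * t - \<bar>x - c j * t\<bar> \<le> c j * t - \<beta> * t" by linarith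
    also have "\<dots> \<le> - (\<beta> - c N) * t" using mult_right_mono[OF c_le(2)[OF j] t0] by (simp add: algebra_simps)
    finally have "\<kappa> * (x - \<beta> * t - \<bar>x - c j * t\<bar>) \<le> \<kappa> * (- (\<beta> - c N) * t)" using k0 by (intro mult_left_mono)
    also have "\<dots> = - ((\<kappa> * (\<beta> - c N)) * t)" by (simp add: algebra_simps)
    also have "\<dots> \<le> - \<gamma> * t" using mult_right_mono[of \<gamma> "\<kappa> * (\<beta> - c N)" t] t0 by (simp add: \<gamma>_def)
    finally show ?thesis by (simp add: right_diff_distrib)
  qed
  have cl: "continuous_on UNIV (\<lambda>x. logistic \<kappa> (x - \<beta> * t - Y))" for t Y
    by (rule continuous_on_compose2[OF logistic_continuous(1)[of UNIV]]) (auto intro!: continuous_intros)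
  have le: "logistic \<kappa> (z - Y) \<le> exp (- \<kappa> * Y) * exp (\<kappa> * z)" for z Y
  proof -
    have "\<kappa> * (z - Y) = - \<kappa> * Y + \<kappa> * z" by (simp add: algebra_simps)
    thus ?thesis using logistic_le_exp[of \<kappa> "z - Y"] by (simp only: exp_add)
  qed
  have main: "\<forall>s. \<exists>C\<ge>0. \<forall>t\<ge>T0. \<forall>Y>0.
    (LINT x|lborel. (U s t x)\<^sup>2 * logistic \<kappa> (x - \<beta> * t - Y)) \<le> C / Y ^ n * exp (- \<gamma> * t)" for n
  proof (induction n)
    \<comment> \<open>No gain in Y is required. Positivity of Y gives a majorant with
      \<open>M = 1\<close>, uniform in the shift.\<close>
    case 0
    show ?case
    proof
      fix s
      from weighted_U_square[of s]
      obtain D where D: "0 \<le> D" "\<forall>t \<gamma> w \<zeta> M. T0 \<le> t \<longrightarrow> \<gamma> \<le> \<theta> \<longrightarrow> soliton_damping \<gamma> \<zeta> t M w \<longrightarrow>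
          (LINT x|lborel. (U s t x)\<^sup>2 * w x) \<le> D * (1 + M) * exp (- \<gamma> * t)"
        by (elim exE conjE)
      have "(LINT x|lborel. (U s t x)\<^sup>2 * logistic \<kappa> (x - \<beta> * t - Y)) \<le> D * (1 + 1) * exp (- \<gamma> * t)"
        if t: "T0 \<le> t" and Y: "Y > 0" for t Y
      proof (rule D(2)[rule_format, OF t \<gamma>(2)], unfold soliton_damping_def, intro conjI allI ballI cl)
        fix x
        have "logistic \<kappa> (x - \<beta> * t - Y) \<le> exp (- \<kappa> * Y) * exp (\<kappa> * (x - \<beta> * t))" by (rule le)
        also have "\<dots> \<le> 1 * exp (\<kappa> * (x - \<beta> * t))" using \<kappa>_pos Y by (intro mult_right_mono) auto
        finally show "logistic \<kappa> (x - \<beta> * t - Y) \<le> 1 * exp (\<kappa> * (x - \<beta> * t))" .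
      qed (use dist[OF t] in \<open>auto simp: less_imp_le[OF logistic_pos] less_imp_le[OF logistic_less_1]\<close>)
      thus "\<exists>C\<ge>0. \<forall>t\<ge>T0. \<forall>Y>0. (LINT x|lborel. (U s t x)\<^sup>2 * logistic \<kappa> (x - \<beta> * t - Y)) \<le> C / Y ^ 0 * exp (- \<gamma> * t)"
        using D(1) by (intro exI[of _ "D * (1 + 1)"]) auto
    qed
  next
    case (Suc n)
    from choice[OF Suc] obtain B where B: "\<And>i. B i \<ge> 0" "\<And>i t Y. T0 \<le> t \<Longrightarrow> Y > 0 \<Longrightarrow>
      (LINT x|lborel. (U i t x)\<^sup>2 * logistic \<kappa> (x - \<beta> * t - Y)) \<le> B i / Y ^ n * exp (- \<gamma> * t)" by blast
    \<comment> \<open>The linear terms: 3 from the square of the next derivative against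
      \<open>w1\<close>, \<open>2 * \<kappa>\<^sup>2\<close> from the third derivative of the
      weight, and \<open>\<beta>\<close> from the speed of the frame.\<close>
    define B' where "B' = (\<lambda>i. 3 * B (Suc i) + (2 * \<kappa>\<^sup>2 + \<beta>) * B i)"
    have B': "0 \<le> B' i" for i unfolding B'_def using B(1) \<beta>0 by (intro add_nonneg_nonneg mult_nonneg_nonneg) auto
    define K where "K = (real (Suc n) / \<kappa>) ^ Suc n"
    have K: "0 \<le> K" using \<kappa>_pos by (simp add: K_def)
    show ?case
    proof
      fix s
      from weighted_decay[OF \<gamma>(1) k0, of A B' s, OF A(1)[rule_format] B']
      obtain C where C: "C \<ge> 0" and C2: "\<forall>w0 w1 w2 w3 \<sigma> \<rho> t. weight w0 w1 w2 w3 \<longrightarrow>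
          decaying_weight \<gamma> \<kappa> A B' w0 w1 w3 \<sigma> \<rho> \<longrightarrow> T0 \<le> t \<longrightarrow>
          (LINT x|lborel. (U s t x)\<^sup>2 * w0 (x - \<sigma> * t)) \<le> C * \<rho> * exp (- \<gamma> * t)"
        by (elim exE conjE)
      \<comment> \<open>The averaged weight lies above the logistic at \<open>2 * y\<close>, while
        its derivatives lie below 1 / y times the logistic at \<open>y\<close>. The old bound at
        \<open>y\<close> thus yields one more power at \<open>2 * y\<close>.\<close>
      have est: "(LINT x|lborel. (U s t x)\<^sup>2 * logistic \<kappa> (x - \<beta> * t - 2 * y)) \<le> C * (1 + K) / y ^ Suc n * exp (- \<gamma> * t)"
        if t: "T0 \<le> t" and y: "y > 0" for t y
      proof -
        define w0 where "w0 = averaged_logistic \<kappa> y"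
        define w1 where "w1 = (\<lambda>z. (logistic \<kappa> (z - y) - logistic \<kappa> (z - 2 * y)) / y)"
        define w2 where "w2 = (\<lambda>z. (logistic1 \<kappa> (z - y) - logistic1 \<kappa> (z - 2 * y)) / y)"
        define w3 where "w3 = (\<lambda>z. (logistic2 \<kappa> (z - y) - logistic2 \<kappa> (z - 2 * y)) / y)"
        have w: "weight w0 w1 w2 w3" unfolding w0_def w1_def w2_def w3_def by (rule weight_right[OF \<kappa>_pos y])
        have w0: "0 \<le> w0 z" "logistic \<kappa> (z - 2 * y) \<le> w0 z" "w0 z \<le> logistic \<kappa> (z - y)" for z
          unfolding w0_def by (rule averaged_logistic_nonneg[OF \<kappa>_pos y] averaged_logistic_between[OF \<kappa>_pos y])+
        have w1: "0 \<le> w1 z" "w1 z \<le> logistic \<kappa> (z - y) / y" "w1 z \<le> \<kappa> * w0 z" for z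
          unfolding w0_def w1_def by (rule averaged_logistic_deriv_le[OF \<kappa>_pos y])+
        have w3: "\<bar>w3 z\<bar> \<le> 2 * \<kappa>\<^sup>2 * logistic \<kappa> (z - y) / y" for z
          unfolding w3_def by (rule averaged_logistic_deriv3_le[OF \<kappa>_pos y])
        \<comment> \<open>The first part pays for the linear terms, the second is the size of the
          weight at the origin of the frame.\<close>
        define \<rho> where "\<rho> = 1 / y ^ Suc n + exp (- \<kappa> * y)"
        have \<rho>: "0 \<le> \<rho>" "exp (- \<kappa> * y) \<le> \<rho>" "1 / y ^ Suc n \<le> \<rho>" using y by (auto simp: \<rho>_def add_nonneg_nonneg)
        have w0_exp: "w0 z \<le> exp (- \<kappa> * y) * exp (\<kappa> * z)" for z using order_trans[OF w0(3) le] .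
        obtain W where W: "\<forall>x. \<bar>w0 x\<bar> \<le> W \<and> \<bar>w1 x\<bar> \<le> W \<and> \<bar>w2 x\<bar> \<le> W \<and> \<bar>w3 x\<bar> \<le> W"
          using w unfolding weight_def by blast
        have "(LINT x|lborel. (U s t x)\<^sup>2 * w0 (x - \<beta> * t)) \<le> C * \<rho> * exp (- \<gamma> * t)"
        proof (rule C2[rule_format, OF w _ t], unfold decaying_weight_def, intro conjI allI impI \<rho>(1))
          show "0 \<le> w0 x" for x by (rule w0)
          show "\<bar>w1 x\<bar> \<le> \<kappa> * w0 x" for x using w1 by simp
          show "\<bar>U i t x\<bar> * w0 (x - \<beta> * t) \<le> A i * (exp (- \<gamma> * t) * (w0 (x - \<beta> * t) + \<rho>))" if t: "T0 \<le> t" for t x i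
          proof -
            have "\<bar>U i t x\<bar> * w0 (x - \<beta> * t) \<le> A i * (exp (- \<gamma> * t) * (w0 (x - \<beta> * t) + exp (- \<kappa> * y)))"
              by (rule A(2)[rule_format, OF t \<gamma>(2) w0(1) w0_exp _ dist[OF t]]) auto
            also have "\<dots> \<le> A i * (exp (- \<gamma> * t) * (w0 (x - \<beta> * t) + \<rho>))"
              using A(1) \<rho>(2) by (intro mult_left_mono add_left_mono) auto
            finally show ?thesis .
          qed
          show "((\<lambda>t. LINT x|lborel. (U i t x)\<^sup>2 * w0 (x - \<beta> * t)) \<longlongrightarrow> 0) at_top" for i
          proof (rule tendsto_0_if_exp_bound[OF \<gamma>(1)])
            show "0 \<le> (LINT x|lborel. (U i t x)\<^sup>2 * w0 (x - \<beta> * t))" for t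
              by (intro Bochner_Integration.integral_nonneg mult_nonneg_nonneg w0) auto
            fix t assume t: "T0 \<le> t"
            \<comment> \<open>The vanishing at infinity is inherited from the previous power, by
              comparison of the weights.\<close>
            have "(LINT x|lborel. (U i t x)\<^sup>2 * w0 (x - \<beta> * t)) \<le> (LINT x|lborel. (U i t x)\<^sup>2 * logistic \<kappa> (x - \<beta> * t - y))"
              by (intro integral_mono integrable_square_weight[OF w t] integrable_U_mult[OF t cl, where W=1] mult_left_mono w0)
                (auto simp: less_imp_le[OF logistic_pos] less_imp_le[OF logistic_less_1])
            also have "\<dots> \<le> B i / y ^ n * exp (- \<gamma> * t)" by (rule B(2)[OF t y])
            finally show "(LINT x|lborel. (U i t x)\<^sup>2 * w0 (x - \<beta> * t)) \<le> B i / y ^ n * exp (- \<gamma> * t)" .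
          qed
          show "(LINT x|lborel. 3 * (U (Suc i) t x)\<^sup>2 * w1 (x - \<beta> * t) - (U i t x)\<^sup>2 * (w3 (x - \<beta> * t) - \<beta> * w1 (x - \<beta> * t)))
            \<le> B' i * exp (- \<gamma> * t) * \<rho>" if t: "T0 \<le> t" for t i
          proof -
            let ?b = "\<lambda>x. logistic \<kappa> (x - \<beta> * t - y)"
            have iw: "integrable lborel (\<lambda>x. (U j t x)\<^sup>2 * w1 (x - \<beta> * t))" "integrable lborel (\<lambda>x. (U j t x)\<^sup>2 * w3 (x - \<beta> * t))"
              "integrable lborel (\<lambda>x. (U j t x)\<^sup>2 * ?b x)" for j
              by (rule integrable_U_mult[OF t continuous_weights_x(2)[OF w], where W=W], use W in blast)
                 (rule integrable_U_mult[OF t continuous_weights_x(4)[OF w], where W=W], use W in blast,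
                  rule integrable_U_mult[OF t cl, where W=1], simp add: less_imp_le[OF logistic_pos] less_imp_le[OF logistic_less_1])
            have "(LINT x|lborel. 3 * (U (Suc i) t x)\<^sup>2 * w1 (x - \<beta> * t) - (U i t x)\<^sup>2 * (w3 (x - \<beta> * t) - \<beta> * w1 (x - \<beta> * t)))
              = (LINT x|lborel. 3 * ((U (Suc i) t x)\<^sup>2 * w1 (x - \<beta> * t)) - (U i t x)\<^sup>2 * w3 (x - \<beta> * t) + \<beta> * ((U i t x)\<^sup>2 * w1 (x - \<beta> * t)))"
              by (intro Bochner_Integration.integral_cong) (auto simp: algebra_simps)
            also have "\<dots> \<le> (LINT x|lborel. (3 / y) * ((U (Suc i) t x)\<^sup>2 * ?b x) + ((2 * \<kappa>\<^sup>2 + \<beta>) / y) * ((U i t x)\<^sup>2 * ?b x))"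
            proof (rule integral_mono)
              show "integrable lborel (\<lambda>x. 3 * ((U (Suc i) t x)\<^sup>2 * w1 (x - \<beta> * t)) - (U i t x)\<^sup>2 * w3 (x - \<beta> * t) + \<beta> * ((U i t x)\<^sup>2 * w1 (x - \<beta> * t)))"
                "integrable lborel (\<lambda>x. (3 / y) * ((U (Suc i) t x)\<^sup>2 * ?b x) + ((2 * \<kappa>\<^sup>2 + \<beta>) / y) * ((U i t x)\<^sup>2 * ?b x))"
                using iw by (intro Bochner_Integration.integrable_add Bochner_Integration.integrable_diff integrable_mult_right; simp)+
              fix x
              have 1: "(U j t x)\<^sup>2 * w1 (x - \<beta> * t) \<le> (U j t x)\<^sup>2 * (?b x / y)" for j
                by (intro mult_left_mono w1) auto
              have 2: "(U i t x)\<^sup>2 * (- w3 (x - \<beta> * t)) \<le> (U i t x)\<^sup>2 * (2 * \<kappa>\<^sup>2 * ?b x / y)"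
                using w3[of "x - \<beta> * t"] by (intro mult_left_mono) auto
              have "3 * ((U (Suc i) t x)\<^sup>2 * w1 (x - \<beta> * t)) - (U i t x)\<^sup>2 * w3 (x - \<beta> * t) + \<beta> * ((U i t x)\<^sup>2 * w1 (x - \<beta> * t))
                \<le> 3 * ((U (Suc i) t x)\<^sup>2 * (?b x / y)) + (U i t x)\<^sup>2 * (2 * \<kappa>\<^sup>2 * ?b x / y) + \<beta> * ((U i t x)\<^sup>2 * (?b x / y))"
                using 1[of "Suc i"] 2 mult_left_mono[OF 1[of i], of \<beta>] \<beta>0 by simp
              also have "\<dots> = (3 / y) * ((U (Suc i) t x)\<^sup>2 * ?b x) + ((2 * \<kappa>\<^sup>2 + \<beta>) / y) * ((U i t x)\<^sup>2 * ?b x)"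
                using y by (simp add: field_simps)
              finally show "3 * ((U (Suc i) t x)\<^sup>2 * w1 (x - \<beta> * t)) - (U i t x)\<^sup>2 * w3 (x - \<beta> * t) + \<beta> * ((U i t x)\<^sup>2 * w1 (x - \<beta> * t))
                \<le> (3 / y) * ((U (Suc i) t x)\<^sup>2 * ?b x) + ((2 * \<kappa>\<^sup>2 + \<beta>) / y) * ((U i t x)\<^sup>2 * ?b x)" .
            qed
            also have "\<dots> = (3 / y) * (LINT x|lborel. (U (Suc i) t x)\<^sup>2 * ?b x) + ((2 * \<kappa>\<^sup>2 + \<beta>) / y) * (LINT x|lborel. (U i t x)\<^sup>2 * ?b x)"
              by (subst Bochner_Integration.integral_add) (use iw(3) in \<open>auto intro: integrable_mult_right\<close>)
            also have "\<dots> \<le> (3 / y) * (B (Suc i) / y ^ n * exp (- \<gamma> * t)) + ((2 * \<kappa>\<^sup>2 + \<beta>) / y) * (B i / y ^ n * exp (- \<gamma> * t))"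
              using y \<beta>0 by (intro add_mono mult_left_mono B t) auto
            also have "\<dots> = B' i * exp (- \<gamma> * t) * (1 / y ^ Suc n)" using y by (simp add: B'_def field_simps)
            also have "\<dots> \<le> B' i * exp (- \<gamma> * t) * \<rho>" using \<rho>(3) B' by (intro mult_left_mono) auto
            finally show ?thesis .
          qed
        qed
        moreover have "(LINT x|lborel. (U s t x)\<^sup>2 * logistic \<kappa> (x - \<beta> * t - 2 * y)) \<le> (LINT x|lborel. (U s t x)\<^sup>2 * w0 (x - \<beta> * t))"
          by (intro integral_mono integrable_square_weight[OF w t] integrable_U_mult[OF t cl, where W=1] mult_left_mono w0)
            (auto simp: less_imp_le[OF logistic_pos] less_imp_le[OF logistic_less_1])
        moreover have "C * \<rho> * exp (- \<gamma> * t) \<le> C * (1 + K) / y ^ Suc n * exp (- \<gamma> * t)"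
        proof -
          have "exp (- \<kappa> * y) \<le> K / y ^ Suc n" unfolding K_def by (rule exp_minus_times_power_le[OF \<kappa>_pos y]) simp
          hence "\<rho> \<le> (1 + K) / y ^ Suc n" by (simp add: \<rho>_def add_divide_distrib)
          hence "C * \<rho> \<le> C * ((1 + K) / y ^ Suc n)" using C by (intro mult_left_mono)
          thus ?thesis by (intro mult_right_mono) auto
        qed
        ultimately show ?thesis by linarith
      qed
      \<comment> \<open>Halving the shift costs the factor \<open>2 ^ Suc n\<close>.\<close>
      have "(LINT x|lborel. (U s t x)\<^sup>2 * logistic \<kappa> (x - \<beta> * t - Y)) \<le> (C * (1 + K) * 2 ^ Suc n) / Y ^ Suc n * exp (- \<gamma> * t)"
        if "T0 \<le> t" "Y > 0" for t Y
        using est[OF that(1), of "Y / 2"] that(2) by (simp add: power_divide)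
      moreover have "0 \<le> C * (1 + K) * 2 ^ Suc n" using C K by simp
      ultimately show "\<exists>C\<ge>0. \<forall>t\<ge>T0. \<forall>Y>0. (LINT x|lborel. (U s t x)\<^sup>2 * logistic \<kappa> (x - \<beta> * t - Y)) \<le> C / Y ^ Suc n * exp (- \<gamma> * t)"
        by blast
    qed
  qed
  show ?thesis using \<gamma>(1) main by blast
qed

text \<open>As on the left, with the weight equal to 1/2 at the point itself. The exponent
  \<open>2 * n\<close> compensates the square root.\<close>

lemma right_pointwise:
  assumes \<beta>: "\<beta> > c N"
  shows "\<exists>C\<ge>0. \<forall>t\<ge>T0. \<forall>x>\<beta> * t. \<bar>U s t x\<bar> \<le> C / (x - \<beta> * t) ^ n"
proof -
  have k0: "0 \<le> \<kappa>" using \<kappa>_pos by simp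
  from right_weighted[OF \<beta>] obtain \<gamma> where \<gamma>: "\<gamma> > 0" and *: "\<forall>n s. \<exists>C\<ge>0. \<forall>t\<ge>T0. \<forall>Y>0.
    (LINT x|lborel. (U s t x)\<^sup>2 * logistic \<kappa> (x - \<beta> * t - Y)) \<le> C / Y ^ n * exp (- \<gamma> * t)" by blast
  have **: "\<exists>C\<ge>0. \<forall>t\<ge>T0. \<forall>Y>0. (LINT x|lborel. (U s t x)\<^sup>2 * logistic \<kappa> (x - \<beta> * t - Y)) \<le> C / Y ^ (2 * n)" for s
  proof -
    from * obtain C where C: "C \<ge> 0" "\<And>t Y. T0 \<le> t \<Longrightarrow> Y > 0 \<Longrightarrow>
      (LINT x|lborel. (U s t x)\<^sup>2 * logistic \<kappa> (x - \<beta> * t - Y)) \<le> C / Y ^ (2 * n) * exp (- \<gamma> * t)" by blast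
    have "C / Y ^ (2 * n) * exp (- \<gamma> * t) \<le> C / Y ^ (2 * n) * 1" if "T0 \<le> t" "Y > 0" for t Y
      using that C(1) \<gamma> T0 by (intro mult_left_mono) auto
    thus ?thesis using C order_trans by (intro exI[of _ C]) fastforce
  qed
  obtain C where C: "C \<ge> 0" "\<And>t Y. T0 \<le> t \<Longrightarrow> Y > 0 \<Longrightarrow>
      (LINT x|lborel. (U s t x)\<^sup>2 * logistic \<kappa> (x - \<beta> * t - Y)) \<le> C / Y ^ (2 * n)" using **[of s] by blast
  obtain C' where C': "C' \<ge> 0" "\<And>t Y. T0 \<le> t \<Longrightarrow> Y > 0 \<Longrightarrow>
      (LINT x|lborel. (U (Suc s) t x)\<^sup>2 * logistic \<kappa> (x - \<beta> * t - Y)) \<le> C' / Y ^ (2 * n)" using **[of "Suc s"] by blast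
  define D where "D = 2 * ((1 + \<kappa>) * (C + C'))"
  have D: "D \<ge> 0" unfolding D_def using C(1) C'(1) k0 by (intro mult_nonneg_nonneg add_nonneg_nonneg) auto
  have "\<bar>U s t x\<bar> \<le> sqrt D / (x - \<beta> * t) ^ n" if t: "T0 \<le> t" and x: "x > \<beta> * t" for t x
  proof -
    define Y where "Y = x - \<beta> * t"
    have Y: "Y > 0" using x by (simp add: Y_def)
    have w: "weight (\<lambda>y. logistic \<kappa> (y - Y)) (\<lambda>y. logistic1 \<kappa> (y - Y)) (\<lambda>y. logistic2 \<kappa> (y - Y)) (\<lambda>y. logistic3 \<kappa> (y - Y))"
      by (rule weight_logistic[OF k0])
    have "(U s t x)\<^sup>2 * logistic \<kappa> (x - \<beta> * t - Y) \<le> (1 + \<kappa>) *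
      ((LINT x|lborel. (U s t x)\<^sup>2 * logistic \<kappa> (x - \<beta> * t - Y)) + (LINT x|lborel. (U (Suc s) t x)\<^sup>2 * logistic \<kappa> (x - \<beta> * t - Y)))"
      by (rule U_square_le_weighted[OF t w])
        (use logistic1_nonneg[OF k0] logistic1_le[OF k0] in \<open>auto simp: less_imp_le[OF logistic_pos]\<close>)
    also have "\<dots> \<le> (1 + \<kappa>) * (C / Y ^ (2 * n) + C' / Y ^ (2 * n))"
      using k0 by (intro mult_left_mono add_mono C(2) C'(2) t Y) auto
    also have "logistic \<kappa> (x - \<beta> * t - Y) = 1 / 2" by (simp add: Y_def logistic_0)
    finally have "(U s t x)\<^sup>2 \<le> D / Y ^ (2 * n)" by (simp add: D_def algebra_simps add_divide_distrib)
    also have "\<dots> = (sqrt D / Y ^ n)\<^sup>2"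
      using D by (simp add: power_divide power_even_eq)
    finally have "\<bar>U s t x\<bar> \<le> \<bar>sqrt D / Y ^ n\<bar>" by (rule abs_le_square_iff[THEN iffD2])
    thus ?thesis using D Y by (simp add: Y_def)
  qed
  thus ?thesis using D by (intro exI[of _ "sqrt D"]) auto
qed

text \<open>The sum of solitons has the right shape; the error exp(-\<theta> t) has not. For 0 < x
  \<le> \<beta> t the distance to the slowest soliton is at most \<beta> t, so the error is absorbed
  at rate \<theta> / \<beta>. For x \<le> 0 this distance is unbounded and the decay to the left
  replaces the error bound.\<close>

lemma bulk_pointwise:
  assumes \<beta>: "\<beta> > c N" and k: "k = min (\<kappa> / 4) (\<theta> / \<beta>)"
  shows "\<exists>C>0. \<forall>t\<ge>T0. \<forall>x\<le>\<beta> * t. \<bar>U s t x\<bar> \<le> C * (\<Sum>j=1..N. exp (- k * \<bar>x - c j * t\<bar>))"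
proof -
  have \<beta>0: "\<beta> > 0" using \<beta> c_pos[of N] N by auto
  have k0: "0 < k" "k \<le> \<kappa> / 4" "k \<le> \<theta> / \<beta>" using \<kappa>_pos \<theta> \<beta>0 by (simp_all only: k min.cobounded1 min.cobounded2) simp
  hence "k \<le> \<kappa>" using \<kappa>_pos by linarith
  obtain C where C: "C \<ge> 0" "\<And>t x. T0 \<le> t \<Longrightarrow> \<bar>U s t x\<bar> \<le> C * exp (- \<kappa> * (c 1 / 2 * t - x) / 2)"
    using left_pointwise[of s] by blast
  obtain A where A: "A > 0" "\<And>t x. T0 \<le> t \<Longrightarrow> \<bar>U s t x\<bar> \<le> A * ((\<Sum>j=1..N. E j t x) + exp (- \<theta> * t))"
    using U_pointwise[of s] by blast
  have "\<bar>U s t x\<bar> \<le> (C + 2 * A) * (\<Sum>j=1..N. exp (- k * \<bar>x - c j * t\<bar>))" if t: "T0 \<le> t" and x: "x \<le> \<beta> * t" for t x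
  proof -
    let ?S = "\<Sum>j=1..N. exp (- k * \<bar>x - c j * t\<bar>)"
    have t0: "0 \<le> t" using t T0 by simp
    have S0: "0 \<le> ?S" by (intro sum_nonneg) auto
    have S1: "exp (- k * \<bar>x - c 1 * t\<bar>) \<le> ?S"
      using N by (intro member_le_sum[where f="\<lambda>j. exp (- k * \<bar>x - c j * t\<bar>)"]) auto
    show ?thesis
    proof (cases "x \<le> 0")
      case True
      have "c 1 * t \<ge> 0" using c1_pos t0 by simp
      \<comment> \<open>The distance is c 1 t - x here. Losing half of it to the frame, after the
        half lost to the square root, leads to \<kappa> / 4.\<close>
      hence "\<bar>x - c 1 * t\<bar> / 2 \<le> c 1 / 2 * t - x" using True by (simp add: field_simps)
      hence "\<kappa> / 2 * (\<bar>x - c 1 * t\<bar> / 2) \<le> \<kappa> / 2 * (c 1 / 2 * t - x)" using \<kappa>_pos by (intro mult_left_mono) auto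
      moreover have "k * \<bar>x - c 1 * t\<bar> \<le> \<kappa> / 4 * \<bar>x - c 1 * t\<bar>" using k0(2) by (rule mult_right_mono) simp
      ultimately have "exp (- \<kappa> * (c 1 / 2 * t - x) / 2) \<le> exp (- k * \<bar>x - c 1 * t\<bar>)" by simp
      also note S1
      finally have "C * exp (- \<kappa> * (c 1 / 2 * t - x) / 2) \<le> C * ?S" using C(1) by (rule mult_left_mono)
      also have "\<dots> \<le> (C + 2 * A) * ?S" using A(1) S0 by (intro mult_right_mono) auto
      finally show ?thesis using C(2)[OF t, of x] by linarith
    next
      case False
      have "c 1 * t \<le> \<beta> * t" using c_le(2)[of 1] \<beta> N t0 by (intro mult_right_mono) auto
      moreover have "c 1 * t \<ge> 0" using c1_pos t0 by simp
      ultimately have "\<bar>x - c 1 * t\<bar> \<le> \<beta> * t" using False x by linarith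
      hence "k * \<bar>x - c 1 * t\<bar> \<le> \<theta> / \<beta> * (\<beta> * t)" using k0 \<beta>0 \<theta> by (intro mult_mono) auto
      hence "exp (- \<theta> * t) \<le> exp (- k * \<bar>x - c 1 * t\<bar>)" using \<beta>0 by simp
      hence 1: "exp (- \<theta> * t) \<le> ?S" using S1 by linarith
      have 2: "(\<Sum>j=1..N. E j t x) \<le> ?S"
      proof (intro sum_mono)
        fix j
        have "k * \<bar>x - c j * t\<bar> \<le> \<kappa> * \<bar>x - c j * t\<bar>" using \<open>k \<le> \<kappa>\<close> by (rule mult_right_mono) simp
        thus "E j t x \<le> exp (- k * \<bar>x - c j * t\<bar>)" by (simp add: E_def)
      qed
      have "\<bar>U s t x\<bar> \<le> A * (?S + ?S)"
        using order_trans[OF A(2)[OF t, of x] mult_left_mono[OF add_mono[OF 2 1]]] A(1) by simp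
      also have "\<dots> \<le> (C + 2 * A) * ?S" using C(1) S0 by (simp add: algebra_simps)
      finally show ?thesis .
    qed
  qed
  moreover have "C + 2 * A > 0" using A(1) C(1) by simp
  ultimately show ?thesis by blast
qed

end

theorem theorem1p4:
  fixes p N :: nat and c x0 :: "nat \<Rightarrow> real" and u :: "real \<Rightarrow> real \<Rightarrow> real"
    and T0 \<theta> \<beta> :: real and \<Lambda> :: "nat \<Rightarrow> real"
  assumes "p \<ge> 2" and "N \<ge> 1"
    and "\<And>j. j \<in> {1..N} \<Longrightarrow> 0 < c j" and "strict_mono_on {1..N} c"
    and "T0 \<ge> 0"
    and "multi_soliton p N c x0 T0 u"
    \<comment> \<open>each \<open>u t\<close> is the continuous representative of its class\<close>
    and "\<And>t. t \<ge> T0 \<Longrightarrow> continuous_on UNIV (u t)"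
    and "\<And>s. continuous_in_sobolev s {T0..} u"
    and "\<theta> > 0" and "\<And>s. \<Lambda> s > 0"
    and "\<And>s t. t \<ge> T0 \<Longrightarrow>
           sobolev_norm s (\<lambda>x. u t x - soliton_sum p N c x0 t x) \<le> \<Lambda> s * exp (- \<theta> * t)"
    and "\<beta> > c N"
  shows "\<exists>T1 \<kappa>. T1 > 0 \<and> T1 \<ge> T0 \<and> \<kappa> > 0 \<and>
    (\<forall>s::nat.
      (\<exists>C>0. \<forall>t\<ge>T1. \<forall>x\<le>\<beta> * t.
          \<bar>(deriv ^^ s) (u t) x\<bar> \<le> C * (\<Sum>j=1..N. exp (- \<kappa> * \<bar>x - c j * t\<bar>))) \<and>
      (\<forall>n::nat. \<exists>C>0. \<forall>t\<ge>T1. \<forall>x>\<beta> * t.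
          \<bar>(deriv ^^ s) (u t) x\<bar> \<le> C / (x - \<beta> * t) ^ n))"
proof -
  interpret gkdv_multi_soliton p N c x0 u T0 \<theta> \<Lambda>
    by unfold_locales (use assms in \<open>auto simp: multi_soliton_def\<close>)
  define k where "k = min (\<kappa> / 4) (\<theta> / \<beta>)"
  have \<beta>: "\<beta> > c N" by fact
  have "\<beta> > 0" using \<beta> c_pos[of N] N by auto
  hence k: "k > 0" using \<kappa>_pos \<theta> by (simp add: k_def)
  show ?thesis
  \<comment> \<open>The maximum with 1 provides a positive time when \<open>T0\<close> is 0.\<close>
  proof (rule exI[of _ "max T0 1"], rule exI[of _ k], intro conjI allI)
    fix s n :: nat
    show "\<exists>C>0. \<forall>t\<ge>max T0 1. \<forall>x\<le>\<beta> * t. \<bar>(deriv ^^ s) (u t) x\<bar> \<le> C * (\<Sum>j=1..N. exp (- k * \<bar>x - c j * t\<bar>))"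
      using bulk_pointwise[OF \<beta> k_def, of s] unfolding U_def by (meson max.boundedE)
    obtain C where C: "C \<ge> 0" "\<And>t x. T0 \<le> t \<Longrightarrow> \<beta> * t < x \<Longrightarrow> \<bar>U s t x\<bar> \<le> C / (x - \<beta> * t) ^ n"
      using right_pointwise[OF \<beta>, of s n] by blast
    show "\<exists>C>0. \<forall>t\<ge>max T0 1. \<forall>x>\<beta> * t. \<bar>(deriv ^^ s) (u t) x\<bar> \<le> C / (x - \<beta> * t) ^ n"
    \<comment> \<open>\<open>C\<close> may be zero, while the constant has to be positive.\<close>
    proof (intro exI[of _ "C + 1"] conjI allI impI)
      fix t x assume "t \<ge> max T0 1" and x: "x > \<beta> * t"
      hence "\<bar>U s t x\<bar> \<le> C / (x - \<beta> * t) ^ n" using C(2) by simp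
      also have "\<dots> \<le> (C + 1) / (x - \<beta> * t) ^ n" using x by (intro divide_right_mono) auto
      finally show "\<bar>(deriv ^^ s) (u t) x\<bar> \<le> (C + 1) / (x - \<beta> * t) ^ n" by (simp add: U_def)
    qed (use C in auto)
  qed (use k in auto)
qed

end
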